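(* Let $m,n\in\mathbb{Z}\setminus\{0\}$, let $\Gamma=\operatorname{BS}(m,n)=\langle a,t\mid ta^mt^{-1}=a^n\rangle$ (discrete), let $\Lambda=\langle a\rangle$, and let $G_{m,n}$ be the Schlichting completion of $(\Gamma,\Lambda)$, with structure map $\alpha\colon\Gamma\to G_{m,n}$. Let $\tau\colon\Gamma\to\mathbb{R}$ be the character with $\tau(a)=0$, $\tau(t)=1$, and let $\bar\tau\colon G_{m,n}\to\mathbb{R}$ be the induced character, i.e. the unique continuous homomorphism with $\bar\tau\circ\alpha=\tau$. The homotopical $\Sigma$-sets of $G_{m,n}$ are given by: (1) if $|mn|=1$, then $\Sigma^k_{\mathrm{top}}(G_{m,n})=\mathbb{R}\bar\tau$ for all $k\ge1$; (2) if $|m|=1$ and $|n|\ge2$, then $\Sigma^k_{\mathrm{top}}(G_{m,n})=\{\lambda\bar\tau\mid\lambda\le0\}$ for all $k\ge1$; (3) if $|m|\ge2$ and $|n|=1$, then $\Sigma^k_{\mathrm{top}}(G_{m,n})=\{\lambda\bar\tau\mid\lambda\ge0\}$ for all $k\ge1$; (4) if $|m|\ge2$ and $|n|\ge2$, then $\Sigma^k_{\mathrm{top}}(G_{m,n})=\{0\}$ for all $k\ge1$. Moreover, for every commutative ring $R$, every $m,n\in\mathbb{Z}\setminus\{0\}$ and every $k\in\mathbb{N}$, we have $\Sigma^k_{\mathrm{top}}(G_{m,n};R)=\Sigma^k_{\mathrm{top}}(G_{m,n})$.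
   Context: Conventions: $\mathbb{N}$ includes $0$; rings have a unit. The subgroup $\Lambda=\langle a\rangle$ is commensurated in $\Gamma$ (every conjugate $g\Lambda g^{-1}$ meets $\Lambda$ in a subgroup of finite index in both). The Schlichting completion of $(\Gamma,\Lambda)$ is the closure of $\alpha(\Gamma)$ in $\operatorname{Sym}(\Gamma/\Lambda)$ with the topology of pointwise convergence ($\Gamma/\Lambda$ discrete), where $\alpha\colon\Gamma\to\operatorname{Sym}(\Gamma/\Lambda)$ is the left multiplication action on left cosets; it is a totally disconnected locally compact group. For a set $X$, $\operatorname{E}X$ is the simplicial set whose $k$-simplices are the tuples $(x_0,\dots,x_k)\in X^{k+1}$, the $i$-th face (degeneracy) map deleting (doubling) the $i$-th entry. For a topological space $X$, $\mathcal{C}(X)$ is the poset of compact subspaces ordered by inclusion. A filtration of a simplicial set $Y$ over a directed poset $A$ is a family of simplicial subsets $(Y_\alpha)_{\alpha\in A}$ with union $Y$ and $Y_\alpha\subseteq Y_\beta$ for $\alpha\le\beta$. For $Y$ connected, it is essentially $q$-connected if for some (equivalently every) vertex $y$, for all $0\le k\le q$ and every $\alpha$ with $y\in Y_\alpha$ there is $\beta\ge\alpha$ such that $\pi_k(|Y_\alpha|,y)\to\pi_k(|Y_\beta|,y)$ is trivial; it is essentially $q$-acyclic over $R$ if for all $0\le k\le q$ and every $\alpha$ there is $\beta\ge\alpha$ such that $\tilde{\operatorname{H}}_k(Y_\alpha;R)\to\tilde{\operatorname{H}}_k(Y_\beta;R)$ is zero. Both are vacuous for $q=-1$. For a locally compact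 Hausdorff group $G$ and a character (continuous homomorphism) $\chi\colon G\to\mathbb{R}$, put $G_\chi=\chi^{-1}([0,+\infty))$ and $G_\chi\cdot\operatorname{E}C=\bigcup_{g\in G_\chi}g\cdot\operatorname{E}C\subseteq\operatorname{E}G$ (left multiplication) for $C\in\mathcal{C}(G)$. Then $\Sigma^k_{\mathrm{top}}(G)$ (resp. $\Sigma^k_{\mathrm{top}}(G;R)$) is the set of characters $\chi$ for which the filtration $(G_\chi\cdot\operatorname{E}C)_{C\in\mathcal{C}(G)}$ of $\operatorname{E}G$ is essentially $(k-1)$-connected (resp. essentially $(k-1)$-acyclic over $R$).
   Formalization: The commutative ring R is assumed to be nonzero; for R = 0 every filtration is essentially acyclic, so the last claim fails (for example for m = n = 2, k = 1). *)

theory Defs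
  imports "HOL-Analysis.Analysis" "HOL-Homology.Homology" "HOL-Algebra.Bij" "HOL-Algebra.Left_Coset"
begin

section \<open>Group presentations and Baumslag-Solitar groups\<close>

text \<open>A word in the generators of type \<open>'g\<close> and their formal inverses: \<open>(x, True)\<close> stands for
  \<open>x\<close> and \<open>(x, False)\<close> for its inverse.\<close>

type_synonym 'g word = "('g \<times> bool) list"

definition word_pow :: "'g \<Rightarrow> int \<Rightarrow> 'g word" where
  "word_pow x k = replicate (nat \<bar>k\<bar>) (x, 0 \<le> k)"

inductive pres_eq :: "('g word \<times> 'g word) set \<Rightarrow> 'g word \<Rightarrow> 'g word \<Rightarrow> bool"
  for R :: "('g word \<times> 'g word) set" where
  refl: "pres_eq R u u"
| sym: "pres_eq R u v \<Longrightarrow> pres_eq R v u"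
| trans: "pres_eq R u v \<Longrightarrow> pres_eq R v w \<Longrightarrow> pres_eq R u w"
| cancel: "pres_eq R (u @ [(x, b), (x, \<not> b)] @ v) (u @ v)"
| relation: "(r, s) \<in> R \<Longrightarrow> pres_eq R (u @ r @ v) (u @ s @ v)"

definition word_class :: "('g word \<times> 'g word) set \<Rightarrow> 'g word \<Rightarrow> 'g word set" where
  "word_class R u = {v. pres_eq R u v}"

text \<open>The group generated by all elements of \<open>'g\<close> subject to the relations \<open>r = s\<close> for
  \<open>(r, s) \<in> R\<close>.\<close>

definition presented_group :: "('g word \<times> 'g word) set \<Rightarrow> 'g word set monoid" where
  "presented_group R =
     \<lparr>carrier = range (word_class R),
      monoid.mult = (\<lambda>A B. \<Union>u\<in>A. \<Union>v\<in>B. word_class R (u @ v)),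
      one = word_class R []\<rparr>"

datatype bs_gen = gen_a | gen_t

definition bs_relations :: "int \<Rightarrow> int \<Rightarrow> (bs_gen word \<times> bs_gen word) set" where
  "bs_relations m n = {(word_pow gen_t 1 @ word_pow gen_a m @ word_pow gen_t (- 1), word_pow gen_a n)}"

definition BS :: "int \<Rightarrow> int \<Rightarrow> bs_gen word set monoid" where
  "BS m n = presented_group (bs_relations m n)"

definition bs_elt :: "int \<Rightarrow> int \<Rightarrow> bs_gen \<Rightarrow> bs_gen word set" where
  "bs_elt m n x = word_class (bs_relations m n) (word_pow x 1)"


section \<open>Schlichting completions\<close>

definition sym_topology :: "'x set \<Rightarrow> ('x \<Rightarrow> 'x) topology" where
  "sym_topology X = subtopology (product_topology (\<lambda>_. discrete_topology X) X) (Bij X)"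

definition coset_action :: "('g, 'm) monoid_scheme \<Rightarrow> 'g set \<Rightarrow> 'g \<Rightarrow> 'g set \<Rightarrow> 'g set" where
  "coset_action \<Gamma> \<Lambda> g = (\<lambda>C \<in> lcosets\<^bsub>\<Gamma>\<^esub> \<Lambda>. g <#\<^bsub>\<Gamma>\<^esub> C)"

definition schlichting_group ::
    "('g, 'm) monoid_scheme \<Rightarrow> 'g set \<Rightarrow> ('g set \<Rightarrow> 'g set) monoid" where
  "schlichting_group \<Gamma> \<Lambda> = (BijGroup (lcosets\<^bsub>\<Gamma>\<^esub> \<Lambda>))
     \<lparr>carrier := sym_topology (lcosets\<^bsub>\<Gamma>\<^esub> \<Lambda>) closure_of (coset_action \<Gamma> \<Lambda> ` carrier \<Gamma>)\<rparr>"

definition schlichting_topology ::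
    "('g, 'm) monoid_scheme \<Rightarrow> 'g set \<Rightarrow> ('g set \<Rightarrow> 'g set) topology" where
  "schlichting_topology \<Gamma> \<Lambda> =
     subtopology (sym_topology (lcosets\<^bsub>\<Gamma>\<^esub> \<Lambda>)) (carrier (schlichting_group \<Gamma> \<Lambda>))"


section \<open>Characters\<close>

definition real_group :: "real monoid" where
  "real_group = \<lparr>carrier = UNIV, monoid.mult = (+), one = 0\<rparr>"

text \<open>A topological group is given by a group \<open>G\<close> together with a topology \<open>T\<close> on its carrier.
  Characters are extensional, i.e. \<open>undefined\<close> off the carrier, so that equality of characters
  is equality of functions on the carrier.\<close>

definition characters :: "('g, 'm) monoid_scheme \<Rightarrow> 'g topology \<Rightarrow> ('g \<Rightarrow> real) set" where
  "characters G T =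
     {\<psi> \<in> hom G real_group. continuous_map T euclideanreal \<psi> \<and> \<psi> \<in> extensional (carrier G)}"

definition scale_character :: "('g, 'm) monoid_scheme \<Rightarrow> real \<Rightarrow> ('g \<Rightarrow> real) \<Rightarrow> 'g \<Rightarrow> real" where
  "scale_character G c \<psi> = (\<lambda>x \<in> carrier G. c * \<psi> x)"

definition zero_character :: "('g, 'm) monoid_scheme \<Rightarrow> 'g \<Rightarrow> real" where
  "zero_character G = (\<lambda>x \<in> carrier G. 0)"


section \<open>Simplicial sets\<close>

text \<open>\<open>face k i\<close> and \<open>degen k i\<close> are the \<open>i\<close>-th face and degeneracy map defined on the
  \<open>k\<close>-simplices (so only \<open>i \<le> k\<close> matters, and \<open>k \<ge> 1\<close> for faces).\<close>

record 'x sset =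
  simplices :: "nat \<Rightarrow> 'x set"
  face :: "nat \<Rightarrow> nat \<Rightarrow> 'x \<Rightarrow> 'x"
  degen :: "nat \<Rightarrow> nat \<Rightarrow> 'x \<Rightarrow> 'x"

definition EE :: "'a set \<Rightarrow> 'a list sset" where
  "EE X = \<lparr>simplices = (\<lambda>k. {xs. length xs = Suc k \<and> set xs \<subseteq> X}),
           face = (\<lambda>k i xs. take i xs @ drop (Suc i) xs),
           degen = (\<lambda>k i xs. take (Suc i) xs @ drop i xs)\<rparr>"

subsection \<open>Geometric realization\<close>

text \<open>The cofaces of the standard simplices are the library's \<open>simplical_face\<close>; the
  codegeneracies are as follows.\<close>

definition simplical_degen :: "nat \<Rightarrow> (nat \<Rightarrow> real) \<Rightarrow> nat \<Rightarrow> real" where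
  "simplical_degen i x = (\<lambda>j. if j < i then x j else if j = i then x i + x (Suc i) else x (Suc j))"

definition presimplex_topology :: "'x sset \<Rightarrow> ((nat \<times> 'x) \<times> (nat \<Rightarrow> real)) topology" where
  "presimplex_topology Y =
     sum_topology (\<lambda>(k, \<sigma>). subtopology (powertop_real UNIV) (standard_simplex k))
       (SIGMA k:UNIV. simplices Y k)"

definition gluing :: "'x sset \<Rightarrow> (((nat \<times> 'x) \<times> (nat \<Rightarrow> real)) \<times> ((nat \<times> 'x) \<times> (nat \<Rightarrow> real))) set" where
  "gluing Y =
     {(((k, face Y (Suc k) i \<sigma>), x), ((Suc k, \<sigma>), simplical_face i x)) | k i \<sigma> x.
        \<sigma> \<in> simplices Y (Suc k) \<and> i \<le> Suc k \<and> x \<in> standard_simplex k} \<union>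
     {(((Suc k, degen Y k i \<sigma>), x), ((k, \<sigma>), simplical_degen i x)) | k i \<sigma> x.
        \<sigma> \<in> simplices Y k \<and> i \<le> k \<and> x \<in> standard_simplex (Suc k)}"

definition gluing_equiv ::
    "'x sset \<Rightarrow> (((nat \<times> 'x) \<times> (nat \<Rightarrow> real)) \<times> ((nat \<times> 'x) \<times> (nat \<Rightarrow> real))) set" where
  "gluing_equiv Y = (gluing Y \<union> (gluing Y)\<inverse>)\<^sup>* \<inter>
     topspace (presimplex_topology Y) \<times> topspace (presimplex_topology Y)"

definition quotient_topology :: "'a topology \<Rightarrow> ('a \<times> 'a) set \<Rightarrow> 'a set topology" where
  "quotient_topology X r = topology (\<lambda>U. U \<subseteq> topspace X // r \<and> openin X {x \<in> topspace X. r `` {x} \<in> U})"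

type_synonym 'x realization_point = "((nat \<times> 'x) \<times> (nat \<Rightarrow> real)) set"

definition realization :: "'x sset \<Rightarrow> 'x realization_point topology" where
  "realization Y = quotient_topology (presimplex_topology Y) (gluing_equiv Y)"

text \<open>The only point of the standard \<open>0\<close>-simplex is \<open>\<lambda>i. if i = 0 then 1 else 0\<close>.\<close>

definition vertex_point :: "'x sset \<Rightarrow> 'x \<Rightarrow> 'x realization_point" where
  "vertex_point Y y = gluing_equiv Y `` {((0, y), \<lambda>i. if i = 0 then 1 else 0)}"

text \<open>The map of realizations induced by the inclusion of a simplicial subset into \<open>Z\<close>.\<close>

definition realization_incl :: "'x sset \<Rightarrow> 'x realization_point \<Rightarrow> 'x realization_point" where
  "realization_incl Z p = gluing_equiv Z `` p"


section \<open>Homotopy groups\<close>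

text \<open>Elements of the \<open>k\<close>-th homotopy group (pointed set if \<open>k = 0\<close>) of \<open>(X, p)\<close> are the classes,
  up to homotopy relative to the boundary, of maps from the \<open>k\<close>-cube to \<open>X\<close> that send the
  boundary to \<open>p\<close>. The \<open>0\<close>-cube is a point with empty boundary.\<close>

definition cube :: "nat \<Rightarrow> (nat \<Rightarrow> real) topology" where
  "cube k = product_topology (\<lambda>_. top_of_set {0..1}) {..<k}"

definition cube_boundary :: "nat \<Rightarrow> (nat \<Rightarrow> real) set" where
  "cube_boundary k = {x \<in> topspace (cube k). \<exists>i<k. x i = 0 \<or> x i = 1}"

definition cube_maps :: "nat \<Rightarrow> 'b topology \<Rightarrow> 'b \<Rightarrow> ((nat \<Rightarrow> real) \<Rightarrow> 'b) set" where
  "cube_maps k X p = {f. continuous_map (cube k) X f \<and> (\<forall>x\<in>cube_boundary k. f x = p)}"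

definition cube_homotopy ::
    "nat \<Rightarrow> 'b topology \<Rightarrow> 'b \<Rightarrow> (((nat \<Rightarrow> real) \<Rightarrow> 'b) \<times> ((nat \<Rightarrow> real) \<Rightarrow> 'b)) set" where
  "cube_homotopy k X p =
     {(f, g). homotopic_with (\<lambda>h. \<forall>x\<in>cube_boundary k. h x = p) (cube k) X f g}"

definition homotopy_group :: "nat \<Rightarrow> 'b topology \<Rightarrow> 'b \<Rightarrow> ((nat \<Rightarrow> real) \<Rightarrow> 'b) set set" where
  "homotopy_group k X p = cube_maps k X p // cube_homotopy k X p"

definition homotopy_one :: "nat \<Rightarrow> 'b topology \<Rightarrow> 'b \<Rightarrow> ((nat \<Rightarrow> real) \<Rightarrow> 'b) set" where
  "homotopy_one k X p = cube_homotopy k X p `` {\<lambda>_. p}"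

text \<open>The map to the \<open>k\<close>-th homotopy group of \<open>(X', p')\<close> induced by a map \<open>\<phi>\<close> into \<open>X'\<close>.\<close>

definition homotopy_induced ::
    "nat \<Rightarrow> 'c topology \<Rightarrow> 'c \<Rightarrow> ('b \<Rightarrow> 'c) \<Rightarrow> ((nat \<Rightarrow> real) \<Rightarrow> 'b) set \<Rightarrow> ((nat \<Rightarrow> real) \<Rightarrow> 'c) set" where
  "homotopy_induced k X' p' \<phi> c = cube_homotopy k X' p' `` ((\<lambda>f. \<phi> \<circ> f) ` c)"


section \<open>Reduced simplicial homology\<close>

text \<open>Homology is that of the augmented unnormalized chain complex; chains are finitely supported
  functions.\<close>

definition chains :: "nat \<Rightarrow> 'x sset \<Rightarrow> ('x \<Rightarrow>\<^sub>0 'r::comm_ring_1) set" where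
  "chains k Y = {c. Poly_Mapping.keys c \<subseteq> simplices Y k}"

definition sset_boundary :: "nat \<Rightarrow> 'x sset \<Rightarrow> ('x \<Rightarrow>\<^sub>0 'r::comm_ring_1) \<Rightarrow> ('x \<Rightarrow>\<^sub>0 'r)" where
  "sset_boundary k Y c = (\<Sum>\<sigma>\<in>Poly_Mapping.keys c. \<Sum>i\<le>k.
     Poly_Mapping.single (face Y k i \<sigma>) ((- 1) ^ i * Poly_Mapping.lookup c \<sigma>))"

definition augmentation :: "('x \<Rightarrow>\<^sub>0 'r::comm_ring_1) \<Rightarrow> 'r" where
  "augmentation c = (\<Sum>\<sigma>\<in>Poly_Mapping.keys c. Poly_Mapping.lookup c \<sigma>)"

definition reduced_cycles :: "nat \<Rightarrow> 'x sset \<Rightarrow> ('x \<Rightarrow>\<^sub>0 'r::comm_ring_1) set" where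
  "reduced_cycles k Y =
     {c \<in> chains k Y. if k = 0 then augmentation c = 0 else sset_boundary k Y c = 0}"

definition boundaries :: "nat \<Rightarrow> 'x sset \<Rightarrow> ('x \<Rightarrow>\<^sub>0 'r::comm_ring_1) set" where
  "boundaries k Y = sset_boundary (Suc k) Y ` chains (Suc k) Y"

definition cycle_group :: "nat \<Rightarrow> 'x sset \<Rightarrow> ('x \<Rightarrow>\<^sub>0 'r::comm_ring_1) monoid" where
  "cycle_group k Y = \<lparr>carrier = reduced_cycles k Y, monoid.mult = (+), one = 0\<rparr>"

definition reduced_homology :: "nat \<Rightarrow> 'x sset \<Rightarrow> ('x \<Rightarrow>\<^sub>0 'r::comm_ring_1) set monoid" where
  "reduced_homology k Y = cycle_group k Y Mod boundaries k Y"

text \<open>The map induced by the inclusion of a simplicial subset into \<open>Z\<close> sends \<open>c + B(Y)\<close> to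
  \<open>c + B(Z)\<close>, which is \<open>B(Z) + (c + B(Y))\<close>.\<close>

definition homology_incl ::
    "nat \<Rightarrow> 'x sset \<Rightarrow> ('x \<Rightarrow>\<^sub>0 'r::comm_ring_1) set \<Rightarrow> ('x \<Rightarrow>\<^sub>0 'r) set" where
  "homology_incl k Z C = boundaries k Z <#>\<^bsub>cycle_group k Z\<^esub> C"


section \<open>Filtrations\<close>

text \<open>In the following two definitions \<open>(F \<alpha>)\<close> for \<open>\<alpha> \<in> A\<close> is a filtration of the simplicial set
  \<open>Y\<close> over the directed poset \<open>(A, leq)\<close>. The integer \<open>q\<close> may be \<open>- 1\<close>.\<close>

definition essentially_connected ::
    "int \<Rightarrow> 'i set \<Rightarrow> ('i \<Rightarrow> 'i \<Rightarrow> bool) \<Rightarrow> 'x sset \<Rightarrow> ('i \<Rightarrow> 'x sset) \<Rightarrow> bool" where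
  "essentially_connected q A leq Y F \<longleftrightarrow>
     (\<exists>y\<in>simplices Y 0. \<forall>k. int k \<le> q \<longrightarrow>
       (\<forall>\<alpha>\<in>A. y \<in> simplices (F \<alpha>) 0 \<longrightarrow>
         (\<exists>\<beta>\<in>A. leq \<alpha> \<beta> \<and>
           (\<forall>c\<in>homotopy_group k (realization (F \<alpha>)) (vertex_point (F \<alpha>) y).
              homotopy_induced k (realization (F \<beta>)) (vertex_point (F \<beta>) y)
                (realization_incl (F \<beta>)) c
              = homotopy_one k (realization (F \<beta>)) (vertex_point (F \<beta>) y)))))"

definition essentially_acyclic ::
    "'r::comm_ring_1 itself \<Rightarrow> int \<Rightarrow> 'i set \<Rightarrow> ('i \<Rightarrow> 'i \<Rightarrow> bool) \<Rightarrow> ('i \<Rightarrow> 'x sset) \<Rightarrow> bool" where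
  "essentially_acyclic (_ :: 'r itself) q A leq F \<longleftrightarrow>
     (\<forall>k. int k \<le> q \<longrightarrow> (\<forall>\<alpha>\<in>A. \<exists>\<beta>\<in>A. leq \<alpha> \<beta> \<and>
        (\<forall>c\<in>carrier (reduced_homology k (F \<alpha>) :: ('x \<Rightarrow>\<^sub>0 'r) set monoid).
           homology_incl k (F \<beta>) c = \<one>\<^bsub>reduced_homology k (F \<beta>)\<^esub>)))"


section \<open>Sigma-sets\<close>

definition char_halfspace :: "('g, 'm) monoid_scheme \<Rightarrow> ('g \<Rightarrow> real) \<Rightarrow> 'g set" where
  "char_halfspace G \<psi> = {g \<in> carrier G. 0 \<le> \<psi> g}"

definition translates :: "('g, 'm) monoid_scheme \<Rightarrow> 'g set \<Rightarrow> 'g set \<Rightarrow> 'g list sset" where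
  "translates G S C =
     (EE (carrier G))\<lparr>simplices := (\<lambda>k. \<Union>g\<in>S. map (\<lambda>x. g \<otimes>\<^bsub>G\<^esub> x) ` simplices (EE C) k)\<rparr>"

definition Sigma_top :: "nat \<Rightarrow> ('g, 'm) monoid_scheme \<Rightarrow> 'g topology \<Rightarrow> ('g \<Rightarrow> real) set" where
  "Sigma_top k G T = {\<psi> \<in> characters G T.
     essentially_connected (int k - 1) {C. compactin T C} (\<subseteq>) (EE (carrier G))
       (translates G (char_halfspace G \<psi>))}"

definition Sigma_top_hom ::
    "'r::comm_ring_1 itself \<Rightarrow> nat \<Rightarrow> ('g, 'm) monoid_scheme \<Rightarrow> 'g topology \<Rightarrow> ('g \<Rightarrow> real) set" where
  "Sigma_top_hom R k G T = {\<psi> \<in> characters G T.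
     essentially_acyclic R (int k - 1) {C. compactin T C} (\<subseteq>)
       (translates G (char_halfspace G \<psi>))}"


section \<open>Schlichting completions of Baumslag-Solitar groups\<close>

definition bs_subgroup :: "int \<Rightarrow> int \<Rightarrow> bs_gen word set set" where
  "bs_subgroup m n = generate (BS m n) {bs_elt m n gen_a}"

abbreviation G_BS :: "int \<Rightarrow> int \<Rightarrow> (bs_gen word set set \<Rightarrow> bs_gen word set set) monoid" where
  "G_BS m n \<equiv> schlichting_group (BS m n) (bs_subgroup m n)"

abbreviation T_BS :: "int \<Rightarrow> int \<Rightarrow> (bs_gen word set set \<Rightarrow> bs_gen word set set) topology" where
  "T_BS m n \<equiv> schlichting_topology (BS m n) (bs_subgroup m n)"

definition bs_structure_map ::
    "int \<Rightarrow> int \<Rightarrow> bs_gen word set \<Rightarrow> bs_gen word set set \<Rightarrow> bs_gen word set set" where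
  "bs_structure_map m n = coset_action (BS m n) (bs_subgroup m n)"

definition tau :: "int \<Rightarrow> int \<Rightarrow> bs_gen word set \<Rightarrow> real" where
  "tau m n = (THE \<psi>. \<psi> \<in> characters (BS m n) (discrete_topology (carrier (BS m n))) \<and>
     \<psi> (bs_elt m n gen_a) = 0 \<and> \<psi> (bs_elt m n gen_t) = 1)"

definition tau_bar :: "int \<Rightarrow> int \<Rightarrow> (bs_gen word set set \<Rightarrow> bs_gen word set set) \<Rightarrow> real" where
  "tau_bar m n = (THE \<psi>. \<psi> \<in> characters (G_BS m n) (T_BS m n) \<and>
     (\<forall>g\<in>carrier (BS m n). \<psi> (bs_structure_map m n g) = tau m n g))"


section \<open>Well-definedness\<close>

text \<open>The quotient topology is a topology, presented groups are groups, and the characters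
  \<open>tau\<close> and \<open>tau_bar\<close> introduced by definite description exist and are unique.\<close>

lemma istopology_quotient_topology:
  "istopology (\<lambda>U. U \<subseteq> topspace X // r \<and> openin X {x \<in> topspace X. r `` {x} \<in> U})"
  unfolding istopology_def
proof (intro conjI allI impI)
  fix S T assume S: "S \<subseteq> topspace X // r \<and> openin X {x \<in> topspace X. r `` {x} \<in> S}"
    and T: "T \<subseteq> topspace X // r \<and> openin X {x \<in> topspace X. r `` {x} \<in> T}"
  have "{x \<in> topspace X. r `` {x} \<in> S \<inter> T} =
      {x \<in> topspace X. r `` {x} \<in> S} \<inter> {x \<in> topspace X. r `` {x} \<in> T}" by blast
  then show "openin X {x \<in> topspace X. r `` {x} \<in> S \<inter> T}" using S T by (simp add: openin_Int)
  show "S \<inter> T \<subseteq> topspace X // r" using S by blast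
next
  fix K assume K: "\<forall>U\<in>K. U \<subseteq> topspace X // r \<and> openin X {x \<in> topspace X. r `` {x} \<in> U}"
  have "{x \<in> topspace X. r `` {x} \<in> \<Union>K} = (\<Union>U\<in>K. {x \<in> topspace X. r `` {x} \<in> U})" by blast
  then show "openin X {x \<in> topspace X. r `` {x} \<in> \<Union>K}" using K by auto
  show "\<Union>K \<subseteq> topspace X // r" using K by blast
qed

lemma pres_eq_context: "pres_eq R u v \<Longrightarrow> pres_eq R (x @ u @ y) (x @ v @ y)"
proof (induction rule: pres_eq.induct)
  case (cancel u z b v)
  then show ?case using pres_eq.cancel[of R "x @ u" z b "v @ y"] by simp
next
  case (relation r s u v)
  then show ?case using pres_eq.relation[of r s R "x @ u" "v @ y"] by simp
qed (auto intro: pres_eq.intros)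

lemma pres_eq_append: "pres_eq R u u' \<Longrightarrow> pres_eq R v v' \<Longrightarrow> pres_eq R (u @ v) (u' @ v')"
  using pres_eq_context[of R u u' "[]" v] pres_eq_context[of R v v' u' "[]"]
  by (auto intro: pres_eq.trans)

lemma word_class_eq_iff: "word_class R u = word_class R v \<longleftrightarrow> pres_eq R u v"
  unfolding word_class_def by (blast intro: pres_eq.intros)

lemma presented_group_mult:
  "word_class R u \<otimes>\<^bsub>presented_group R\<^esub> word_class R v = word_class R (u @ v)"
proof -
  have "word_class R (u' @ v') = word_class R (u @ v)"
    if "u' \<in> word_class R u" "v' \<in> word_class R v" for u' v'
    using that unfolding word_class_eq_iff
    by (simp add: word_class_def pres_eq_append pres_eq.sym)
  moreover have "u \<in> word_class R u" "v \<in> word_class R v"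
    by (auto simp: word_class_def pres_eq.refl)
  ultimately have "(\<Union>u'\<in>word_class R u. \<Union>v'\<in>word_class R v. word_class R (u' @ v')) = word_class R (u @ v)"
    by blast
  then show ?thesis by (simp add: presented_group_def)
qed

lemma pres_eq_inverse: "pres_eq R (rev (map (\<lambda>(x, b). (x, \<not> b)) w) @ w) []"
proof (induction w)
  case Nil
  show ?case by (simp add: pres_eq.refl)
next
  case (Cons z w)
  obtain x b where z: "z = (x, b)" by force
  let ?i = "rev (map (\<lambda>(x, b). (x, \<not> b)) w)"
  have "pres_eq R (?i @ [(x, \<not> b), (x, \<not> \<not> b)] @ w) (?i @ w)" by (rule pres_eq.cancel)
  then show ?case using Cons pres_eq.trans by (auto simp: z)
qed

lemma group_presented_group: "group (presented_group R)"
proof (rule groupI)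
  have one: "\<one>\<^bsub>presented_group R\<^esub> = word_class R []"
    and car: "carrier (presented_group R) = range (word_class R)"
    by (simp_all add: presented_group_def)
  show "\<one>\<^bsub>presented_group R\<^esub> \<in> carrier (presented_group R)" by (simp add: one car)
  fix x assume x: "x \<in> carrier (presented_group R)"
  then obtain u where u: "x = word_class R u" by (auto simp: car)
  show "\<one>\<^bsub>presented_group R\<^esub> \<otimes>\<^bsub>presented_group R\<^esub> x = x"
    by (simp add: one u presented_group_mult)
  show "\<exists>y\<in>carrier (presented_group R). y \<otimes>\<^bsub>presented_group R\<^esub> x = \<one>\<^bsub>presented_group R\<^esub>"
    using pres_eq_inverse[of R u]
    by (auto simp: one u car presented_group_mult word_class_eq_iff)
  fix y assume y: "y \<in> carrier (presented_group R)"
  then obtain v where v: "y = word_class R v" by (auto simp: car)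
  show "x \<otimes>\<^bsub>presented_group R\<^esub> y \<in> carrier (presented_group R)"
    by (simp add: u v presented_group_mult car)
  fix z assume z: "z \<in> carrier (presented_group R)"
  then obtain w where w: "z = word_class R w" by (auto simp: car)
  show "x \<otimes>\<^bsub>presented_group R\<^esub> y \<otimes>\<^bsub>presented_group R\<^esub> z =
      x \<otimes>\<^bsub>presented_group R\<^esub> (y \<otimes>\<^bsub>presented_group R\<^esub> z)"
    by (simp add: u v w presented_group_mult)
qed

definition t_exponent :: "bs_gen word \<Rightarrow> real" where
  "t_exponent w = (\<Sum>(x, b)\<leftarrow>w. if x = gen_t then (if b then 1 else - 1) else 0)"

lemma t_exponent_append [simp]: "t_exponent (u @ v) = t_exponent u + t_exponent v"
  by (simp add: t_exponent_def)

lemma t_exponent_pres: "pres_eq (bs_relations m n) u v \<Longrightarrow> t_exponent u = t_exponent v"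
proof (induction rule: pres_eq.induct)
  case (relation r s u v)
  then show ?case
    by (auto simp: bs_relations_def word_pow_def t_exponent_def sum_list_replicate)
qed (auto simp: t_exponent_def)

lemma char_real_unique:
  assumes f: "f \<in> hom (presented_group R) real_group" and g: "g \<in> hom (presented_group R) real_group"
    and e: "\<And>x. f (word_class R [(x, True)]) = g (word_class R [(x, True)])"
  shows "f (word_class R w) = g (word_class R w)"
proof -
  have add: "h (word_class R (u @ v)) = h (word_class R u) + h (word_class R v)"
    if "h \<in> hom (presented_group R) real_group" for h u v
  proof -
    have "word_class R u \<in> carrier (presented_group R)" "word_class R v \<in> carrier (presented_group R)"
      by (auto simp: presented_group_def)
    from hom_mult[OF that this] show ?thesis by (simp add: presented_group_mult real_group_def)
  qed
  have z: "h (word_class R []) = 0" if "h \<in> hom (presented_group R) real_group" for h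
    using add[OF that, of "[]" "[]"] by simp
  have neg: "h (word_class R [(x, False)]) = - h (word_class R [(x, True)])"
    if h: "h \<in> hom (presented_group R) real_group" for h x
  proof -
    have "word_class R ([(x, False)] @ [(x, True)]) = word_class R []"
      using pres_eq.cancel[of R "[]" x False "[]"] by (simp add: word_class_eq_iff)
    then show ?thesis using add[OF h, of "[(x, False)]" "[(x, True)]"] z[OF h] by simp
  qed
  show ?thesis
  proof (induction w)
    case Nil
    show ?case by (simp add: z f g)
  next
    case (Cons a w)
    obtain x b where a: "a = (x, b)" by force
    have "f (word_class R [a]) = g (word_class R [a])"
      unfolding a using e[of x] neg[OF f] neg[OF g] by (cases b) auto
    then show ?case using add[OF f, of "[a]" w] add[OF g, of "[a]" w] Cons by simp
  qed
qed

lemma ex1_tau: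
  "\<exists>!\<psi>. \<psi> \<in> characters (BS m n) (discrete_topology (carrier (BS m n))) \<and>
     \<psi> (bs_elt m n gen_a) = 0 \<and> \<psi> (bs_elt m n gen_t) = 1"
proof -
  let ?R = "bs_relations m n"
  let ?C = "carrier (BS m n)"
  define h where "h = (\<lambda>A\<in>?C. t_exponent (SOME w. w \<in> A))"
  have car: "?C = range (word_class ?R)" by (simp add: BS_def presented_group_def)
  have h: "h (word_class ?R w) = t_exponent w" for w
  proof -
    have "w \<in> word_class ?R w" by (simp add: word_class_def pres_eq.refl)
    then have "(SOME v. v \<in> word_class ?R w) \<in> word_class ?R w" by (rule someI)
    then show ?thesis using t_exponent_pres by (auto simp: h_def car word_class_def)
  qed
  have "h (x \<otimes>\<^bsub>BS m n\<^esub> y) = h x + h y" if "x \<in> ?C" "y \<in> ?C" for x y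
    using that unfolding car by (auto simp: h BS_def presented_group_mult)
  then have hh: "h \<in> hom (BS m n) real_group"
    by (intro homI) (auto simp: real_group_def)
  have ex: "h \<in> characters (BS m n) (discrete_topology ?C) \<and>
     h (bs_elt m n gen_a) = 0 \<and> h (bs_elt m n gen_t) = 1"
    using hh by (simp add: characters_def bs_elt_def h) (simp add: h_def word_pow_def t_exponent_def)
  moreover have "f = h" if f: "f \<in> characters (BS m n) (discrete_topology ?C) \<and>
     f (bs_elt m n gen_a) = 0 \<and> f (bs_elt m n gen_t) = 1" for f
  proof (rule extensionalityI)
    show "f \<in> extensional ?C" "h \<in> extensional ?C" using f ex by (auto simp: characters_def)
    fix A assume "A \<in> ?C"
    then obtain w where w: "A = word_class ?R w" by (auto simp: car)
    have "f (word_class ?R [(x, True)]) = h (word_class ?R [(x, True)])" for x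
      using f ex by (cases x) (auto simp: bs_elt_def word_pow_def)
    then show "f A = h A" unfolding w
      using char_real_unique[of f ?R h] f hh by (auto simp: characters_def BS_def)
  qed
  ultimately show ?thesis by blast
qed


lemma ex1_tau_bar:
  "\<exists>!\<psi>. \<psi> \<in> characters (G_BS m n) (T_BS m n) \<and>
     (\<forall>g\<in>carrier (BS m n). \<psi> (bs_structure_map m n g) = tau m n g)"
proof -
  define \<Gamma> where "\<Gamma> = BS m n"
  define L where "L = bs_subgroup m n"
  define X where "X = lcosets\<^bsub>\<Gamma>\<^esub> L"
  define \<alpha> where "\<alpha> = coset_action \<Gamma> L"
  define G where "G = carrier (schlichting_group \<Gamma> L)"
  interpret group \<Gamma> by (simp add: \<Gamma>_def BS_def group_presented_group)
  have agen: "{bs_elt m n gen_a} \<subseteq> carrier \<Gamma>"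
    by (auto simp: \<Gamma>_def BS_def presented_group_def bs_elt_def)
  interpret L: subgroup L \<Gamma>
    unfolding L_def bs_subgroup_def using generate_is_subgroup[OF agen] by (simp add: \<Gamma>_def)
  have tau: "tau m n \<in> characters \<Gamma> (discrete_topology (carrier \<Gamma>))" "tau m n (bs_elt m n gen_a) = 0"
    using theI'[OF ex1_tau[of m n]] by (simp_all add: tau_def \<Gamma>_def)
  then have tadd: "tau m n (x \<otimes>\<^bsub>\<Gamma>\<^esub> y) = tau m n x + tau m n y" if "x \<in> carrier \<Gamma>" "y \<in> carrier \<Gamma>" for x y
    using that by (auto simp: characters_def hom_def real_group_def)
  have t1: "tau m n \<one>\<^bsub>\<Gamma>\<^esub> = 0" using tadd[of "\<one>\<^bsub>\<Gamma>\<^esub>" "\<one>\<^bsub>\<Gamma>\<^esub>"] by simp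
  have tL: "tau m n x = 0" if "x \<in> L" for x
  proof -
    have "x \<in> generate \<Gamma> {bs_elt m n gen_a}" using that by (simp add: L_def bs_subgroup_def \<Gamma>_def)
    then show ?thesis
    proof (induction rule: generate.induct)
      case (inv h)
      then have "h \<in> carrier \<Gamma>" using agen by blast
      then show ?case using tadd[of "inv\<^bsub>\<Gamma>\<^esub> h" h] inv tau t1 by auto
    next
      case (eng h1 h2)
      then show ?case using tadd generate_in_carrier[OF agen] by auto
    qed (use tau t1 in auto)
  qed
  have LX: "g <#\<^bsub>\<Gamma>\<^esub> L \<in> X" if "g \<in> carrier \<Gamma>" for g
    using that by (auto simp: X_def LCOSETS_def)
  have L1: "L \<in> X" using LX[of "\<one>\<^bsub>\<Gamma>\<^esub>"] L.subset lcos_mult_one by fastforce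
  define v where "v C = tau m n (SOME w. w \<in> C)" for C
  have v: "v (g <#\<^bsub>\<Gamma>\<^esub> L) = tau m n g" if g: "g \<in> carrier \<Gamma>" for g
  proof -
    have "g \<in> g <#\<^bsub>\<Gamma>\<^esub> L" using g lcos_self L.subgroup_axioms by blast
    then have "(SOME w. w \<in> g <#\<^bsub>\<Gamma>\<^esub> L) \<in> g <#\<^bsub>\<Gamma>\<^esub> L" by (rule someI)
    then show ?thesis using tadd[OF g] tL L.subset by (auto simp: v_def l_coset_def)
  qed
  have \<alpha>: "\<alpha> g (h <#\<^bsub>\<Gamma>\<^esub> L) = (g \<otimes>\<^bsub>\<Gamma>\<^esub> h) <#\<^bsub>\<Gamma>\<^esub> L" if "g \<in> carrier \<Gamma>" "h \<in> carrier \<Gamma>" for g h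
    using that LX[of h] L.subset by (simp add: \<alpha>_def coset_action_def X_def lcos_m_assoc)
  have \<alpha>L: "\<alpha> g L = g <#\<^bsub>\<Gamma>\<^esub> L" if "g \<in> carrier \<Gamma>" for g
    using that \<alpha>[OF that one_closed] L.subset lcos_mult_one by simp
  have top: "topspace (sym_topology X) = Bij X"
    by (auto simp: sym_topology_def Bij_def PiE_def bij_betw_def)
  have \<alpha>B: "\<alpha> g \<in> Bij X" if g: "g \<in> carrier \<Gamma>" for g
  proof -
    have sub: "\<alpha> h ` X \<subseteq> X" if "h \<in> carrier \<Gamma>" for h
    proof
      fix D assume "D \<in> \<alpha> h ` X"
      then obtain k where "k \<in> carrier \<Gamma>" "D = \<alpha> h (k <#\<^bsub>\<Gamma>\<^esub> L)" by (auto simp: X_def LCOSETS_def)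
      then show "D \<in> X" using \<alpha> LX that by simp
    qed
    have inv: "\<alpha> (inv\<^bsub>\<Gamma>\<^esub> h) (\<alpha> h C) = C" if "h \<in> carrier \<Gamma>" "C \<in> X" for h C
    proof -
      obtain k where "k \<in> carrier \<Gamma>" "C = k <#\<^bsub>\<Gamma>\<^esub> L" using \<open>C \<in> X\<close> by (auto simp: X_def LCOSETS_def)
      then show ?thesis using \<alpha> \<open>h \<in> carrier \<Gamma>\<close> by (simp add: m_assoc[symmetric])
    qed
    have "bij_betw (\<alpha> g) X X"
      by (rule bij_betw_byWitness[where f' = "\<alpha> (inv\<^bsub>\<Gamma>\<^esub> g)"])
         (use sub inv[of g] inv[of "inv\<^bsub>\<Gamma>\<^esub> g"] g in auto)
    then show ?thesis by (simp add: Bij_def \<alpha>_def coset_action_def X_def)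
  qed
  have G: "G = sym_topology X closure_of (\<alpha> ` carrier \<Gamma>)"
    by (simp add: G_def schlichting_group_def X_def \<alpha>_def)
  have GB: "G \<subseteq> Bij X" using closure_of_subset_topspace[of "sym_topology X"] by (simp add: G top)
  have \<alpha>G: "\<alpha> g \<in> G" if "g \<in> carrier \<Gamma>" for g
    using closure_of_subset[of "\<alpha> ` carrier \<Gamma>" "sym_topology X"] \<alpha>B that by (auto simp: G top)
  have ev: "continuous_map (sym_topology X) (discrete_topology X) (\<lambda>f. f C)" if "C \<in> X" for C
    unfolding sym_topology_def
    by (intro continuous_map_from_subtopology continuous_map_product_projection that)
  have approx: "\<exists>d\<in>carrier \<Gamma>. \<alpha> d C = g C \<and> \<alpha> d D = g D" if "g \<in> G" "C \<in> X" "D \<in> X" for g C D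
  proof -
    define U where "U = {f \<in> topspace (sym_topology X). f C \<in> {g C}} \<inter> {f \<in> topspace (sym_topology X). f D \<in> {g D}}"
    have gB: "g \<in> Bij X" using GB that by blast
    then have "g C \<in> X" "g D \<in> X" using that by (auto simp: Bij_def bij_betw_def)
    then have "openin (sym_topology X) U"
      unfolding U_def using ev[OF that(2)] ev[OF that(3)]
      by (intro openin_Int openin_continuous_map_preimage[where Y = "discrete_topology X"]) auto
    moreover have "g \<in> U" using gB by (simp add: U_def top)
    ultimately have "\<exists>y. y \<in> \<alpha> ` carrier \<Gamma> \<and> y \<in> U"
      using that(1) unfolding G in_closure_of by blast
    then show ?thesis by (auto simp: U_def)
  qed
  define \<psi> where "\<psi> = (\<lambda>g\<in>G. v (g L))"
  have T: "T_BS m n = subtopology (sym_topology X) G"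
    by (simp add: schlichting_topology_def G_def X_def \<Gamma>_def L_def)
  have GG: "carrier (G_BS m n) = G" by (simp add: G_def \<Gamma>_def L_def)
  have mult: "g \<otimes>\<^bsub>G_BS m n\<^esub> h = compose X g h" if "g \<in> G" "h \<in> G" for g h
    using GB that by (auto simp: schlichting_group_def BijGroup_def X_def \<Gamma>_def L_def)
  have key: "\<psi> (compose X g h) = \<psi> g + \<psi> h \<and> compose X g h \<in> G" if g: "g \<in> G" and h: "h \<in> G" for g h
  proof -
    have cl: "compose X g h \<in> G"
    proof -
      have "\<exists>y\<in>\<alpha> ` carrier \<Gamma>. y \<in> U" if U: "openin (sym_topology X) U" "compose X g h \<in> U" for U
      proof -
        have gB: "g \<in> Bij X" and hB: "h \<in> Bij X" using GB g h by auto
        obtain V where V: "openin (product_topology (\<lambda>_. discrete_topology X) X) V" "U = V \<inter> Bij X"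
          using U by (auto simp: sym_topology_def openin_subtopology)
        then obtain W where W: "finite {i \<in> X. W i \<noteq> X}" "compose X g h \<in> PiE X W" "PiE X W \<subseteq> V"
          using U by (auto simp: openin_product_topology_alt)
        define F where "F = {i \<in> X. W i \<noteq> X}"
        have app: "\<exists>d\<in>carrier \<Gamma>. \<forall>C\<in>E. \<alpha> d C = k C" if "k \<in> G" "finite E" "E \<subseteq> X" for k E
        proof -
          define U' where "U' = topspace (sym_topology X) \<inter> (\<Inter>C\<in>E. {f \<in> topspace (sym_topology X). f C \<in> {k C}})"
          have kB: "k \<in> Bij X" using GB that by blast
          then have kX: "k C \<in> X" if "C \<in> E" for C using that \<open>E \<subseteq> X\<close> by (auto simp: Bij_def bij_betw_def)
          have "openin (sym_topology X) U'"
          proof (cases "E = {}")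
            case False
            have "openin (sym_topology X) (\<Inter>C\<in>E. {f \<in> topspace (sym_topology X). f C \<in> {k C}})"
            proof (rule openin_INT2[OF \<open>finite E\<close> False])
              fix C assume "C \<in> E"
              then show "openin (sym_topology X) {f \<in> topspace (sym_topology X). f C \<in> {k C}}"
                using ev[of C] \<open>E \<subseteq> X\<close> kX by (intro openin_continuous_map_preimage[where Y = "discrete_topology X"]) auto
            qed
            then show ?thesis unfolding U'_def by blast
          qed (simp add: U'_def)
          moreover have "k \<in> U'" using kB by (simp add: U'_def top)
          ultimately have "\<exists>y. y \<in> \<alpha> ` carrier \<Gamma> \<and> y \<in> U'"
            using that(1) unfolding G in_closure_of by blast
          then show ?thesis by (auto simp: U'_def)
        qed
        have F: "finite F" "F \<subseteq> X" using W by (auto simp: F_def)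
        have hX: "h C \<in> X" if "C \<in> X" for C using hB that by (auto simp: Bij_def bij_betw_def)
        obtain e where e: "e \<in> carrier \<Gamma>" "\<forall>C\<in>F. \<alpha> e C = h C" using app[OF h F] by blast
        obtain d where d: "d \<in> carrier \<Gamma>" "\<forall>C\<in>h ` F. \<alpha> d C = g C" using app[OF g, of "h ` F"] F hX by blast
        have de: "\<alpha> (d \<otimes>\<^bsub>\<Gamma>\<^esub> e) C = \<alpha> d (\<alpha> e C)" if "C \<in> X" for C
          using that \<alpha> d e by (auto simp: X_def LCOSETS_def m_assoc)
        have deB: "\<alpha> (d \<otimes>\<^bsub>\<Gamma>\<^esub> e) \<in> Bij X" using \<alpha>B d e by simp
        have "\<alpha> (d \<otimes>\<^bsub>\<Gamma>\<^esub> e) \<in> PiE X W"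
        proof (rule PiE_I)
          fix C assume C: "C \<in> X"
          show "\<alpha> (d \<otimes>\<^bsub>\<Gamma>\<^esub> e) C \<in> W C"
          proof (cases "C \<in> F")
            case True
            then have "\<alpha> (d \<otimes>\<^bsub>\<Gamma>\<^esub> e) C = compose X g h C" using de C d e by (simp add: compose_def)
            then show ?thesis using W C by (auto simp: PiE_def)
          next
            case False
            then show ?thesis using deB C by (auto simp: F_def Bij_def bij_betw_def)
          qed
        next
          fix C assume "C \<notin> X"
          then show "\<alpha> (d \<otimes>\<^bsub>\<Gamma>\<^esub> e) C = undefined" using deB by (auto simp: Bij_def extensional_def)
        qed
        then show ?thesis using W V deB d e by (intro bexI[of _ "\<alpha> (d \<otimes>\<^bsub>\<Gamma>\<^esub> e)"]) auto
      qed
      moreover have "compose X g h \<in> Bij X" using GB g h compose_Bij by blast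
      ultimately show ?thesis unfolding G in_closure_of top by blast
    qed
    obtain e where e: "e \<in> carrier \<Gamma>" "\<alpha> e L = h L" using approx[OF h L1 L1] by blast
    then have eX: "h L = e <#\<^bsub>\<Gamma>\<^esub> L" using \<alpha>L by simp
    obtain d where d: "d \<in> carrier \<Gamma>" "\<alpha> d L = g L" "\<alpha> d (h L) = g (h L)"
      using approx[OF g L1, of "h L"] eX LX e by auto
    have "g (h L) = (d \<otimes>\<^bsub>\<Gamma>\<^esub> e) <#\<^bsub>\<Gamma>\<^esub> L" using d \<alpha>[OF d(1) e(1)] eX by simp
    moreover have "g L = d <#\<^bsub>\<Gamma>\<^esub> L" using d \<alpha>L by simp
    ultimately show ?thesis using cl g h eX d e L1 v tadd by (simp add: \<psi>_def compose_def)
  qed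
  have cont: "continuous_map (subtopology (sym_topology X) G) euclideanreal \<psi>"
  proof -
    have "continuous_map (subtopology (sym_topology X) G) (discrete_topology X) (\<lambda>f. f L)"
      by (intro continuous_map_from_subtopology ev L1)
    moreover have "continuous_map (discrete_topology X) euclideanreal v" by simp
    ultimately have "continuous_map (subtopology (sym_topology X) G) euclideanreal (v \<circ> (\<lambda>f. f L))"
      by (rule continuous_map_compose)
    then show ?thesis by (rule continuous_map_eq) (auto simp: \<psi>_def)
  qed
  have ex: "\<psi> \<in> characters (G_BS m n) (T_BS m n) \<and>
     (\<forall>g\<in>carrier (BS m n). \<psi> (bs_structure_map m n g) = tau m n g)"
  proof
    show "\<psi> \<in> characters (G_BS m n) (T_BS m n)"
      using cont key by (auto simp: characters_def T GG mult real_group_def hom_def) (simp add: \<psi>_def)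
    show "\<forall>g\<in>carrier (BS m n). \<psi> (bs_structure_map m n g) = tau m n g"
      using \<alpha>G \<alpha>L v by (simp add: bs_structure_map_def \<psi>_def flip: \<Gamma>_def L_def \<alpha>_def)
  qed
  moreover have "f = \<psi>" if f: "f \<in> characters (G_BS m n) (T_BS m n) \<and>
     (\<forall>g\<in>carrier (BS m n). f (bs_structure_map m n g) = tau m n g)" for f
  proof (rule extensionalityI)
    show "f \<in> extensional G" "\<psi> \<in> extensional G" using f ex by (auto simp: characters_def GG)
    fix g assume g: "g \<in> G"
    have sub: "\<alpha> ` carrier \<Gamma> \<subseteq> G" using \<alpha>G by blast
    show "f g = \<psi> g"
    proof (rule forall_in_closure_of_eq[where f = f and g = \<psi> and x = g and X = "subtopology (sym_topology X) G" and S = "\<alpha> ` carrier \<Gamma>" and Y = euclideanreal])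
      show "g \<in> subtopology (sym_topology X) G closure_of (\<alpha> ` carrier \<Gamma>)"
        using g sub by (simp add: closure_of_subtopology Int_absorb1 flip: G)
      show "continuous_map (subtopology (sym_topology X) G) euclideanreal f"
        using f by (simp add: characters_def T)
      show "f x = \<psi> x" if "x \<in> \<alpha> ` carrier \<Gamma>" for x
        using that f ex by (auto simp: bs_structure_map_def \<Gamma>_def L_def \<alpha>_def)
    qed (use cont in simp_all)
  qed
  ultimately show ?thesis by blast
qed

end

(*
Let T be the Bass-Serre tree of BS(m,n) = HNN(<a>, t), whose vertices are the cosets g<a>; the
Schlichting completion G acts on T with compact open vertex stabilizers.  The character tau_bar
is the height of the vertex g o, where o is the root, and every character is a multiple of
tau_bar because characters kill the compact stabilizer of o.  Up to cofinality the filtration of EG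
consists of the tuples whose images in T lie in a ball of fixed radius around a vertex of the half
tree {c * height >= 0}.

If every vertex has at most one neighbour in the direction in which the half tree opens (or c = 0),
then the half tree is closed under moving one step towards the root.  This move does not increase
distances, so its iterates are successively contiguous self-maps of the filtration, up to
enlarging the radius by one.  On finitely many vertices they become constant, hence all homotopy
and homology classes die at once.  Otherwise every descending ray can be followed below the half
tree by more than the given radius and left again along another branch; being in that branch is
constant on the simplices, so already pi_0 and reduced H_0 are essentially nontrivial.
*)

theory Submission
  imports Defs "HOL-Library.Sublist"
begin

section \<open>Geometric realization in terms of weighted lists\<close>

text \<open>Homotopy and homology are driven by one device: maps f 0 = id, f 1, f 2, ... such that f
  j and f (j + 1) send each member of one cover into a common member of a larger cover. The obstacle
  is that the f j become constant only pointwise, so no finite number of steps contracts a whole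
  stage. A cycle has finitely many vertices; for maps of cubes, compactness of the image has to
  supply a bound on the number of steps, which is the purpose of
  \<open>compactin_realization_bounded\<close>.

  The device acts on elements of G, not on tree vertices: the fibres of \<open>pos\<close> are
  cosets of the stabilizer of the root, and the contraction first moves every element to a chosen
  one in its fibre. No equivariance is asked for, since a stage is just a cover by translates.

  Tree vertices are encoded by reduced words, so that the distance to the root is a length. A vertex
  has |n| neighbours above it and |m| below it; the sign of c decides which of the two numbers
  matters, and this is the origin of \<open>modulus\<close> and \<open>good\<close>.\<close>

definition cover_sset :: "'a set set \<Rightarrow> 'a list sset" where
  "cover_sset K = (EE UNIV)\<lparr>simplices := (\<lambda>k. {xs. length xs = Suc k \<and> (\<exists>B\<in>K. set xs \<subseteq> B)})\<rparr>"

definition weighted :: "'a set set \<Rightarrow> ('a \<times> real) list set" where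
  "weighted K = {ws. ws \<noteq> [] \<and> (\<exists>B\<in>K. fst ` set ws \<subseteq> B) \<and> (\<forall>w\<in>set ws. 0 \<le> snd w) \<and>
     sum_list (map snd ws) = 1}"

text \<open>A point of the realization is represented by the list of the vertices of a simplex
  with their barycentric weights.  Gluing then means deleting a vertex of weight \<open>0\<close> and merging
  adjacent equal vertices, so that no index arithmetic is needed.\<close>

definition wrep :: "('a \<times> real) list \<Rightarrow> (nat \<times> 'a list) \<times> (nat \<Rightarrow> real)" where
  "wrep ws = ((length ws - 1, map fst ws), \<lambda>j. if j < length ws then snd (ws ! j) else 0)"

definition wlist :: "(nat \<times> 'a list) \<times> (nat \<Rightarrow> real) \<Rightarrow> ('a \<times> real) list" where
  "wlist q = zip (snd (fst q)) (map (snd q) [0..<Suc (fst (fst q))])"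

definition wpoint :: "'a set set \<Rightarrow> ('a \<times> real) list \<Rightarrow> 'a list realization_point" where
  "wpoint K ws = gluing_equiv (cover_sset K) `` {wrep ws}"

lemma simplices_cover_sset:
  "simplices (cover_sset K) k = {xs. length xs = Suc k \<and> (\<exists>B\<in>K. set xs \<subseteq> B)}"
  by (simp add: cover_sset_def)

lemma face_cover_sset: "face (cover_sset K) k i xs = take i xs @ drop (Suc i) xs"
  by (simp add: cover_sset_def EE_def)

lemma degen_cover_sset: "degen (cover_sset K) k i xs = take (Suc i) xs @ drop i xs"
  by (simp add: cover_sset_def EE_def)

lemma topspace_presimplex:
  "((k, \<sigma>), x) \<in> topspace (presimplex_topology Y) \<longleftrightarrow> \<sigma> \<in> simplices Y k \<and> x \<in> standard_simplex k"
  by (auto simp: presimplex_topology_def)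

lemma sum_nth_map: "(\<Sum>j<length ws. snd (ws ! j)) = sum_list (map snd ws)"
  by (simp add: sum_list_sum_nth atLeast0LessThan)

lemma wrep_in:
  assumes "ws \<in> weighted K"
  shows "wrep ws \<in> topspace (presimplex_topology (cover_sset K))"
proof -
  let ?x = "\<lambda>j. if j < length ws then snd (ws ! j) else 0"
  from assms have ne: "ws \<noteq> []" and B: "\<exists>B\<in>K. fst ` set ws \<subseteq> B"
    and nn: "\<And>w. w \<in> set ws \<Longrightarrow> 0 \<le> snd w" and s: "sum_list (map snd ws) = 1"
    by (auto simp: weighted_def)
  have nn': "\<And>j. 0 \<le> ?x j" using nn by auto
  have "{..length ws - 1} = {..<length ws}" using ne by (cases ws) auto
  then have sum: "(\<Sum>j\<le>length ws - 1. ?x j) = 1"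
    using s by (simp add: sum_nth_map)
  have "?x j \<le> 1" for j
  proof (cases "j \<le> length ws - 1")
    case True
    have "?x j \<le> (\<Sum>j\<le>length ws - 1. ?x j)" by (rule member_le_sum) (use True nn' in auto)
    then show ?thesis using sum by linarith
  next
    case False
    then show ?thesis using ne by (cases ws) auto
  qed
  then have "?x \<in> standard_simplex (length ws - 1)"
    unfolding standard_simplex_def using ne nn' sum by (intro CollectI conjI allI impI) auto
  then show ?thesis
    using ne B by (cases ws) (auto simp: wrep_def topspace_presimplex simplices_cover_sset)
qed

lemma wlist_wrep: "ws \<noteq> [] \<Longrightarrow> wlist (wrep ws) = ws"
  by (rule nth_equalityI) (auto simp: wlist_def wrep_def simp del: upt_Suc)

lemma length_wlist: "length \<sigma> = Suc k \<Longrightarrow> length (wlist ((k, \<sigma>), x)) = Suc k"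
  by (simp add: wlist_def del: upt_Suc)

lemma nth_wlist: "length \<sigma> = Suc k \<Longrightarrow> j \<le> k \<Longrightarrow> wlist ((k, \<sigma>), x) ! j = (\<sigma> ! j, x j)"
  by (simp add: wlist_def del: upt_Suc)

lemma map_fst_wlist: "length \<sigma> = Suc k \<Longrightarrow> map fst (wlist ((k, \<sigma>), x)) = \<sigma>"
  by (simp add: wlist_def del: upt_Suc)

lemma map_snd_wlist: "length \<sigma> = Suc k \<Longrightarrow> map snd (wlist ((k, \<sigma>), x)) = map x [0..<Suc k]"
  by (simp add: wlist_def del: upt_Suc)

lemma wlist_in:
  assumes "q \<in> topspace (presimplex_topology (cover_sset K))"
  shows "wlist q \<in> weighted K" and "wrep (wlist q) = q"
proof -
  obtain k \<sigma> x where q: "q = ((k, \<sigma>), x)" by (metis prod.collapse)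
  have l: "length \<sigma> = Suc k" and B: "\<exists>B\<in>K. set \<sigma> \<subseteq> B" and x: "x \<in> standard_simplex k"
    using assms by (auto simp: q topspace_presimplex simplices_cover_sset)
  have f: "fst ` set (wlist q) = set \<sigma>" 
    using map_fst_wlist[OF l, of x] unfolding q by (metis set_map)
  have "snd ` set (wlist q) = x ` {0..<Suc k}"
    using map_snd_wlist[OF l, of x] unfolding q by (metis set_map set_upt)
  moreover have "0 \<le> x j" for j using x by (simp add: standard_simplex_def)
  ultimately have "\<forall>a\<in>snd ` set (wlist q). 0 \<le> a" by auto
  then have nn: "\<forall>w\<in>set (wlist q). 0 \<le> snd w" by blast
  have "sum_list (map snd (wlist q)) = (\<Sum>j\<le>k. x j)"
    unfolding q map_snd_wlist[OF l] by (simp add: sum_list_distinct_conv_sum_set atLeast0LessThan lessThan_Suc_atMost del: upt_Suc)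
  moreover have "wlist q \<noteq> []" using length_wlist[OF l, of x] by (auto simp: q)
  ultimately show "wlist q \<in> weighted K"
    using f nn B x by (auto simp: weighted_def standard_simplex_def)
  show "wrep (wlist q) = q"
    using length_wlist[OF l, of x] x
    by (auto simp: q wrep_def map_fst_wlist[OF l] nth_wlist[OF l] standard_simplex_def less_Suc_eq_le fun_eq_iff)
qed

text \<open>A coface inserts the coordinate 0 and a codegeneracy adds two neighbouring coordinates.
  On weighted lists the face relation therefore deletes an entry of weight 0, and the degeneracy
  relation merges two adjacent entries with the same vertex.\<close>

lemma gluing_wlist:
  assumes "(q, q') \<in> gluing (cover_sset K)"
  shows "q \<in> topspace (presimplex_topology (cover_sset K)) \<and> q' \<in> topspace (presimplex_topology (cover_sset K)) \<and>
    ((\<exists>u v w. wlist q = u @ w \<and> wlist q' = u @ (v, 0) # w) \<or>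
     (\<exists>u v a b w. wlist q = u @ (v, a) # (v, b) # w \<and> wlist q' = u @ (v, a + b) # w))"
  using assms unfolding gluing_def Un_iff
proof
  assume "(q, q') \<in> {(((k, face (cover_sset K) (Suc k) i \<sigma>), x), ((Suc k, \<sigma>), simplical_face i x)) | k i \<sigma> x.
        \<sigma> \<in> simplices (cover_sset K) (Suc k) \<and> i \<le> Suc k \<and> x \<in> standard_simplex k}"
  then obtain k i \<sigma> x where q: "q = ((k, take i \<sigma> @ drop (Suc i) \<sigma>), x)" and q': "q' = ((Suc k, \<sigma>), simplical_face i x)"
    and s: "\<sigma> \<in> simplices (cover_sset K) (Suc k)" and i: "i \<le> Suc k" and x: "x \<in> standard_simplex k"
    by (auto simp: face_cover_sset)
  have l: "length \<sigma> = Suc (Suc k)" and B: "\<exists>B\<in>K. set \<sigma> \<subseteq> B" using s by (auto simp: simplices_cover_sset)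
  have l': "length (take i \<sigma> @ drop (Suc i) \<sigma>) = Suc k" using l i by auto
  have top': "q' \<in> topspace (presimplex_topology (cover_sset K))"
    using s simplical_face_in_standard_simplex[of "Suc k" i x] i x by (simp add: q' topspace_presimplex)
  have "set (take i \<sigma> @ drop (Suc i) \<sigma>) \<subseteq> set \<sigma>"
    by (auto dest: in_set_takeD in_set_dropD)
  then have top: "q \<in> topspace (presimplex_topology (cover_sset K))"
    using B x l' by (auto simp: q topspace_presimplex simplices_cover_sset)
  let ?W = "wlist q'"
  have L: "length ?W = Suc (Suc k)" using length_wlist[OF l] by (simp add: q')
  have W: "?W = take i ?W @ ?W ! i # drop (Suc i) ?W" using L i by (simp add: id_take_nth_drop)
  have Wi: "?W ! i = (\<sigma> ! i, 0)" using nth_wlist[OF l] i by (simp add: q' simplical_face_def)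
  have "wlist q = take i ?W @ drop (Suc i) ?W"
  proof (rule nth_equalityI)
    show len: "length (wlist q) = length (take i ?W @ drop (Suc i) ?W)"
      using L i length_wlist[OF l'] by (simp add: q)
    fix j assume "j < length (wlist q)"
    then have j: "j \<le> k" using length_wlist[OF l'] by (simp add: q)
    show "wlist q ! j = (take i ?W @ drop (Suc i) ?W) ! j"
      using j L i l nth_wlist[OF l' j] nth_wlist[OF l]
      by (auto simp: q q' nth_append simplical_face_def)
  qed
  moreover have "wlist q' = take i ?W @ (\<sigma> ! i, 0) # drop (Suc i) ?W" using W Wi by simp
  ultimately show ?thesis using top top' by blast
next
  assume "(q, q') \<in> {(((Suc k, degen (cover_sset K) k i \<sigma>), x), ((k, \<sigma>), simplical_degen i x)) | k i \<sigma> x.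
        \<sigma> \<in> simplices (cover_sset K) k \<and> i \<le> k \<and> x \<in> standard_simplex (Suc k)}"
  then obtain k i \<sigma> x where q: "q = ((Suc k, take (Suc i) \<sigma> @ drop i \<sigma>), x)" and q': "q' = ((k, \<sigma>), simplical_degen i x)"
    and s: "\<sigma> \<in> simplices (cover_sset K) k" and i: "i \<le> k" and x: "x \<in> standard_simplex (Suc k)"
    by (auto simp: degen_cover_sset)
  have l: "length \<sigma> = Suc k" and B: "\<exists>B\<in>K. set \<sigma> \<subseteq> B" using s by (auto simp: simplices_cover_sset)
  have l': "length (take (Suc i) \<sigma> @ drop i \<sigma>) = Suc (Suc k)" using l i by auto
  have "set (take (Suc i) \<sigma> @ drop i \<sigma>) \<subseteq> set \<sigma>"
    by (auto dest: in_set_takeD in_set_dropD)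
  then have top: "q \<in> topspace (presimplex_topology (cover_sset K))"
    using B x l' by (auto simp: q topspace_presimplex simplices_cover_sset)
  let ?W = "wlist q"
  have L: "length ?W = Suc (Suc k)" using length_wlist[OF l'] by (simp add: q)
  have W: "?W = take i ?W @ ?W ! i # ?W ! Suc i # drop (Suc (Suc i)) ?W"
    using L i id_take_nth_drop[of i ?W] Cons_nth_drop_Suc[of "Suc i" ?W] by simp
  have Wi: "?W ! i = (\<sigma> ! i, x i)" "?W ! Suc i = (\<sigma> ! i, x (Suc i))"
    using nth_wlist[OF l'] i l by (auto simp: q nth_append)
  let ?V = "take i ?W @ (\<sigma> ! i, x i + x (Suc i)) # drop (Suc (Suc i)) ?W"
  have V: "wlist q' = ?V"
  proof (rule nth_equalityI)
    show len: "length (wlist q') = length ?V"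
      using L i length_wlist[OF l] by (simp add: q')
    fix j assume "j < length (wlist q')"
    then have j: "j \<le> k" using length_wlist[OF l] by (simp add: q')
    consider "j < i" | "j = i" | j' where "j = Suc j'" "i \<le> j'" 
      by (cases j) (auto simp: less_Suc_eq_le not_less, linarith?)
    then show "wlist q' ! j = ?V ! j"
    proof cases
      case 1
      then show ?thesis using j L i l nth_wlist[OF l'] nth_wlist[OF l]
        by (auto simp: q q' nth_append simplical_degen_def)
    next
      case 2
      then show ?thesis using j L i l nth_wlist[OF l]
        by (auto simp: q' nth_append simplical_degen_def)
    next
      case 3
      then have "?V ! j = ?W ! Suc j" using L j by (auto simp: nth_append nth_Cons' Suc_diff_le)
      moreover have "?W ! Suc j = (\<sigma> ! j, x (Suc j))"
        using nth_wlist[OF l', of "Suc j" x] j l i 3 by (simp add: q nth_append)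
      ultimately show ?thesis using 3 nth_wlist[OF l j] by (simp add: q' simplical_degen_def)
    qed
  qed
  have "wlist q \<in> weighted K" by (rule wlist_in[OF top])
  then have nn: "\<And>w. w \<in> set ?W \<Longrightarrow> 0 \<le> snd w" and sm: "sum_list (map snd ?W) = 1"
    and ne: "?W \<noteq> []" and "\<exists>B\<in>K. fst ` set ?W \<subseteq> B"
    by (auto simp: weighted_def)
  \<comment> \<open>Merging keeps the vertex set and the total weight; via \<open>wrep_in\<close>
    this shows that the codegeneracy lands in the standard simplex.\<close>
  have "?V \<in> weighted K"
  proof -
    have nn0: "0 \<le> x i" "0 \<le> x (Suc i)" using x by (auto simp: standard_simplex_def)
    have "sum_list (map snd ?V) = sum_list (map snd ?W)"
      by (subst (3) W) (simp add: Wi)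
    moreover have "fst ` set ?V = fst ` set ?W"
      by (subst (3) W) (simp add: Wi)
    ultimately show ?thesis using nn nn0 sm \<open>\<exists>B\<in>K. fst ` set ?W \<subseteq> B\<close>
      by (auto simp: weighted_def dest: in_set_takeD in_set_dropD)
  qed
  then have "wrep ?V \<in> topspace (presimplex_topology (cover_sset K))" by (rule wrep_in)
  moreover have "wrep ?V = q'"
  proof -
    have z: "simplical_degen i x j = 0" if "j > k" for j
      using that i x by (auto simp: simplical_degen_def standard_simplex_def)
    have "length ?V = Suc k" using length_wlist[OF l] V by (metis q')
    then show ?thesis unfolding V[symmetric] 
      using z by (auto simp: q' wrep_def map_fst_wlist[OF l] nth_wlist[OF l] length_wlist[OF l] less_Suc_eq_le fun_eq_iff)
  qed
  ultimately have top': "q' \<in> topspace (presimplex_topology (cover_sset K))" by simp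
  have "wlist q = take i ?W @ (\<sigma> ! i, x i) # (\<sigma> ! i, x (Suc i)) # drop (Suc (Suc i)) ?W"
    using W Wi by simp
  then show ?thesis using top top' V by blast
qed

lemma weighted_drop: "u @ (v, 0) # w \<in> weighted K \<Longrightarrow> u @ w \<in> weighted K"
  by (auto simp: weighted_def)

lemma weighted_merge: "u @ (v, a) # (v, b) # w \<in> weighted K \<Longrightarrow> u @ (v, a + b) # w \<in> weighted K"
  by (auto simp: weighted_def)

lemma gluing_drop:
  assumes "u @ (v, 0) # w \<in> weighted K"
  shows "(wrep (u @ w), wrep (u @ (v, 0) # w)) \<in> gluing (cover_sset K)"
proof -
  let ?k = "length (u @ w) - 1" and ?i = "length u" and ?\<sigma> = "map fst (u @ (v, 0::real) # w)"
  define x where "x = snd (wrep (u @ w))"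
  have ne: "u @ w \<noteq> []" using assms by (auto simp: weighted_def)
  have x: "x \<in> standard_simplex ?k"
    using wrep_in[OF weighted_drop[OF assms]] by (auto simp: x_def wrep_def topspace_presimplex)
  have s: "?\<sigma> \<in> simplices (cover_sset K) (Suc ?k)"
    using wrep_in[OF assms] ne by (cases u) (auto simp: wrep_def topspace_presimplex simplices_cover_sset)
  have i: "?i \<le> Suc ?k" using ne by (cases u) auto
  have l: "wrep (u @ w) = ((?k, face (cover_sset K) (Suc ?k) ?i ?\<sigma>), x)"
    by (simp add: x_def wrep_def face_cover_sset)
  have r: "wrep (u @ (v, 0) # w) = ((Suc ?k, ?\<sigma>), simplical_face ?i x)"
  proof -
    have "length (u @ w) = Suc ?k" using ne by (cases u) auto
    moreover have "snd (wrep (u @ (v, 0) # w)) j = simplical_face ?i x j" for j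
    proof (cases j ?i rule: linorder_cases)
      case greater
      then obtain j' where "j = Suc j'" "?i \<le> j'" by (cases j) auto
      then show ?thesis by (simp add: x_def wrep_def simplical_face_def nth_append Suc_diff_le)
    qed (auto simp: x_def wrep_def simplical_face_def nth_append)
    ultimately show ?thesis unfolding prod_eq_iff fun_eq_iff by (simp add: wrep_def)
  qed
  show ?thesis unfolding gluing_def l r
    by (rule UnI1, rule CollectI, rule exI[of _ ?k], rule exI[of _ ?i], rule exI[of _ ?\<sigma>], rule exI[of _ x])
       (use s i x in simp)
qed

lemma gluing_merge:
  assumes "u @ (v, a) # (v, b) # w \<in> weighted K"
  shows "(wrep (u @ (v, a) # (v, b) # w), wrep (u @ (v, a + b) # w)) \<in> gluing (cover_sset K)"
proof -
  let ?k = "length (u @ w)" and ?i = "length u" and ?\<sigma> = "map fst (u @ (v, a + b) # w)"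
  define x where "x = snd (wrep (u @ (v, a) # (v, b) # w))"
  have x: "x \<in> standard_simplex (Suc ?k)"
    using wrep_in[OF assms] by (auto simp: x_def wrep_def topspace_presimplex)
  have s: "?\<sigma> \<in> simplices (cover_sset K) ?k"
    using wrep_in[OF weighted_merge[OF assms]] by (auto simp: wrep_def topspace_presimplex simplices_cover_sset)
  have i: "?i \<le> ?k" by simp
  have l: "wrep (u @ (v, a) # (v, b) # w) = ((Suc ?k, degen (cover_sset K) ?k ?i ?\<sigma>), x)"
    by (simp add: x_def wrep_def degen_cover_sset)
  have r: "wrep (u @ (v, a + b) # w) = ((?k, ?\<sigma>), simplical_degen ?i x)"
  proof -
    have "snd (wrep (u @ (v, a + b) # w)) j = simplical_degen ?i x j" for j
    proof (cases j ?i rule: linorder_cases)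
      case greater
      then obtain j' where "j = Suc j'" "?i \<le> j'" by (cases j) auto
      then show ?thesis by (simp add: x_def wrep_def simplical_degen_def nth_append Suc_diff_le)
    qed (auto simp: x_def wrep_def simplical_degen_def nth_append)
    then show ?thesis unfolding prod_eq_iff fun_eq_iff by (simp add: wrep_def)
  qed
  show ?thesis unfolding gluing_def l r
    by (rule UnI2, rule CollectI, rule exI[of _ ?k], rule exI[of _ ?i], rule exI[of _ ?\<sigma>], rule exI[of _ x])
       (use s i x in simp)
qed

section \<open>The realization as a quotient space, and continuity of maps into and out of
  it\<close>

lemma quotient_map_quotient_topology:
  assumes "equiv (topspace X) r"
  shows "quotient_map X (quotient_topology X r) (\<lambda>x. r `` {x})"
proof -
  have o: "openin (quotient_topology X r) U \<longleftrightarrow>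
      U \<subseteq> topspace X // r \<and> openin X {x \<in> topspace X. r `` {x} \<in> U}" for U
    by (simp add: quotient_topology_def istopology_quotient_topology)
  have "{x \<in> topspace X. r `` {x} \<in> topspace X // r} = topspace X"
    by (auto simp: quotientI)
  then have "openin (quotient_topology X r) (topspace X // r)"
    by (simp add: o)
  then have t: "topspace (quotient_topology X r) = topspace X // r"
    using o by (meson openin_subset openin_topspace subset_antisym)
  show ?thesis
    unfolding quotient_map_def t o by (auto simp: quotient_def)
qed

lemma equiv_gluing_equiv: "equiv (topspace (presimplex_topology Y)) (gluing_equiv Y)"
proof (rule equivI)
  have s: "sym ((gluing Y \<union> (gluing Y)\<inverse>)\<^sup>*)" by (rule sym_rtrancl[OF sym_Un_converse])
  show "sym (gluing_equiv Y)" using s unfolding gluing_equiv_def sym_def by blast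
  show "trans (gluing_equiv Y)"
    unfolding gluing_equiv_def trans_def by (blast intro: rtrancl_trans)
qed (auto simp: gluing_equiv_def refl_on_def)

lemma quotient_map_realization:
  "quotient_map (presimplex_topology Y) (realization Y) (\<lambda>q. gluing_equiv Y `` {q})"
  unfolding realization_def by (rule quotient_map_quotient_topology[OF equiv_gluing_equiv])

lemma wpoint_wlist:
  "q \<in> topspace (presimplex_topology (cover_sset K)) \<Longrightarrow>
    gluing_equiv (cover_sset K) `` {q} = wpoint K (wlist q)"
  by (simp add: wpoint_def wlist_in)

lemma topspace_realization: "topspace (realization (cover_sset K)) = wpoint K ` weighted K"
proof -
  have "topspace (realization (cover_sset K)) =
      (\<lambda>q. gluing_equiv (cover_sset K) `` {q}) ` topspace (presimplex_topology (cover_sset K))"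
    using quotient_imp_surjective_map[OF quotient_map_realization] by metis
  also have "\<dots> = wpoint K ` weighted K"
  proof (intro equalityI image_subsetI)
    fix q :: "(nat \<times> 'a list) \<times> (nat \<Rightarrow> real)"
    assume "q \<in> topspace (presimplex_topology (cover_sset K))"
    then show "gluing_equiv (cover_sset K) `` {q} \<in> wpoint K ` weighted K"
      using wpoint_wlist[of q K] wlist_in(1)[of q K] by simp
  next
    fix ws :: "('a \<times> real) list" assume "ws \<in> weighted K"
    then show "wpoint K ws \<in> (\<lambda>q. gluing_equiv (cover_sset K) `` {q}) ` topspace (presimplex_topology (cover_sset K))"
      unfolding wpoint_def by (intro imageI wrep_in)
  qed
  finally show ?thesis .
qed

lemma wpoint_eqI:
  assumes "(wrep ws, wrep ws') \<in> gluing (cover_sset K)"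
  shows "wpoint K ws = wpoint K ws'"
proof -
  have "(wrep ws, wrep ws') \<in> gluing_equiv (cover_sset K)"
    using assms gluing_wlist[OF assms] by (auto simp: gluing_equiv_def)
  then show ?thesis unfolding wpoint_def by (rule equiv_class_eq[OF equiv_gluing_equiv])
qed

lemma wpoint_drop: "u @ (v, 0) # w \<in> weighted K \<Longrightarrow> wpoint K (u @ w) = wpoint K (u @ (v, 0) # w)"
  by (intro wpoint_eqI gluing_drop)

lemma wpoint_merge:
  "u @ (v, a) # (v, b) # w \<in> weighted K \<Longrightarrow>
    wpoint K (u @ (v, a) # (v, b) # w) = wpoint K (u @ (v, a + b) # w)"
  by (intro wpoint_eqI gluing_merge)

text \<open>Induction along the generated equivalence relation: whatever is invariant under the two
  list moves descends to points of the realization.\<close>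

lemma wpoint_respects:
  assumes "wpoint K ws = wpoint K ws'" "ws \<in> weighted K" "ws' \<in> weighted K"
    and drop: "\<And>u v w. u @ (v, 0) # w \<in> weighted K \<Longrightarrow> F (u @ w) = F (u @ (v, 0) # w)"
    and merge: "\<And>u v a b w. u @ (v, a) # (v, b) # w \<in> weighted K \<Longrightarrow>
      F (u @ (v, a) # (v, b) # w) = F (u @ (v, a + b) # w)"
  shows "F ws = F ws'"
proof -
  have glue: "F (wlist q) = F (wlist q')" if g: "(q, q') \<in> gluing (cover_sset K)" for q q'
  proof -
    have "wlist q \<in> weighted K" "wlist q' \<in> weighted K"
      using gluing_wlist[OF g] wlist_in by blast+
    then show ?thesis using gluing_wlist[OF g] drop merge by metis
  qed
  have "(wrep ws, wrep ws') \<in> gluing_equiv (cover_sset K)"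
    using assms(1-3) wrep_in eq_equiv_class[OF _ equiv_gluing_equiv] unfolding wpoint_def by metis
  then have "(wrep ws, wrep ws') \<in> (gluing (cover_sset K) \<union> (gluing (cover_sset K))\<inverse>)\<^sup>*"
    by (simp add: gluing_equiv_def)
  then have "F (wlist (wrep ws)) = F (wlist (wrep ws'))"
    by (induction rule: rtrancl_induct) (auto dest: glue)
  then show ?thesis using assms(2,3) by (simp add: wlist_wrep weighted_def)
qed

text \<open>With a fixed vertex sequence \<tau> all points come from one closed cell, so continuity
  reduces to that of the finitely many weights.\<close>

lemma continuous_map_wpoint:
  assumes L: "\<And>z. z \<in> topspace X \<Longrightarrow> L z \<in> weighted K"
    and t: "\<And>z. z \<in> topspace X \<Longrightarrow> map fst (L z) = \<tau>"
    and c: "\<And>j. j < length \<tau> \<Longrightarrow> continuous_map X euclideanreal (\<lambda>z. snd (L z ! j))"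
  shows "continuous_map X (realization (cover_sset K)) (\<lambda>z. wpoint K (L z))"
\<comment> \<open>That \<tau> is a simplex is read off from a point of X, hence the separate empty
  case.\<close>
proof (cases "topspace X = {}")
  case True
  then show ?thesis by (simp add: continuous_map_def)
next
  case False
  let ?k = "length \<tau> - 1"
  define h where "h z = (\<lambda>j. if j < length \<tau> then snd (L z ! j) else 0)" for z
  have len: "length (L z) = length \<tau>" if "z \<in> topspace X" for z
    using t[OF that] by (metis length_map)
  have r: "wrep (L z) = ((?k, \<tau>), h z)" if "z \<in> topspace X" for z
    using t len that by (simp add: wrep_def h_def)
  have top: "((?k, \<tau>), h z) \<in> topspace (presimplex_topology (cover_sset K))" if "z \<in> topspace X" for z
    using wrep_in[OF L[OF that]] r[OF that] by simp
  have \<tau>: "\<tau> \<in> simplices (cover_sset K) ?k" 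
  proof -
    obtain z where "z \<in> topspace X" using False by blast
    from top[OF this] show ?thesis by (simp add: topspace_presimplex)
  qed
  have "continuous_map X (powertop_real UNIV) h"
    unfolding continuous_map_componentwise_UNIV
  proof
    show "continuous_map X euclideanreal (\<lambda>z. h z j)" for j
      using c[of j] by (cases "j < length \<tau>") (auto simp: h_def)
  qed
  then have "continuous_map X (subtopology (powertop_real UNIV) (standard_simplex ?k)) h"
    using top by (intro continuous_map_into_subtopology) (auto simp: topspace_presimplex)
  moreover have "continuous_map (subtopology (powertop_real UNIV) (standard_simplex ?k))
      (presimplex_topology (cover_sset K)) (\<lambda>x. ((?k, \<tau>), x))"
    unfolding presimplex_topology_def
    using continuous_map_component_injection[of "(?k, \<tau>)" "SIGMA k:UNIV. simplices (cover_sset K) k" 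
      "\<lambda>(k, \<sigma>). subtopology (powertop_real UNIV) (standard_simplex k)"] \<tau> by simp
  ultimately have "continuous_map X (presimplex_topology (cover_sset K)) ((\<lambda>x. ((?k, \<tau>), x)) \<circ> h)"
    by (rule continuous_map_compose)
  from continuous_map_compose[OF this quotient_imp_continuous_map[OF quotient_map_realization]]
  show ?thesis by (rule continuous_map_eq) (simp add: wpoint_def r)
qed

text \<open>The cells are open in the disjoint union, so maps on the product can be pasted from the
  pieces \<open>Z \<times> {i} \<times> simplex\<close>.\<close>

lemma continuous_prod_presimplex:
  assumes cont: "\<And>k \<sigma>. \<sigma> \<in> simplices Y k \<Longrightarrow>
      continuous_map (prod_topology Z (subtopology (powertop_real UNIV) (standard_simplex k))) T
        (\<lambda>(s, x). h (s, ((k, \<sigma>), x)))"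
  shows "continuous_map (prod_topology Z (presimplex_topology Y)) T h"
proof (rule pasting_lemma[where I = "SIGMA k:UNIV. simplices Y k"
      and T = "\<lambda>i. topspace Z \<times> {i} \<times> standard_simplex (fst i)" and f = "\<lambda>i. h"])
  fix i assume i: "i \<in> (SIGMA k:UNIV. simplices Y k)"
  obtain k \<sigma> where k: "i = (k, \<sigma>)" "\<sigma> \<in> simplices Y k" using i by auto
  let ?D = "subtopology (powertop_real UNIV) (standard_simplex k)"
  let ?P = "presimplex_topology Y"
  have comp: "openin ?P ({i} \<times> U)" if "openin ?D U" for U
  proof -
    have "openin (case j of (k, \<sigma>) \<Rightarrow> subtopology (powertop_real UNIV) (standard_simplex k)) {x. (j, x) \<in> {i} \<times> U}" for j
      using that k by (cases "j = i") auto
    moreover have "U \<subseteq> topspace ?D" using that openin_subset by blast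
    ultimately show ?thesis
      unfolding presimplex_topology_def openin_sum_topology using i k by auto
  qed
  have oc: "openin ?P ({i} \<times> standard_simplex (fst i))"
    using comp[OF openin_topspace] k by simp
  then show "openin (prod_topology Z ?P) (topspace Z \<times> {i} \<times> standard_simplex (fst i))"
    by (simp add: openin_prod_Times_iff)
  let ?S = "subtopology ?P ({i} \<times> standard_simplex (fst i))"
  have "continuous_map ?S ?D snd"
    unfolding continuous_map_def
  proof (intro conjI allI impI)
    show "snd \<in> topspace ?S \<rightarrow> topspace ?D" using k by auto
    fix U assume U: "openin ?D U"
    have "U \<subseteq> standard_simplex k" using openin_subset[OF U] by simp
    then have "{x \<in> topspace ?S. snd x \<in> U} = ({i} \<times> U) \<inter> ({i} \<times> standard_simplex (fst i))"
      using openin_subset[OF comp[OF U]] k by auto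
    then show "openin ?S {x \<in> topspace ?S. snd x \<in> U}"
      using comp[OF U] by (auto simp: openin_subtopology)
  qed
  then have "continuous_map (prod_topology Z ?S) (prod_topology Z ?D) (\<lambda>z. (fst z, snd (snd z)))"
    by (intro continuous_map_pairedI continuous_map_fst)
       (auto intro: continuous_map_compose[OF continuous_map_snd, unfolded comp_def])
  from continuous_map_compose[OF this cont[OF k(2)]]
  have "continuous_map (prod_topology Z ?S) T h"
    by (rule continuous_map_eq) (auto simp: k)
  then show "continuous_map (subtopology (prod_topology Z ?P) (topspace Z \<times> {i} \<times> standard_simplex (fst i))) T h"
    by (simp add: subtopology_Times)
next
  fix z assume z: "z \<in> topspace (prod_topology Z (presimplex_topology Y))"
  obtain s k \<sigma> x where zz: "z = (s, ((k, \<sigma>), x))" by (metis prod.collapse)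
  have "s \<in> topspace Z" "\<sigma> \<in> simplices Y k" "x \<in> standard_simplex k"
    using z by (auto simp: zz topspace_presimplex)
  then show "\<exists>j. j \<in> (SIGMA k:UNIV. simplices Y k) \<and> z \<in> topspace Z \<times> {j} \<times> standard_simplex (fst j) \<and> h z = h z"
    by (intro exI[of _ "(k, \<sigma>)"]) (simp add: zz)
qed simp

text \<open>For compact Hausdorff Z the product of the identity with the quotient map onto the
  realization is again a quotient map, so homotopies may be defined cell by cell. This is how
  homotopies out of a realization become continuous.\<close>

lemma continuous_prod_realization:
  assumes Z: "compact_space Z" "Hausdorff_space Z"
    and cont: "\<And>k \<sigma>. \<sigma> \<in> simplices (cover_sset K) k \<Longrightarrow>
      continuous_map (prod_topology Z (subtopology (powertop_real UNIV) (standard_simplex k))) T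
        (\<lambda>(s, x). F s (wlist ((k, \<sigma>), x)))"
    and drop: "\<And>s u v w. s \<in> topspace Z \<Longrightarrow> u @ (v, 0) # w \<in> weighted K \<Longrightarrow> F s (u @ w) = F s (u @ (v, 0) # w)"
    and merge: "\<And>s u v a b w. s \<in> topspace Z \<Longrightarrow> u @ (v, a) # (v, b) # w \<in> weighted K \<Longrightarrow>
      F s (u @ (v, a) # (v, b) # w) = F s (u @ (v, a + b) # w)"
  obtains H where "continuous_map (prod_topology Z (realization (cover_sset K))) T H"
    and "\<And>s ws. s \<in> topspace Z \<Longrightarrow> ws \<in> weighted K \<Longrightarrow> H (s, wpoint K ws) = F s ws"
proof -
  let ?P = "presimplex_topology (cover_sset K)"
  define q where "q = (\<lambda>(s :: 'a, p). (s, gluing_equiv (cover_sset K) `` {p}))"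
  have qm: "quotient_map (prod_topology Z ?P) (prod_topology Z (realization (cover_sset K))) q"
    unfolding q_def
    by (rule quotient_map_prod_right[OF compact_imp_locally_compact_space[OF Z(1)] _ quotient_map_realization])
       (use Z in simp)
  have c: "continuous_map (prod_topology Z ?P) T (\<lambda>(s, p). F s (wlist p))"
    by (rule continuous_prod_presimplex) (use cont in simp)
  obtain H where H: "continuous_map (prod_topology Z (realization (cover_sset K))) T H"
    "\<And>x. x \<in> topspace (prod_topology Z ?P) \<Longrightarrow> H (q x) = (\<lambda>(s, p). F s (wlist p)) x"
  proof (rule quotient_map_lift_exists[OF qm c])
    fix x y assume x: "x \<in> topspace (prod_topology Z ?P)" and y: "y \<in> topspace (prod_topology Z ?P)" and e: "q x = q y"
    obtain s p where "x = (s, p)" by (rule prod.exhaust)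
    moreover obtain s' p' where "y = (s', p')" by (rule prod.exhaust)
    ultimately have xy: "x = (s, p)" "y = (s', p')" by simp_all
    have s: "s' = s" "s \<in> topspace Z" "p \<in> topspace ?P" "p' \<in> topspace ?P" using x y e by (auto simp: xy q_def)
    have "wpoint K (wlist p) = wpoint K (wlist p')" using e s by (simp add: xy q_def flip: wpoint_wlist)
    then have "F s (wlist p) = F s (wlist p')"
      by (rule wpoint_respects) (use s drop merge wlist_in in blast)+
    then show "(\<lambda>(s, p). F s (wlist p)) x = (\<lambda>(s, p). F s (wlist p)) y" by (simp add: xy s)
  qed blast
  show ?thesis
  proof (rule that[OF H(1)])
    fix s ws assume "s \<in> topspace Z" and ws: "ws \<in> weighted K"
    then show "H (s, wpoint K ws) = F s ws"
      using H(2)[of "(s, wrep ws)"] wrep_in[OF ws] by (simp add: q_def wpoint_def wlist_wrep weighted_def)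
  qed
qed

text \<open>The prefix u collects the entries already kept, since the list moves take place in the
  middle of a list.\<close>

lemma wpoint_filter_aux:
  "u @ ws \<in> weighted K \<Longrightarrow> wpoint K (u @ filter (\<lambda>w. snd w \<noteq> 0) ws) = wpoint K (u @ ws) \<and>
    u @ filter (\<lambda>w. snd w \<noteq> 0) ws \<in> weighted K"
proof (induction ws arbitrary: u)
  case (Cons p ws)
  obtain v a where p: "p = (v, a)" by force
  show ?case
  proof (cases "a = 0")
    case True
    then show ?thesis
      using Cons.IH[of u] Cons.prems weighted_drop[of u v ws K] wpoint_drop[of u v ws K] by (simp add: p)
  next
    case False
    then show ?thesis using Cons.IH[of "u @ [p]"] Cons.prems by (simp add: p)
  qed
qed simp

lemma wpoint_filter:
  assumes "ws \<in> weighted K"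
  shows "wpoint K (filter (\<lambda>w. snd w \<noteq> 0) ws) = wpoint K ws"
    and "filter (\<lambda>w. snd w \<noteq> 0) ws \<in> weighted K"
  using wpoint_filter_aux[of "[]" ws K] assms by auto

text \<open>The first weight must vary in the induction because every merge adds to it.\<close>

lemma wpoint_const_aux:
  "(y, a) # ws \<in> weighted K \<Longrightarrow> fst ` set ws \<subseteq> {y} \<Longrightarrow> wpoint K ((y, a) # ws) = wpoint K [(y, 1)]"
proof (induction ws arbitrary: a)
  case Nil
  then show ?case by (simp add: weighted_def)
next
  case (Cons p ws)
  then obtain b where p: "p = (y, b)" by (cases p) auto
  show ?case
    using Cons.IH[of "a + b"] Cons.prems weighted_merge[of "[]" y a b ws K] wpoint_merge[of "[]" y a b ws K]
    by (simp add: p)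
qed

lemma wpoint_const:
  assumes "ws \<in> weighted K" "fst ` set ws \<subseteq> {y}"
  shows "wpoint K ws = wpoint K [(y, 1)]"
proof -
  obtain p ws' where "ws = p # ws'" using assms(1) by (cases ws) (auto simp: weighted_def)
  moreover from this obtain a where "p = (y, a)" using assms(2) by (cases p) auto
  ultimately show ?thesis using wpoint_const_aux[of y a ws' K] assms by simp
qed

lemma vertex_point_eq: "vertex_point (cover_sset K) [y] = wpoint K [(y, 1)]"
proof -
  have "(\<lambda>i. if i = 0 then 1 else 0) = (\<lambda>j. if j < length [(y, 1::real)] then snd ([(y, 1)] ! j) else 0)"
    by auto
  then have "((0, [y]), \<lambda>i. if i = 0 then 1 else 0) = wrep [(y, 1)]" by (simp add: wrep_def)
  then show ?thesis by (simp only: vertex_point_def wpoint_def)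
qed

section \<open>Maps induced by vertex maps, and homotopies between contiguous maps\<close>

definition wmap :: "'a set set \<Rightarrow> 'b set set \<Rightarrow> ('a \<Rightarrow> 'b) \<Rightarrow> 'a list realization_point \<Rightarrow> 'b list realization_point"
  where "wmap K K' f p = wpoint K' (map (apfst f) (SOME ws. ws \<in> weighted K \<and> wpoint K ws = p))"

lemma weighted_map:
  assumes "ws \<in> weighted K" "\<And>B. B \<in> K \<Longrightarrow> \<exists>B'\<in>K'. f ` B \<subseteq> B'"
  shows "map (apfst f) ws \<in> weighted K'"
proof -
  obtain B where "B \<in> K" "fst ` set ws \<subseteq> B" using assms(1) by (auto simp: weighted_def)
  moreover obtain B' where "B' \<in> K'" "f ` B \<subseteq> B'" using assms(2) \<open>B \<in> K\<close> by blast
  ultimately have "\<exists>B'\<in>K'. fst ` set (map (apfst f) ws) \<subseteq> B'"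
    by (intro bexI[of _ B']) force+
  moreover have "map snd (map (apfst f) ws) = map snd ws" by simp
  ultimately show ?thesis using assms(1) unfolding weighted_def by (auto simp del: map_map)
qed

text \<open>Applying f entrywise turns each list move into a move of the same kind, so by
  \<open>wpoint_respects\<close> the representative chosen in \<open>wmap\<close> does not
  matter.\<close>

lemma wmap_wpoint:
  assumes "ws \<in> weighted K" "\<And>B. B \<in> K \<Longrightarrow> \<exists>B'\<in>K'. f ` B \<subseteq> B'"
  shows "wmap K K' f (wpoint K ws) = wpoint K' (map (apfst f) ws)"
proof -
  let ?ws = "SOME ws'. ws' \<in> weighted K \<and> wpoint K ws' = wpoint K ws"
  have "?ws \<in> weighted K \<and> wpoint K ?ws = wpoint K ws"
    by (rule someI[of _ ws]) (use assms in simp)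
  moreover have "wpoint K' (map (apfst f) ws') = wpoint K' (map (apfst f) ws)"
    if "ws' \<in> weighted K" "wpoint K ws' = wpoint K ws" for ws'
  proof (rule wpoint_respects[where F = "\<lambda>ws. wpoint K' (map (apfst f) ws)", OF that(2,1) assms(1)])
    fix u v w assume "u @ (v, 0) # w \<in> weighted K"
    from weighted_map[OF this assms(2)]
    show "wpoint K' (map (apfst f) (u @ w)) = wpoint K' (map (apfst f) (u @ (v, 0) # w))"
      using wpoint_drop by simp
  next
    fix u v a b w assume "u @ (v, a) # (v, b) # w \<in> weighted K"
    from weighted_map[OF this assms(2)]
    show "wpoint K' (map (apfst f) (u @ (v, a) # (v, b) # w)) = wpoint K' (map (apfst f) (u @ (v, a + b) # w))"
      using wpoint_merge by simp
  qed
  ultimately show ?thesis by (simp add: wmap_def)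
qed

text \<open>The straight line from \<open>f\<close> to \<open>g\<close> inside the simplex spanned by the images under both
  maps; this replaces the usual triangulation of the product with an interval.\<close>

definition cylinder :: "('a \<Rightarrow> 'b) \<Rightarrow> ('a \<Rightarrow> 'b) \<Rightarrow> real \<Rightarrow> ('a \<times> real) list \<Rightarrow> ('b \<times> real) list" where
  "cylinder f g s ws = map (\<lambda>w. (f (fst w), (1 - s) * snd w)) ws @ map (\<lambda>w. (g (fst w), s * snd w)) ws"

lemma weighted_cylinder:
  assumes "ws \<in> weighted K" "\<And>B. B \<in> K \<Longrightarrow> \<exists>B'\<in>K'. f ` B \<union> g ` B \<subseteq> B'" "0 \<le> s" "s \<le> 1"
  shows "cylinder f g s ws \<in> weighted K'"
proof -
  obtain B where "B \<in> K" "fst ` set ws \<subseteq> B" using assms(1) by (auto simp: weighted_def)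
  moreover obtain B' where "B' \<in> K'" "f ` B \<union> g ` B \<subseteq> B'" using assms(2) \<open>B \<in> K\<close> by blast
  ultimately have "\<exists>B'\<in>K'. fst ` set (cylinder f g s ws) \<subseteq> B'"
    by (intro bexI[of _ B']) (force simp: cylinder_def)+
  moreover have "sum_list (map snd (cylinder f g s ws)) = (1 - s) * sum_list (map snd ws) + s * sum_list (map snd ws)"
    by (simp add: cylinder_def comp_def sum_list_const_mult)
  moreover have "\<forall>w\<in>set (cylinder f g s ws). 0 \<le> snd w" 
    using assms(1,3,4) by (auto simp: cylinder_def weighted_def)
  ultimately show ?thesis using assms(1) by (auto simp: weighted_def cylinder_def)
qed

text \<open>Both images of a simplex lie in one simplex of the target, so the straight line
  \<open>cylinder\<close> between them is defined there. At the base point the line joins z to z and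
  is constant, which makes the homotopy based.\<close>

lemma contiguous_homotopic:
  assumes con: "\<And>B. B \<in> K \<Longrightarrow> \<exists>B'\<in>K'. f ` B \<union> g ` B \<subseteq> B'"
    and y: "f y = z" "g y = z" "y \<in> \<Union>K"
  shows "homotopic_with (\<lambda>h. h (wpoint K [(y, 1)]) = wpoint K' [(z, 1)])
    (realization (cover_sset K)) (realization (cover_sset K')) (wmap K K' f) (wmap K K' g)"
proof -
  let ?I = "top_of_set {0..1::real}"
  have f: "\<And>B. B \<in> K \<Longrightarrow> \<exists>B'\<in>K'. f ` B \<subseteq> B'" and g: "\<And>B. B \<in> K \<Longrightarrow> \<exists>B'\<in>K'. g ` B \<subseteq> B'"
    using con by (meson le_supE)+
  have cyl: "cylinder f g s ws \<in> weighted K'" if "ws \<in> weighted K" "s \<in> {0..1}" for s ws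
    using weighted_cylinder[OF that(1) con] that by simp
  obtain H where H: "continuous_map (prod_topology ?I (realization (cover_sset K))) (realization (cover_sset K')) H"
    "\<And>s ws. s \<in> topspace ?I \<Longrightarrow> ws \<in> weighted K \<Longrightarrow> H (s, wpoint K ws) = wpoint K' (cylinder f g s ws)"
  proof (rule continuous_prod_realization[of ?I K "realization (cover_sset K')" "\<lambda>s ws. wpoint K' (cylinder f g s ws)"])
    show "compact_space ?I" by (simp add: compact_space_subtopology)
    show "Hausdorff_space ?I" by (simp add: Hausdorff_space_subtopology)
    fix k \<sigma> assume s: "\<sigma> \<in> simplices (cover_sset K) k"
    then have l: "length \<sigma> = Suc k" by (simp add: simplices_cover_sset)
    let ?D = "subtopology (powertop_real UNIV) (standard_simplex k)"
    let ?L = "\<lambda>z. cylinder f g (fst z) (wlist ((k, \<sigma>), snd z))"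
    have "continuous_map (prod_topology ?I ?D) (realization (cover_sset K')) (\<lambda>z. wpoint K' (?L z))"
    proof (rule continuous_map_wpoint)
      fix z assume z: "z \<in> topspace (prod_topology ?I ?D)"
      then have "wlist ((k, \<sigma>), snd z) \<in> weighted K"
        using s by (intro wlist_in) (auto simp: topspace_presimplex)
      then show "?L z \<in> weighted K'" using cyl z by auto
      show "map fst (?L z) = map f \<sigma> @ map g \<sigma>"
        using map_fst_wlist[OF l, of "snd z"] by (simp add: cylinder_def comp_def flip: map_map[of f fst, unfolded comp_def] map_map[of g fst, unfolded comp_def])
    next
      fix j assume j: "j < length (map f \<sigma> @ map g \<sigma>)"
      have e: "snd (?L z ! j) = (if j < Suc k then (1 - fst z) * snd z j else fst z * snd z (j - Suc k))" for z
        using j l length_wlist[OF l] nth_wlist[OF l] by (auto simp: cylinder_def nth_append)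
      have 1: "continuous_map (prod_topology ?I ?D) euclideanreal fst"
        using continuous_map_fst continuous_map_into_fulltopology by blast
      have "continuous_map ?D euclideanreal (\<lambda>x. x i)" for i
        by (intro continuous_map_from_subtopology continuous_map_product_projection) simp
      from continuous_map_compose[OF continuous_map_snd this]
      have 2: "continuous_map (prod_topology ?I ?D) euclideanreal (\<lambda>z. snd z i)" for i
        by (simp add: comp_def)
      show "continuous_map (prod_topology ?I ?D) euclideanreal (\<lambda>z. snd (?L z ! j))"
        unfolding e using 1 2 by (cases "j < Suc k") (auto intro!: continuous_map_real_mult continuous_map_diff)
    qed
    then show "continuous_map (prod_topology ?I ?D) (realization (cover_sset K')) (\<lambda>(s, x). wpoint K' (cylinder f g s (wlist ((k, \<sigma>), x))))"
      unfolding case_prod_unfold .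
  next
    fix s u v w assume "s \<in> topspace ?I" "u @ (v, 0) # w \<in> weighted K"
    then have c: "cylinder f g s (u @ (v, 0) # w) \<in> weighted K'" using cyl by simp
    let ?A = "map (\<lambda>w. (f (fst w), (1 - s) * snd w))" and ?B = "map (\<lambda>w. (g (fst w), s * snd w))"
    \<comment> \<open>Every list occurs twice in \<open>cylinder\<close>, so one move on it becomes
      two moves, one in each half.\<close>
    have c1: "?A u @ (f v, 0) # (?A w @ ?B u @ (g v, 0) # ?B w) \<in> weighted K'" using c by (simp add: cylinder_def)
    have c2: "(?A u @ ?A w @ ?B u) @ (g v, 0) # ?B w \<in> weighted K'" using weighted_drop[OF c1] by simp
    show "wpoint K' (cylinder f g s (u @ w)) = wpoint K' (cylinder f g s (u @ (v, 0) # w))"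
      using wpoint_drop[OF c1] wpoint_drop[OF c2] by (simp add: cylinder_def)
  next
    fix s u v a b w assume "s \<in> topspace ?I" "u @ (v, a) # (v, b) # w \<in> weighted K"
    then have c: "cylinder f g s (u @ (v, a) # (v, b) # w) \<in> weighted K'" using cyl by simp
    let ?A = "map (\<lambda>w. (f (fst w), (1 - s) * snd w))" and ?B = "map (\<lambda>w. (g (fst w), s * snd w))"
    have c1: "?A u @ (f v, (1 - s) * a) # (f v, (1 - s) * b) # (?A w @ ?B u @ (g v, s * a) # (g v, s * b) # ?B w) \<in> weighted K'"
      using c by (simp add: cylinder_def)
    have c2: "(?A u @ (f v, (1 - s) * a + (1 - s) * b) # ?A w @ ?B u) @ (g v, s * a) # (g v, s * b) # ?B w \<in> weighted K'"
      using weighted_merge[OF c1] by simp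
    show "wpoint K' (cylinder f g s (u @ (v, a) # (v, b) # w)) = wpoint K' (cylinder f g s (u @ (v, a + b) # w))"
      using wpoint_merge[OF c1] wpoint_merge[OF c2] by (simp add: cylinder_def distrib_left)
  qed blast
  \<comment> \<open>At either end of the line one half of \<open>cylinder\<close> has weight 0
    throughout. The image list may contain zeros of its own, so both sides are compared after all
    zeros are removed.\<close>
  have nz: "filter (\<lambda>w. snd w \<noteq> 0) (cylinder f g 0 ws) = filter (\<lambda>w. snd w \<noteq> 0) (map (apfst f) ws)"
    "filter (\<lambda>w. snd w \<noteq> 0) (cylinder f g 1 ws) = filter (\<lambda>w. snd w \<noteq> 0) (map (apfst g) ws)" for ws
    by (auto simp: cylinder_def filter_map comp_def apfst_def map_prod_def case_prod_beta)
  have H0: "H (0, p) = wmap K K' f p" and H1: "H (1, p) = wmap K K' g p" if p: "p \<in> topspace (realization (cover_sset K))" for p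
  proof -
    obtain ws where ws: "ws \<in> weighted K" "p = wpoint K ws" using p by (auto simp: topspace_realization)
    show "H (0, p) = wmap K K' f p"
      using H(2)[of 0 ws] wmap_wpoint[OF ws(1) f] ws wpoint_filter(1)[OF cyl[OF ws(1)], of 0]
        wpoint_filter(1)[OF weighted_map[OF ws(1) f]] nz by simp
    show "H (1, p) = wmap K K' g p"
      using H(2)[of 1 ws] wmap_wpoint[OF ws(1) g] ws wpoint_filter(1)[OF cyl[OF ws(1)], of 1]
        wpoint_filter(1)[OF weighted_map[OF ws(1) g]] nz by simp
  qed
  have y1: "[(y, 1)] \<in> weighted K" using y(3) by (auto simp: weighted_def)
  have "H (t, wpoint K [(y, 1)]) = wpoint K' [(z, 1)]" if t: "t \<in> {0..1}" for t
  proof -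
    have "cylinder f g t [(y, 1)] = [(z, 1 - t), (z, t)]" by (simp add: cylinder_def y)
    then show ?thesis
      using H(2)[of t, OF _ y1] cyl[OF y1 t] t wpoint_const[of "[(z, 1 - t), (z, t)]" K' z] by simp
  qed
  moreover have "wpoint K [(y, 1)] \<in> topspace (realization (cover_sset K))"
    using y1 by (simp add: topspace_realization)
  ultimately show ?thesis
    by (subst homotopic_with) (use H(1) H0 H1 in \<open>auto intro!: exI[of _ H]\<close>)
qed

section \<open>Contractions and obstructions\<close>

text \<open>The affine extension of a vertex function. It comes from the product lemma, applied to a
  function constant along the interval and then restricted to the parameter 0.\<close>

lemma continuous_weighted_sum:
  fixes \<phi> :: "'a \<Rightarrow> real"
  obtains H where "continuous_map (realization (cover_sset K)) euclideanreal H"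
    and "\<And>ws. ws \<in> weighted K \<Longrightarrow> H (wpoint K ws) = (\<Sum>w\<leftarrow>ws. \<phi> (fst w) * snd w)"
proof -
  let ?I = "top_of_set {0..1::real}"
  let ?F = "\<lambda>ws. \<Sum>w\<leftarrow>ws. \<phi> (fst w) * snd w"
  obtain H where H: "continuous_map (prod_topology ?I (realization (cover_sset K))) euclideanreal H"
    "\<And>s ws. s \<in> topspace ?I \<Longrightarrow> ws \<in> weighted K \<Longrightarrow> H (s, wpoint K ws) = ?F ws"
  proof (rule continuous_prod_realization[of ?I K euclideanreal "\<lambda>s. ?F"])
    show "compact_space ?I" by (simp add: compact_space_subtopology)
    show "Hausdorff_space ?I" by (simp add: Hausdorff_space_subtopology)
    fix k \<sigma> assume "\<sigma> \<in> simplices (cover_sset K) k"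
    then have l: "length \<sigma> = Suc k" by (simp add: simplices_cover_sset)
    let ?D = "subtopology (powertop_real UNIV) (standard_simplex k)"
    have e: "?F (wlist ((k, \<sigma>), x)) = (\<Sum>j\<in>{0..<Suc k}. \<phi> (\<sigma> ! j) * x j)" for x
      unfolding sum_list_sum_nth by (rule sum.cong) (auto simp: length_wlist[OF l] nth_wlist[OF l])
    have "continuous_map ?D euclideanreal (\<lambda>x. x i)" for i
      by (intro continuous_map_from_subtopology continuous_map_product_projection) simp
    from continuous_map_compose[OF continuous_map_snd this]
    have 2: "continuous_map (prod_topology ?I ?D) euclideanreal (\<lambda>z. snd z i)" for i
      by (simp add: comp_def)
    show "continuous_map (prod_topology ?I ?D) euclideanreal (\<lambda>(s, x). ?F (wlist ((k, \<sigma>), x)))"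
      unfolding e case_prod_unfold by (intro continuous_map_sum continuous_map_real_mult) (auto intro: 2)
  next
    show "?F (u @ w) = ?F (u @ (v, 0) # w)" for u v w by simp
    show "?F (u @ (v, a) # (v, b) # w) = ?F (u @ (v, a + b) # w)" for u v a b w
      by (simp add: algebra_simps)
  qed blast
  have "continuous_map (realization (cover_sset K)) euclideanreal (\<lambda>p. H (0, p))"
    using continuous_map_o_Pair[OF H(1), of 0] by (simp add: comp_def)
  then show ?thesis using H(2)[of 0] that by auto
qed

text \<open>If the depth were unbounded, a continuous function weighting deep vertices heavily
  enough would be unbounded on the compact set.\<close>

lemma compactin_realization_bounded:
  fixes d :: "'a \<Rightarrow> nat"
  assumes S: "compactin (realization (cover_sset K)) S"
  obtains N where "\<And>p. p \<in> S \<Longrightarrow> \<exists>ws\<in>weighted K. wpoint K ws = p \<and> (\<forall>w\<in>set ws. d (fst w) \<le> N)"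
proof (rule ccontr)
  assume "\<not> thesis"
  then have n: "\<exists>p\<in>S. \<forall>ws\<in>weighted K. wpoint K ws = p \<longrightarrow> (\<exists>w\<in>set ws. N < d (fst w))" for N
    using that by (meson not_le)
  have "\<exists>ws w. ws \<in> weighted K \<and> wpoint K ws \<in> S \<and> w \<in> set ws \<and> snd w > 0 \<and> N < d (fst w)" for N
  proof -
    obtain p where p: "p \<in> S" "\<And>ws. ws \<in> weighted K \<Longrightarrow> wpoint K ws = p \<Longrightarrow> \<exists>w\<in>set ws. N < d (fst w)"
      using n by blast
    have "p \<in> wpoint K ` weighted K"
      using p(1) compactin_subset_topspace[OF S] by (auto simp: topspace_realization)
    then obtain ws where ws: "ws \<in> weighted K" "wpoint K ws = p" by blast
    \<comment> \<open>The deep vertex has to carry positive weight, so it is sought in the list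
      without zeros, which represents the same point.\<close>
    let ?ws = "filter (\<lambda>w. snd w \<noteq> 0) ws"
    obtain w where "w \<in> set ?ws" "N < d (fst w)" using p(2) wpoint_filter[OF ws(1)] ws(2) by blast
    moreover from this have "0 < snd w" using ws(1) by (force simp: weighted_def)
    ultimately show ?thesis using wpoint_filter[OF ws(1)] ws(2) p(1)
      by (intro exI[of _ ?ws] exI[of _ w]) simp
  qed
  then obtain ws w where w: "\<And>N. ws N \<in> weighted K" "\<And>N. wpoint K (ws N) \<in> S" "\<And>N. w N \<in> set (ws N)"
    "\<And>N. snd (w N) > 0" "\<And>N. N < d (fst (w N))" by metis
  \<comment> \<open>The coefficient \<open>c M\<close> is at least \<open>real j / snd (w j)\<close>
    for every j \<le> M. As \<open>fst (w N)\<close> has depth above N, this single vertex makes the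
    value of H at the N-th point at least N.\<close>
  define c where "c N = (\<Sum>j\<le>N. real j / snd (w j))" for N
  have cpos: "c N \<ge> 0" for N unfolding c_def using w(4) by (intro sum_nonneg) (simp add: less_imp_le)
  have cge: "c M \<ge> real N / snd (w N)" if "N \<le> M" for N M
    unfolding c_def using w(4) that by (intro member_le_sum) (auto simp: less_imp_le)
  obtain H where H: "continuous_map (realization (cover_sset K)) euclideanreal H"
    "\<And>ws. ws \<in> weighted K \<Longrightarrow> H (wpoint K ws) = (\<Sum>w\<leftarrow>ws. c (d (fst w)) * snd w)"
    using continuous_weighted_sum[of K "\<lambda>v. c (d v)"] by blast
  have "compactin euclideanreal (H ` S)" by (rule image_compactin[OF S H(1)])
  then have "bounded (H ` S)" by (simp add: compact_imp_bounded)
  then obtain b where b: "\<And>p. p \<in> S \<Longrightarrow> H p \<le> b" unfolding bounded_iff by (force simp: abs_le_iff)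
  have le: "real N \<le> b" for N
  proof -
    have "real N \<le> c (d (fst (w N))) * snd (w N)"
      using cge[of N "d (fst (w N))"] w(4,5)[of N] by (simp add: divide_le_eq)
    also have "\<dots> \<le> (\<Sum>w\<leftarrow>ws N. c (d (fst w)) * snd w)"
      using w(1,3)[of N] cpos by (intro member_le_sum_list) (auto simp: weighted_def)
    also have "\<dots> \<le> b" using H(2)[OF w(1)[of N]] b[OF w(2)[of N]] by simp
    finally show ?thesis .
  qed
  obtain N where "b < real N" using reals_Archimedean2 by blast
  then show False using le[of N] by linarith
qed

lemma gluing_equiv_mono:
  assumes "\<And>B. B \<in> K \<Longrightarrow> \<exists>B'\<in>K'. B \<subseteq> B'"
  shows "gluing_equiv (cover_sset K) \<subseteq> gluing_equiv (cover_sset K')"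
proof -
  have s: "simplices (cover_sset K) k \<subseteq> simplices (cover_sset K') k" for k
  proof
    fix xs assume "xs \<in> simplices (cover_sset K) k"
    then obtain B where B: "length xs = Suc k" "B \<in> K" "set xs \<subseteq> B" by (auto simp: simplices_cover_sset)
    obtain B' where "B' \<in> K'" "B \<subseteq> B'" using assms B(2) by blast
    then show "xs \<in> simplices (cover_sset K') k" using B by (auto simp: simplices_cover_sset)
  qed
  then have "gluing (cover_sset K) \<subseteq> gluing (cover_sset K')"
    unfolding gluing_def face_cover_sset degen_cover_sset by blast
  then have "(gluing (cover_sset K) \<union> (gluing (cover_sset K))\<inverse>)\<^sup>* \<subseteq> (gluing (cover_sset K') \<union> (gluing (cover_sset K'))\<inverse>)\<^sup>*"
    by (intro rtrancl_mono) blast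
  moreover have "topspace (presimplex_topology (cover_sset K)) \<subseteq> topspace (presimplex_topology (cover_sset K'))"
  proof
    fix q assume q: "q \<in> topspace (presimplex_topology (cover_sset K))"
    obtain k \<sigma> x where "q = ((k, \<sigma>), x)" by (metis prod.collapse)
    then show "q \<in> topspace (presimplex_topology (cover_sset K'))" using q s by (auto simp: topspace_presimplex)
  qed
  ultimately show ?thesis unfolding gluing_equiv_def by blast
qed

text \<open>Saturating a class under the larger gluing relation keeps its representatives. This
  identifies the inclusion with step 0 of a contraction.\<close>

lemma realization_incl_eq:
  assumes K: "\<And>B. B \<in> K \<Longrightarrow> \<exists>B'\<in>K'. B \<subseteq> B'" and p: "p \<in> topspace (realization (cover_sset K))"
  shows "realization_incl (cover_sset K') p = wmap K K' id p"
proof -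
  obtain ws where ws: "ws \<in> weighted K" "p = wpoint K ws" using p by (auto simp: topspace_realization)
  have e: "equiv (topspace (presimplex_topology Y)) (gluing_equiv Y)" for Y :: "'a list sset"
    by (rule equiv_gluing_equiv)
  have mem: "(wrep ws, wrep ws) \<in> gluing_equiv (cover_sset K)"
    using equiv_class_self[OF e wrep_in[OF ws(1)]] by simp
  have "gluing_equiv (cover_sset K') `` p = gluing_equiv (cover_sset K') `` {wrep ws}"
  proof (intro equalityI subsetI)
    fix q assume "q \<in> gluing_equiv (cover_sset K') `` p"
    then obtain q' where q': "(q', q) \<in> gluing_equiv (cover_sset K')" "(wrep ws, q') \<in> gluing_equiv (cover_sset K)"
      by (auto simp: ws(2) wpoint_def)
    then have "(wrep ws, q') \<in> gluing_equiv (cover_sset K')" using gluing_equiv_mono[OF K] by blast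
    then show "q \<in> gluing_equiv (cover_sset K') `` {wrep ws}"
      using q'(1) e[of "cover_sset K'"] by (auto simp: equiv_def dest: transD)
  next
    fix q assume "q \<in> gluing_equiv (cover_sset K') `` {wrep ws}"
    then show "q \<in> gluing_equiv (cover_sset K') `` p" using mem by (auto simp: ws(2) wpoint_def)
  qed
  also have "\<dots> = wpoint K' (map (apfst id) ws)" by (simp add: wpoint_def apfst_def map_prod_def case_prod_beta)
  also have "\<dots> = wmap K K' id p" unfolding ws(2) by (rule wmap_wpoint[symmetric]) (use ws K in simp_all)
  finally show ?thesis by (simp add: realization_incl_def)
qed

lemma cube_boundary_subset: "cube_boundary k \<subseteq> topspace (cube k)"
  by (auto simp: cube_boundary_def)

text \<open>Let the depth of x be the first index from which on f j x = y. The image of the cube is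
  compact, so its points are represented by vertices of depth at most some N. Contiguity joins f 0,
  the inclusion, to f N in N homotopies, and f N is constant on the image. All f j fix y, so the
  boundary stays at the base point throughout.\<close>

lemma homotopy_trivial:
  fixes f :: "nat \<Rightarrow> 'a \<Rightarrow> 'a"
  assumes f0: "f 0 = id" and fy: "\<And>j. f j y = y" and ev: "\<And>x. \<exists>N. \<forall>j\<ge>N. f j x = y"
    and con: "\<And>B j. B \<in> K \<Longrightarrow> \<exists>B'\<in>K'. f j ` B \<union> f (Suc j) ` B \<subseteq> B'"
    and y: "y \<in> \<Union>K"
    and c: "c \<in> homotopy_group k (realization (cover_sset K)) (vertex_point (cover_sset K) [y])"
  shows "homotopy_induced k (realization (cover_sset K')) (vertex_point (cover_sset K') [y])
      (realization_incl (cover_sset K')) c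
    = homotopy_one k (realization (cover_sset K')) (vertex_point (cover_sset K') [y])"
proof -
  let ?R = "realization (cover_sset K)" and ?R' = "realization (cover_sset K')"
  let ?p = "wpoint K [(y, 1)]" and ?p' = "wpoint K' [(y, 1)]"
  let ?P = "\<lambda>h. \<forall>x\<in>cube_boundary k. h x = ?p'"
  let ?i = "realization_incl (cover_sset K')"
  have sub: "\<exists>B'\<in>K'. f j ` B \<subseteq> B'" if "B \<in> K" for B j using con[OF that, of j] by blast
  have K: "\<exists>B'\<in>K'. B \<subseteq> B'" if "B \<in> K" for B using sub[OF that, of 0] by (simp add: f0)
  define d where "d x = (LEAST N. \<forall>j\<ge>N. f j x = y)" for x
  have d: "f j x = y" if "d x \<le> j" for j x
  proof -
    have "\<forall>j\<ge>d x. f j x = y" unfolding d_def by (rule LeastI_ex[OF ev])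
    then show ?thesis using that by blast
  qed
  have null: "homotopic_with ?P (cube k) ?R' (?i \<circ> h) (\<lambda>_. ?p')"
    if h: "continuous_map (cube k) ?R h" "\<forall>x\<in>cube_boundary k. h x = ?p" for h
  proof -
    have "compact_space (cube k)"
      unfolding cube_def by (simp add: compact_space_product_topology compact_space_subtopology)
    then have "compactin ?R (h ` topspace (cube k))"
      using image_compactin[OF _ h(1)] by (simp add: compact_space_def)
    then obtain N where N: "\<And>p. p \<in> h ` topspace (cube k) \<Longrightarrow>
        \<exists>ws\<in>weighted K. wpoint K ws = p \<and> (\<forall>w\<in>set ws. d (fst w) \<le> N)"
      using compactin_realization_bounded[of K "h ` topspace (cube k)" d] by blast
    have hin: "h x \<in> topspace ?R" if "x \<in> topspace (cube k)" for x
      using that h(1) continuous_map_image_subset_topspace by blast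
    have step: "homotopic_with ?P (cube k) ?R' (wmap K K' (f j) \<circ> h) (wmap K K' (f (Suc j)) \<circ> h)" for j
      by (rule homotopic_with_compose_continuous_map_right[OF contiguous_homotopic[OF con fy fy y] h(1)])
         (use h(2) in auto)
    have wy: "wmap K K' (f j) ?p = ?p'" for j
      using wmap_wpoint[of "[(y, 1)]" K K' "f j"] sub y by (auto simp: weighted_def fy)
    have cont: "continuous_map (cube k) ?R' (wmap K K' (f j) \<circ> h)" for j
      using homotopic_with_imp_continuous_maps[OF step] by blast
    have chain: "homotopic_with ?P (cube k) ?R' (wmap K K' (f 0) \<circ> h) (wmap K K' (f j) \<circ> h)" for j
    proof (induction j)
      case 0
      then show ?case using cont[of 0] h(2) wy[of 0] by (auto simp: comp_def)
    next
      case (Suc j)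
      then show ?case using step homotopic_with_trans by blast
    qed
    have "homotopic_with ?P (cube k) ?R' (?i \<circ> h) (wmap K K' (f 0) \<circ> h)"
    proof (rule homotopic_with_symD, rule homotopic_with_equal)
      show "(wmap K K' (f 0) \<circ> h) x = (?i \<circ> h) x" if "x \<in> topspace (cube k)" for x
        using realization_incl_eq[OF K hin[OF that]] by (simp add: f0)
      then show "\<forall>x\<in>cube_boundary k. (?i \<circ> h) x = ?p'"
        using cube_boundary_subset h(2) wy by (metis comp_apply subsetD)
    qed (use cont h(2) wy in auto)
    moreover have "homotopic_with ?P (cube k) ?R' (wmap K K' (f N) \<circ> h) (\<lambda>_. ?p')"
    proof (rule homotopic_with_equal)
      fix x assume "x \<in> topspace (cube k)"
      then have "h x \<in> h ` topspace (cube k)" by (rule imageI)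
      from N[OF this] obtain ws where ws: "ws \<in> weighted K" "wpoint K ws = h x" "\<forall>w\<in>set ws. d (fst w) \<le> N"
        by blast
      have "wmap K K' (f N) (h x) = wpoint K' (map (apfst (f N)) ws)"
        using wmap_wpoint[OF ws(1) sub] ws(2) by simp
      also have "\<dots> = ?p'"
      proof (rule wpoint_const[OF weighted_map[OF ws(1) sub]])
        show "fst ` set (map (apfst (f N)) ws) \<subseteq> {y}"
          unfolding set_map image_image by (rule image_subsetI) (use ws(3) d in simp)
      qed
      finally show "(wmap K K' (f N) \<circ> h) x = ?p'" by simp
    qed (use cont h(2) wy in auto)
    ultimately show ?thesis using chain[of N] homotopic_with_trans by blast
  qed
  obtain f0 where f0: "f0 \<in> cube_maps k ?R ?p" "c = cube_homotopy k ?R ?p `` {f0}"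
    using c unfolding homotopy_group_def vertex_point_eq quotient_def by blast
  have "homotopic_with (\<lambda>h. \<forall>x\<in>cube_boundary k. h x = ?p) (cube k) ?R f0 f0"
    using f0(1) by (simp add: cube_maps_def)
  then have ne: "f0 \<in> c" by (simp add: f0(2) cube_homotopy_def)
  \<comment> \<open>The induced map is defined by the images of all members of the class c, so each
    of them has to be null-homotopic; \<open>ne\<close> ensures that there is one.\<close>
  have "cube_homotopy k ?R' ?p' `` {?i \<circ> h} = cube_homotopy k ?R' ?p' `` {\<lambda>_. ?p'}" if "h \<in> c" for h
  proof -
    have hom: "homotopic_with (\<lambda>h. \<forall>x\<in>cube_boundary k. h x = ?p) (cube k) ?R f0 h"
      using that by (simp add: f0(2) cube_homotopy_def)
    have "homotopic_with ?P (cube k) ?R' (?i \<circ> h) (\<lambda>_. ?p')"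
      by (rule null) (use homotopic_with_imp_continuous_maps[OF hom] homotopic_with_imp_property[OF hom] in blast)+
    then show ?thesis
      unfolding cube_homotopy_def by (auto intro: homotopic_with_trans dest: homotopic_with_symD)
  qed
  then have "homotopy_induced k ?R' ?p' ?i c = cube_homotopy k ?R' ?p' `` {\<lambda>_. ?p'}"
    using ne unfolding homotopy_induced_def by blast
  then show ?thesis by (simp add: vertex_point_eq homotopy_one_def)
qed

text \<open>The affine extension of the indicator of \<phi> takes only the values 0 and 1 on the
  larger stage, because \<phi> is constant on its members. A path from y to z would be a connected
  set containing both values.\<close>

lemma pi0_nontrivial:
  fixes \<phi> :: "'a \<Rightarrow> bool"
  assumes K: "\<And>B. B \<in> K \<Longrightarrow> \<exists>B'\<in>K'. B \<subseteq> B'" and \<phi>: "\<And>B u v. B \<in> K' \<Longrightarrow> u \<in> B \<Longrightarrow> v \<in> B \<Longrightarrow> \<phi> u = \<phi> v"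
    and y: "y \<in> \<Union>K" and z: "z \<in> \<Union>K" and ne: "\<phi> y \<noteq> \<phi> z"
  shows "\<exists>c\<in>homotopy_group 0 (realization (cover_sset K)) (vertex_point (cover_sset K) [y]).
    homotopy_induced 0 (realization (cover_sset K')) (vertex_point (cover_sset K') [y])
      (realization_incl (cover_sset K')) c
    \<noteq> homotopy_one 0 (realization (cover_sset K')) (vertex_point (cover_sset K') [y])"
proof -
  let ?R = "realization (cover_sset K)" and ?R' = "realization (cover_sset K')"
  let ?p = "wpoint K [(y, 1)]" and ?p' = "wpoint K' [(y, 1)]"
  let ?q = "wpoint K [(z, 1)]" and ?q' = "wpoint K' [(z, 1)]"
  let ?i = "realization_incl (cover_sset K')"
  have b: "cube_boundary 0 = {}" by (simp add: cube_boundary_def)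
  have z1: "[(z, 1)] \<in> weighted K" using z by (auto simp: weighted_def)
  have z1': "[(z, 1)] \<in> weighted K'" and y1': "[(y, 1)] \<in> weighted K'"
    using z y K unfolding weighted_def by (simp, blast)+
  have zt: "?q \<in> topspace ?R" using z1 by (simp add: topspace_realization)
  have iz: "?i ?q = ?q'"
    using realization_incl_eq[OF K zt] wmap_wpoint[OF z1, of K' id] K by simp
  let ?f = "\<lambda>_ :: nat \<Rightarrow> real. ?q"
  have fm: "?f \<in> cube_maps 0 ?R ?p" using zt by (simp add: cube_maps_def b)
  let ?c = "cube_homotopy 0 ?R ?p `` {?f}"
  have cin: "?c \<in> homotopy_group 0 ?R ?p" unfolding homotopy_group_def by (rule quotientI[OF fm])
  have fc: "?f \<in> ?c" using fm by (simp add: cube_homotopy_def cube_maps_def b)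
  have "homotopy_induced 0 ?R' ?p' ?i ?c \<noteq> homotopy_one 0 ?R' ?p'"
  proof
    assume e: "homotopy_induced 0 ?R' ?p' ?i ?c = homotopy_one 0 ?R' ?p'"
    have "?i \<circ> ?f \<in> homotopy_induced 0 ?R' ?p' ?i ?c"
      unfolding homotopy_induced_def
      by (rule ImageI[OF _ imageI[OF fc]]) (use z1' in \<open>simp add: cube_homotopy_def b iz comp_def topspace_realization\<close>)
    then have "homotopic_with (\<lambda>h. True) (cube 0) ?R' (\<lambda>_. ?p') (\<lambda>_. ?q')"
      unfolding e homotopy_one_def by (simp add: cube_homotopy_def b comp_def iz)
    moreover have "(\<lambda>_. undefined) \<in> topspace (cube 0)" by (simp add: cube_def)
    then have "cube 0 \<noteq> trivial_topology" by auto
    ultimately have "path_component_of ?R' ?p' ?q'" by (simp add: homotopic_constant_maps)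
    then obtain g where g: "pathin ?R' g" "g 0 = ?p'" "g 1 = ?q'" unfolding path_component_of_def by blast
    obtain H where H: "continuous_map ?R' euclideanreal H"
      "\<And>ws. ws \<in> weighted K' \<Longrightarrow> H (wpoint K' ws) = (\<Sum>w\<leftarrow>ws. of_bool (\<phi> (fst w)) * snd w)"
      using continuous_weighted_sum[of K' "\<lambda>v. of_bool (\<phi> v)"] by blast
    have H01: "H p \<in> {0, 1}" if p: "p \<in> topspace ?R'" for p
    proof -
      obtain ws where ws: "ws \<in> weighted K'" "p = wpoint K' ws" using p by (auto simp: topspace_realization)
      then obtain B where B: "B \<in> K'" "fst ` set ws \<subseteq> B" by (auto simp: weighted_def)
      obtain w0 where w0: "w0 \<in> set ws" using ws by (cases ws) (auto simp: weighted_def)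
      have "(\<Sum>w\<leftarrow>ws. of_bool (\<phi> (fst w)) * snd w) = (\<Sum>w\<leftarrow>ws. of_bool (\<phi> (fst w0)) * snd w)"
        by (rule arg_cong[where f = sum_list], rule map_cong) (use \<phi>[OF B(1)] B(2) w0 in auto)
      also have "\<dots> = of_bool (\<phi> (fst w0))" using ws(1) by (simp add: sum_list_const_mult weighted_def)
      finally show ?thesis using H(2)[OF ws(1)] ws(2) by simp
    qed
    have gc: "continuous_map (top_of_set {0..1}) ?R' g" using g(1) by (simp add: pathin_def)
    have "continuous_map (top_of_set {0..1}) euclideanreal (H \<circ> g)"
      by (rule continuous_map_compose[OF gc H(1)])
    then have "connected ((H \<circ> g) ` {0..1})"
      by (intro connected_continuous_image) auto
    moreover have "(H \<circ> g) ` {0..1} \<subseteq> {0, 1}"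
    proof (rule image_subsetI)
      fix t :: real assume "t \<in> {0..1}"
      then have "g t \<in> topspace ?R'" using continuous_map_image_subset_topspace[OF gc] by auto
      then show "(H \<circ> g) t \<in> {0, 1}" using H01 by simp
    qed
    ultimately obtain r where "(H \<circ> g) ` {0..1} = {r}"
      using connected_finite_iff_sing[of "(H \<circ> g) ` {0..1}"] finite_subset[of "(H \<circ> g) ` {0..1}" "{0, 1}"] by auto
    moreover have "(0::real) \<in> {0..1}" "(1::real) \<in> {0..1}" by simp_all
    ultimately have "(H \<circ> g) 0 = (H \<circ> g) 1" by (metis imageI singletonD)
    then show False using g H(2)[OF y1'] H(2)[OF z1'] ne by (cases "\<phi> z") auto
  qed
  then show ?thesis using cin unfolding vertex_point_eq by blast
qed

section \<open>The prism operator\<close>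

definition fibrewise_additive :: "('k \<Rightarrow> 'r::ab_group_add \<Rightarrow> 'b::ab_group_add) \<Rightarrow> bool" where
  "fibrewise_additive \<phi> \<longleftrightarrow> (\<forall>s a b. \<phi> s (a + b) = \<phi> s a + \<phi> s b)"

text \<open>The homomorphism on formal sums determined by its values on single terms. For
  \<open>fibrewise_additive\<close> \<phi> a coefficient 0 contributes nothing, so any finite
  superset of the keys may be summed over.\<close>

definition lift_sum :: "('k \<Rightarrow> 'r::ab_group_add \<Rightarrow> 'b::ab_group_add) \<Rightarrow> ('k \<Rightarrow>\<^sub>0 'r) \<Rightarrow> 'b" where
  "lift_sum \<phi> c = (\<Sum>s\<in>Poly_Mapping.keys c. \<phi> s (Poly_Mapping.lookup c s))"

lemma fibrewise_additive_zero: "fibrewise_additive \<phi> \<Longrightarrow> \<phi> s 0 = 0"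
  unfolding fibrewise_additive_def by (metis add.right_neutral add_left_cancel)

lemma lift_sum_superset:
  assumes "fibrewise_additive \<phi>" "finite S" "Poly_Mapping.keys c \<subseteq> S"
  shows "lift_sum \<phi> c = (\<Sum>s\<in>S. \<phi> s (Poly_Mapping.lookup c s))"
  unfolding lift_sum_def
  by (rule sum.mono_neutral_left) (use assms in \<open>auto simp: fibrewise_additive_zero in_keys_iff\<close>)

lemma lift_sum_add:
  assumes "fibrewise_additive \<phi>"
  shows "lift_sum \<phi> (c + d) = lift_sum \<phi> c + lift_sum \<phi> d"
proof -
  let ?S = "Poly_Mapping.keys c \<union> Poly_Mapping.keys d"
  have "lift_sum \<phi> (c + d) = (\<Sum>s\<in>?S. \<phi> s (Poly_Mapping.lookup (c + d) s))"
    by (rule lift_sum_superset[OF assms]) (use Poly_Mapping.keys_add[of c d] in auto)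
  also have "\<dots> = (\<Sum>s\<in>?S. \<phi> s (Poly_Mapping.lookup c s)) + (\<Sum>s\<in>?S. \<phi> s (Poly_Mapping.lookup d s))"
    using assms by (simp add: fibrewise_additive_def lookup_add sum.distrib)
  also have "\<dots> = lift_sum \<phi> c + lift_sum \<phi> d"
    using lift_sum_superset[OF assms, of ?S c] lift_sum_superset[OF assms, of ?S d] by simp
  finally show ?thesis .
qed

lemma lift_sum_zero [simp]: "lift_sum \<phi> 0 = 0"
  by (simp add: lift_sum_def)

lemma lift_sum_uminus: "fibrewise_additive \<phi> \<Longrightarrow> lift_sum \<phi> (- c) = - lift_sum \<phi> c"
  using lift_sum_add[of \<phi> c "- c"] by (simp add: eq_neg_iff_add_eq_0 add.commute)

lemma lift_sum_diff: "fibrewise_additive \<phi> \<Longrightarrow> lift_sum \<phi> (c - d) = lift_sum \<phi> c - lift_sum \<phi> d"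
  using lift_sum_add[of \<phi> c "- d"] by (simp add: lift_sum_uminus)

lemma lift_sum_sum: "fibrewise_additive \<phi> \<Longrightarrow> lift_sum \<phi> (\<Sum>i\<in>I. h i) = (\<Sum>i\<in>I. lift_sum \<phi> (h i))"
  by (induction I rule: infinite_finite_induct) (simp_all add: lift_sum_add)

lemma lift_sum_single [simp]:
  assumes "fibrewise_additive \<phi>"
  shows "lift_sum \<phi> (Poly_Mapping.single s r) = \<phi> s r"
  using lift_sum_superset[OF assms, of "{s}" "Poly_Mapping.single s r"]
  by (simp add: fibrewise_additive_zero[OF assms])

lemma lift_sum_comp:
  "fibrewise_additive \<psi> \<Longrightarrow> lift_sum \<psi> (lift_sum \<phi> c) = lift_sum (\<lambda>s r. lift_sum \<psi> (\<phi> s r)) c"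
  by (simp add: lift_sum_def[of \<phi>] lift_sum_def[of "\<lambda>s r. lift_sum \<psi> (\<phi> s r)"] lift_sum_sum)

lemma lift_sum_diff_fun: "lift_sum (\<lambda>s r. \<phi> s r - \<psi> s r) c = lift_sum \<phi> c - lift_sum \<psi> c"
  by (simp add: lift_sum_def sum_subtractf)

lemma lift_sum_add_fun: "lift_sum (\<lambda>s r. \<phi> s r + \<psi> s r) c = lift_sum \<phi> c + lift_sum \<psi> c"
  by (simp add: lift_sum_def sum.distrib)

lemma lift_sum_id: "lift_sum Poly_Mapping.single c = c"
proof (rule poly_mapping_eqI)
  fix k
  have "Poly_Mapping.lookup (lift_sum Poly_Mapping.single c) k =
      (\<Sum>s\<in>Poly_Mapping.keys c. if s = k then Poly_Mapping.lookup c s else 0)"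
    by (simp add: lift_sum_def lookup_sum lookup_single when_def)
  then show "Poly_Mapping.lookup (lift_sum Poly_Mapping.single c) k = Poly_Mapping.lookup c k"
    by (simp add: sum.delta in_keys_iff)
qed

definition push :: "('a \<Rightarrow> 'b) \<Rightarrow> ('a \<Rightarrow>\<^sub>0 'r::ab_group_add) \<Rightarrow> ('b \<Rightarrow>\<^sub>0 'r)" where
  "push h = lift_sum (\<lambda>s r. Poly_Mapping.single (h s) r)"

definition bd :: "'a list \<Rightarrow> 'r::comm_ring_1 \<Rightarrow> ('a list \<Rightarrow>\<^sub>0 'r)" where
  "bd xs r = (\<Sum>i<length xs. Poly_Mapping.single (take i xs @ drop (Suc i) xs) ((- 1) ^ i * r))"

text \<open>The empty list is the simplex of dimension \<open>- 1\<close>, so that \<^term>\<open>bd\<close> is the boundary of the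
  augmented complex in all degrees.\<close>

fun prism :: "('a \<Rightarrow> 'b) \<Rightarrow> ('a \<Rightarrow> 'b) \<Rightarrow> 'a list \<Rightarrow> 'r::comm_ring_1 \<Rightarrow> ('b list \<Rightarrow>\<^sub>0 'r)" where
  "prism f g [] r = 0"
| "prism f g (x # xs) r = Poly_Mapping.single (f x # map g (x # xs)) r - push ((#) (f x)) (prism f g xs r)"

lemma fibrewise_additive_single: "fibrewise_additive (\<lambda>s r. Poly_Mapping.single (h s) r)"
  by (simp add: fibrewise_additive_def single_add)

lemma fibrewise_additive_bd: "fibrewise_additive bd"
  by (simp add: fibrewise_additive_def bd_def distrib_left single_add sum.distrib)

lemma push_add: "push h (c + d) = push h c + push h d"
  unfolding push_def by (rule lift_sum_add[OF fibrewise_additive_single])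

lemma push_diff: "push h (c - d) = push h c - push h d"
  unfolding push_def by (rule lift_sum_diff[OF fibrewise_additive_single])

lemma push_single [simp]: "push h (Poly_Mapping.single s r) = Poly_Mapping.single (h s) r"
  unfolding push_def by (rule lift_sum_single[OF fibrewise_additive_single])

lemma push_sum: "push h (\<Sum>i\<in>I. c i) = (\<Sum>i\<in>I. push h (c i))"
  unfolding push_def by (rule lift_sum_sum[OF fibrewise_additive_single])

lemma push_id: "push id c = c"
  using lift_sum_id[of c] by (simp add: push_def)

lemma fibrewise_additive_prism: "fibrewise_additive (prism f g :: 'a list \<Rightarrow> 'r::comm_ring_1 \<Rightarrow> _)"
proof -
  have "prism f g xs (a + b) = prism f g xs a + prism f g xs b" for xs and a b :: 'r
    by (induction xs) (simp_all add: single_add push_add)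
  then show ?thesis by (simp add: fibrewise_additive_def)
qed

lemma bd_Cons: "bd (x # xs) r = Poly_Mapping.single xs r - push ((#) x) (bd xs r)"
  by (simp add: bd_def sum.lessThan_Suc_shift push_sum single_uminus sum_negf del: sum.lessThan_Suc)

text \<open>The cone formula: the boundary of the cone over c is c minus the cone over the boundary
  of c. Owing to the empty simplex it holds in all degrees.\<close>

lemma lift_bd_Cons: "lift_sum bd (push ((#) v) c) = c - push ((#) v) (lift_sum bd c)"
proof -
  have "lift_sum bd (push ((#) v) c) = lift_sum (\<lambda>s r. Poly_Mapping.single s r - push ((#) v) (bd s r)) c"
    unfolding push_def by (subst lift_sum_comp[OF fibrewise_additive_bd])
      (simp add: lift_sum_single[OF fibrewise_additive_bd] bd_Cons flip: push_def)
  also have "\<dots> = c - lift_sum (\<lambda>s r. push ((#) v) (bd s r)) c"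
    by (simp add: lift_sum_diff_fun lift_sum_id)
  also have "lift_sum (\<lambda>s r. push ((#) v) (bd s r)) c = push ((#) v) (lift_sum bd c)"
    unfolding push_def by (rule lift_sum_comp[OF fibrewise_additive_single, symmetric])
  finally show ?thesis .
qed

lemma push_bd: "push (map g) (bd xs r) = bd (map g xs) r"
  by (simp add: bd_def push_sum take_map drop_map)

lemma lift_bd_push: "lift_sum bd (push (map g) c) = push (map g) (lift_sum bd c)"
  unfolding push_def lift_sum_comp[OF fibrewise_additive_bd] lift_sum_comp[OF fibrewise_additive_single]
  by (simp add: lift_sum_single[OF fibrewise_additive_bd] push_bd flip: push_def)

lemma lift_prism_Cons:
  "lift_sum (prism f g) (push ((#) x) c) =
    push ((#) (f x)) (push ((#) (g x)) (push (map g) c)) - push ((#) (f x)) (lift_sum (prism f g) c)"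
proof -
  have "lift_sum (prism f g) (push ((#) x) c) = lift_sum (\<lambda>s r. prism f g (x # s) r) c"
    unfolding push_def by (simp add: lift_sum_comp fibrewise_additive_prism lift_sum_single)
  also have "\<dots> = push (\<lambda>s. f x # g x # map g s) c - lift_sum (\<lambda>s r. push ((#) (f x)) (prism f g s r)) c"
    by (simp add: lift_sum_diff_fun push_def)
  also have "lift_sum (\<lambda>s r. push ((#) (f x)) (prism f g s r)) c = push ((#) (f x)) (lift_sum (prism f g) c)"
    unfolding push_def by (rule lift_sum_comp[OF fibrewise_additive_single, symmetric])
  also have "push (\<lambda>s. f x # g x # map g s) c = push ((#) (f x)) (push ((#) (g x)) (push (map g) c))"
    unfolding push_def by (simp add: lift_sum_comp fibrewise_additive_single lift_sum_single)
  finally show ?thesis .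
qed

text \<open>Unwinding the recursion, \<open>prism f g\<close> of [x0, ..., xk] is the alternating
  sum of the simplices [f x0, ..., f xi, g xi, ..., g xk], the classical prism operator. In
  recursive form both terms are cones with apex \<open>f x\<close>, so the cone formula yields the
  identity by induction.\<close>

lemma prism_homotopy_simplex:
  "lift_sum bd (prism f g xs r) + lift_sum (prism f g) (bd xs r) =
    Poly_Mapping.single (map g xs) r - Poly_Mapping.single (map f xs) r"
proof (induction xs)
  case Nil
  then show ?case by (simp add: bd_def)
next
  case (Cons x xs)
  let ?c = "push ((#) (f x))" and ?d = "push ((#) (g x))"
  have 1: "lift_sum bd (prism f g (x # xs) r) =
      Poly_Mapping.single (map g (x # xs)) r - ?c (Poly_Mapping.single (map g xs) r - ?d (bd (map g xs) r))
      - (prism f g xs r - ?c (lift_sum bd (prism f g xs r)))"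
    by (simp add: lift_sum_diff fibrewise_additive_bd lift_sum_single lift_bd_Cons bd_Cons)
  have 2: "lift_sum (prism f g) (bd (x # xs) r) =
      prism f g xs r - (?c (?d (bd (map g xs) r)) - ?c (lift_sum (prism f g) (bd xs r)))"
    unfolding bd_Cons by (simp add: lift_sum_diff fibrewise_additive_prism lift_sum_single lift_prism_Cons push_bd)
  have "?c (lift_sum bd (prism f g xs r)) + ?c (lift_sum (prism f g) (bd xs r)) =
      ?c (Poly_Mapping.single (map g xs) r - Poly_Mapping.single (map f xs) r)"
    unfolding Cons[symmetric] push_add ..
  then show ?case unfolding 1 2 push_diff by (simp add: algebra_simps)
qed

lemma prism_homotopy:
  "lift_sum bd (lift_sum (prism f g) c) + lift_sum (prism f g) (lift_sum bd c) = push (map g) c - push (map f) c"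
  unfolding push_def
  by (simp add: lift_sum_comp fibrewise_additive_bd fibrewise_additive_prism prism_homotopy_simplex
      flip: lift_sum_diff_fun lift_sum_add_fun)

section \<open>Chains, cycles and boundaries of a cover\<close>

lemma chains_cover_sset: "c \<in> chains k (cover_sset K) \<longleftrightarrow>
    (\<forall>xs\<in>Poly_Mapping.keys c. length xs = Suc k \<and> (\<exists>B\<in>K. set xs \<subseteq> B))"
  by (auto simp: chains_def simplices_cover_sset)

lemma sset_boundary_eq:
  assumes "c \<in> chains k (cover_sset K)"
  shows "sset_boundary k (cover_sset K) c = lift_sum bd c"
  unfolding sset_boundary_def lift_sum_def
proof (rule sum.cong)
  fix xs assume "xs \<in> Poly_Mapping.keys c"
  then have "length xs = Suc k" using assms by (simp add: chains_cover_sset)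
  then show "(\<Sum>i\<le>k. Poly_Mapping.single (face (cover_sset K) k i xs) ((- 1) ^ i * Poly_Mapping.lookup c xs))
      = bd xs (Poly_Mapping.lookup c xs)"
    by (simp add: bd_def face_cover_sset lessThan_Suc_atMost)
qed simp

text \<open>The boundary of a vertex is the empty simplex, so in degree 0 the coefficient of
  \<open>[]\<close> in the boundary is the augmentation. This makes the cycle condition uniform in
  k.\<close>

lemma reduced_cycles_cover_sset:
  "reduced_cycles k (cover_sset K) = {c \<in> chains k (cover_sset K). lift_sum bd c = 0}"
proof -
  have "augmentation c = 0 \<longleftrightarrow> lift_sum bd c = 0" if c: "c \<in> chains 0 (cover_sset K)" for c :: "'a list \<Rightarrow>\<^sub>0 'b"
  proof -
    have "lift_sum bd c = (\<Sum>xs\<in>Poly_Mapping.keys c. Poly_Mapping.single [] (Poly_Mapping.lookup c xs))"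
      unfolding lift_sum_def
    proof (rule sum.cong)
      fix xs assume "xs \<in> Poly_Mapping.keys c"
      then have "length xs = Suc 0" using c by (simp add: chains_cover_sset)
      then show "bd xs (Poly_Mapping.lookup c xs) = Poly_Mapping.single [] (Poly_Mapping.lookup c xs)"
        by (auto simp: length_Suc_conv bd_def)
    qed simp
    also have "\<dots> = Poly_Mapping.single [] (augmentation c)"
      unfolding augmentation_def by (induction rule: infinite_finite_induct) (auto simp: single_add)
    finally show ?thesis by (metis lookup_single_eq single_zero lookup_zero)
  qed
  then show ?thesis unfolding reduced_cycles_def by (auto simp: sset_boundary_eq)
qed

lemma keys_lift_sum:
  assumes "xs \<in> Poly_Mapping.keys (lift_sum \<phi> c)"
  obtains s where "s \<in> Poly_Mapping.keys c" "xs \<in> Poly_Mapping.keys (\<phi> s (Poly_Mapping.lookup c s))"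
  using assms Poly_Mapping.keys_sum[of "\<lambda>s. \<phi> s (Poly_Mapping.lookup c s)" "Poly_Mapping.keys c"]
  unfolding lift_sum_def by blast

lemma keys_push:
  assumes "xs \<in> Poly_Mapping.keys (push h c)"
  obtains s where "s \<in> Poly_Mapping.keys c" "xs = h s"
  using assms unfolding push_def by (rule keys_lift_sum) (auto split: if_splits)

lemma keys_prism:
  "ys \<in> Poly_Mapping.keys (prism f g xs r) \<Longrightarrow>
    length ys = Suc (length xs) \<and> set ys \<subseteq> f ` set xs \<union> g ` set xs"
proof (induction xs arbitrary: ys)
  case (Cons x xs)
  have "ys \<in> Poly_Mapping.keys (Poly_Mapping.single (f x # map g (x # xs)) r) \<union>
      Poly_Mapping.keys (push ((#) (f x)) (prism f g xs r))"
    using Cons.prems keys_diff by fastforce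
  then show ?case
  proof
    assume "ys \<in> Poly_Mapping.keys (push ((#) (f x)) (prism f g xs r))"
    then obtain zs where "zs \<in> Poly_Mapping.keys (prism f g xs r)" "ys = f x # zs" by (rule keys_push)
    then show ?thesis using Cons.IH[of zs] by auto
  qed (auto split: if_splits)
qed simp

lemma chains_prism:
  assumes "c \<in> chains k (cover_sset K)" "\<And>B. B \<in> K \<Longrightarrow> \<exists>B'\<in>K'. f ` B \<union> g ` B \<subseteq> B'"
  shows "lift_sum (prism f g) c \<in> chains (Suc k) (cover_sset K')"
  unfolding chains_cover_sset
proof
  fix ys assume "ys \<in> Poly_Mapping.keys (lift_sum (prism f g) c)"
  then obtain xs where xs: "xs \<in> Poly_Mapping.keys c"
    "ys \<in> Poly_Mapping.keys (prism f g xs (Poly_Mapping.lookup c xs))" by (rule keys_lift_sum)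
  then obtain B where B: "B \<in> K" "set xs \<subseteq> B" "length xs = Suc k" using assms(1) by (auto simp: chains_cover_sset)
  obtain B' where "B' \<in> K'" "f ` B \<union> g ` B \<subseteq> B'" using assms(2) B(1) by blast
  then show "length ys = Suc (Suc k) \<and> (\<exists>B\<in>K'. set ys \<subseteq> B)"
    using keys_prism[OF xs(2)] B by (intro conjI bexI[of _ B']) (simp, blast)
qed

lemma boundaries_cover_sset: "boundaries k (cover_sset K) = lift_sum bd ` chains (Suc k) (cover_sset K)"
  unfolding boundaries_def by (rule image_cong) (auto simp: sset_boundary_eq)

lemma zero_chains: "0 \<in> chains k Y"
  by (simp add: chains_def)

lemma chains_add: "c \<in> chains k Y \<Longrightarrow> d \<in> chains k Y \<Longrightarrow> c + d \<in> chains k Y"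
  using Poly_Mapping.keys_add[of c d] unfolding chains_def by blast

lemma chains_uminus: "c \<in> chains k Y \<Longrightarrow> - c \<in> chains k Y"
  unfolding chains_def by simp

lemma boundaries_add:
  "a \<in> boundaries k (cover_sset K) \<Longrightarrow> b \<in> boundaries k (cover_sset K) \<Longrightarrow> a + b \<in> boundaries k (cover_sset K)"
  unfolding boundaries_cover_sset by (auto simp: chains_add simp flip: lift_sum_add[OF fibrewise_additive_bd])

lemma boundaries_uminus:
  "a \<in> boundaries k (cover_sset K) \<Longrightarrow> - a \<in> boundaries k (cover_sset K)"
  unfolding boundaries_cover_sset by (auto simp: chains_uminus simp flip: lift_sum_uminus[OF fibrewise_additive_bd])

lemma zero_boundaries: "0 \<in> boundaries k (cover_sset K)"
  unfolding boundaries_cover_sset by (rule image_eqI[of _ _ 0]) (simp_all add: zero_chains)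

text \<open>On a cycle, the images under f j and f (j + 1) differ by the boundary of a prism;
  telescoping shows that c is homologous to its image under f N. If N is large enough for the
  finitely many vertices of c, that image is a multiple of a simplex with all entries y, and it is
  the boundary of its cone with apex y.\<close>

lemma cycle_is_boundary:
  fixes f :: "nat \<Rightarrow> 'a \<Rightarrow> 'a" and c :: "'a list \<Rightarrow>\<^sub>0 'r::comm_ring_1"
  assumes f0: "f 0 = id" and ev: "\<And>x. \<exists>N. \<forall>j\<ge>N. f j x = y"
    and con: "\<And>B j. B \<in> K \<Longrightarrow> \<exists>B'\<in>K'. f j ` B \<union> f (Suc j) ` B \<subseteq> B'"
    and c: "c \<in> reduced_cycles k (cover_sset K)"
  shows "c \<in> boundaries k (cover_sset K')"
proof -
  have cc: "c \<in> chains k (cover_sset K)" and c0: "lift_sum bd c = 0"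
    using c by (auto simp: reduced_cycles_cover_sset)
  have step: "push (map (f (Suc j))) c - push (map (f j)) c \<in> boundaries k (cover_sset K')" for j
    using prism_homotopy[of "f j" "f (Suc j)" c] chains_prism[OF cc con, of j] c0
    unfolding boundaries_cover_sset by (intro image_eqI[of _ _ "lift_sum (prism (f j) (f (Suc j))) c"]) simp_all
  have all: "push (map (f j)) c - c \<in> boundaries k (cover_sset K')" for j
  proof (induction j)
    case 0
    then show ?case using push_id[of c] by (simp add: f0 zero_boundaries id_def)
  next
    case (Suc j)
    then show ?case using boundaries_add[OF step[of j] Suc] by simp
  qed
  obtain M where M: "\<And>x j. M x \<le> j \<Longrightarrow> f j x = y" using ev by metis
  let ?S = "\<Union>(set ` Poly_Mapping.keys c)"
  define N where "N = Max (insert 0 (M ` ?S))"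
  have "M x \<le> N" if "x \<in> ?S" for x unfolding N_def by (rule Max_ge) (use that in auto)
  then have fN: "f N x = y" if "x \<in> ?S" for x using M that by blast
  let ?c = "push (map (f N)) c"
  \<comment> \<open>The cone needs a member of K' that contains y. The member containing the image
    of the simplex under f N does, because a simplex has at least one vertex and f N sends it to
    y.\<close>
  have "push ((#) y) ?c \<in> chains (Suc k) (cover_sset K')"
    unfolding chains_cover_sset
  proof
    fix ys assume "ys \<in> Poly_Mapping.keys (push ((#) y) ?c)"
    then obtain zs where zs: "zs \<in> Poly_Mapping.keys ?c" "ys = y # zs" by (rule keys_push)
    from zs(1) obtain xs where xs: "xs \<in> Poly_Mapping.keys c" "zs = map (f N) xs" by (rule keys_push)
    obtain B where B: "B \<in> K" "set xs \<subseteq> B" "length xs = Suc k" using cc xs(1) by (auto simp: chains_cover_sset)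
    obtain B' where B': "B' \<in> K'" "f N ` B \<union> f (Suc N) ` B \<subseteq> B'" using con B(1) by blast
    obtain x where "x \<in> set xs" using B(3) by (cases xs) auto
    then have "y \<in> B'" using fN[of x] xs(1) B B' by blast
    then show "length ys = Suc (Suc k) \<and> (\<exists>B\<in>K'. set ys \<subseteq> B)"
      using B B' zs xs by (intro conjI bexI[of _ B']) auto
  qed
  moreover have "lift_sum bd (push ((#) y) ?c) = ?c"
    unfolding lift_bd_Cons lift_bd_push c0 by (simp add: push_def)
  ultimately have "?c \<in> boundaries k (cover_sset K')"
    unfolding boundaries_cover_sset by (metis imageI)
  then show ?thesis using boundaries_add[OF _ boundaries_uminus[OF all[of N]]] by fastforce
qed

lemma homology_incl_class:
  assumes C: "C \<in> carrier (reduced_homology k (cover_sset K) :: ('a list \<Rightarrow>\<^sub>0 'r::comm_ring_1) set monoid)"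
  obtains c where "c \<in> reduced_cycles k (cover_sset K)"
    "homology_incl k (cover_sset K') C = {b' + (b + c) | b' b. b' \<in> boundaries k (cover_sset K') \<and> b \<in> boundaries k (cover_sset K)}"
proof -
  obtain c where "c \<in> reduced_cycles k (cover_sset K)" "C = (\<lambda>b. b + c) ` boundaries k (cover_sset K)"
    using C by (auto simp: reduced_homology_def FactGroup_def RCOSETS_def r_coset_def cycle_group_def)
  moreover from this(2) have "homology_incl k (cover_sset K') C = {b' + (b + c) | b' b. b' \<in> boundaries k (cover_sset K') \<and> b \<in> boundaries k (cover_sset K)}"
    by (auto simp: homology_incl_def set_mult_def cycle_group_def)
  ultimately show ?thesis using that by blast
qed

lemma homology_trivial:
  fixes f :: "nat \<Rightarrow> 'a \<Rightarrow> 'a"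
  assumes f0: "f 0 = id" and ev: "\<And>x. \<exists>N. \<forall>j\<ge>N. f j x = y"
    and con: "\<And>B j. B \<in> K \<Longrightarrow> \<exists>B'\<in>K'. f j ` B \<union> f (Suc j) ` B \<subseteq> B'"
    and C: "C \<in> carrier (reduced_homology k (cover_sset K) :: ('a list \<Rightarrow>\<^sub>0 'r::comm_ring_1) set monoid)"
  shows "homology_incl k (cover_sset K') C = \<one>\<^bsub>reduced_homology k (cover_sset K')\<^esub>"
proof -
  obtain c where c: "c \<in> reduced_cycles k (cover_sset K)"
    and H: "homology_incl k (cover_sset K') C = {b' + (b + c) | b' b. b' \<in> boundaries k (cover_sset K') \<and> b \<in> boundaries k (cover_sset K)}"
    by (rule homology_incl_class[OF C])
  have cb: "c \<in> boundaries k (cover_sset K')" by (rule cycle_is_boundary[OF f0 ev con c])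
  have sub: "boundaries k (cover_sset K) \<subseteq> (boundaries k (cover_sset K') :: ('a list \<Rightarrow>\<^sub>0 'r) set)"
  proof -
    have "chains (Suc k) (cover_sset K) \<subseteq> (chains (Suc k) (cover_sset K') :: ('a list \<Rightarrow>\<^sub>0 'r) set)"
    proof
      fix d :: "'a list \<Rightarrow>\<^sub>0 'r" assume d: "d \<in> chains (Suc k) (cover_sset K)"
      show "d \<in> chains (Suc k) (cover_sset K')"
        unfolding chains_cover_sset
      proof
        fix xs assume "xs \<in> Poly_Mapping.keys d"
        then obtain B where B: "B \<in> K" "set xs \<subseteq> B" "length xs = Suc (Suc k)" using d by (auto simp: chains_cover_sset)
        obtain B' where "B' \<in> K'" "B \<subseteq> B'" using con[OF B(1), of 0] f0 by auto
        then show "length xs = Suc (Suc k) \<and> (\<exists>B\<in>K'. set xs \<subseteq> B)" using B by blast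
      qed
    qed
    then show ?thesis unfolding boundaries_cover_sset by (rule image_mono)
  qed
  have "homology_incl k (cover_sset K') C = boundaries k (cover_sset K')"
    unfolding H
  proof (intro equalityI subsetI)
    fix x :: "'a list \<Rightarrow>\<^sub>0 'r" assume "x \<in> {b' + (b + c) | b' b. b' \<in> boundaries k (cover_sset K') \<and> b \<in> boundaries k (cover_sset K)}"
    then show "x \<in> boundaries k (cover_sset K')" using cb sub by (auto intro!: boundaries_add)
  next
    fix x :: "'a list \<Rightarrow>\<^sub>0 'r" assume "x \<in> boundaries k (cover_sset K')"
    then have "x + - c \<in> boundaries k (cover_sset K')" using boundaries_add boundaries_uminus cb by blast
    then show "x \<in> {b' + (b + c) | b' b. b' \<in> boundaries k (cover_sset K') \<and> b \<in> boundaries k (cover_sset K)}"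
      using zero_boundaries[of k K] by (intro CollectI exI[of _ "x + - c"] exI[of _ 0]) simp
  qed
  then show ?thesis by (simp add: reduced_homology_def FactGroup_def)
qed

text \<open>Summing the coefficients of the vertices that satisfy \<phi> gives a functional that
  kills boundaries, since \<phi> agrees at both ends of every edge of the larger stage. It does not
  kill the cycle z - y, because 0 \<noteq> 1 in R.\<close>

lemma homology_0_nontrivial:
  fixes \<phi> :: "'a \<Rightarrow> bool"
  assumes \<phi>: "\<And>B u v. B \<in> K' \<Longrightarrow> u \<in> B \<Longrightarrow> v \<in> B \<Longrightarrow> \<phi> u = \<phi> v"
    and y: "y \<in> \<Union>K" and z: "z \<in> \<Union>K" and ne: "\<phi> y \<noteq> \<phi> z"
  shows "\<exists>C\<in>carrier (reduced_homology 0 (cover_sset K) :: ('a list \<Rightarrow>\<^sub>0 'r::comm_ring_1) set monoid).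
    homology_incl 0 (cover_sset K') C \<noteq> \<one>\<^bsub>reduced_homology 0 (cover_sset K')\<^esub>"
proof -
  let ?c = "Poly_Mapping.single [z] 1 - Poly_Mapping.single [y] 1 :: 'a list \<Rightarrow>\<^sub>0 'r"
  let ?C = "(\<lambda>b. b + ?c) ` boundaries 0 (cover_sset K)"
  have k: "Poly_Mapping.keys ?c \<subseteq> {[z], [y]}"
    using keys_diff[of "Poly_Mapping.single [z] 1" "Poly_Mapping.single [y] (1::'r)"] by (auto split: if_splits)
  have "?c \<in> chains 0 (cover_sset K)"
    unfolding chains_cover_sset
  proof
    fix xs assume "xs \<in> Poly_Mapping.keys ?c"
    then have "xs = [z] \<or> xs = [y]" using k by blast
    then show "length xs = Suc 0 \<and> (\<exists>B\<in>K. set xs \<subseteq> B)" using y z by auto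
  qed
  moreover have "lift_sum bd ?c = 0"
    by (simp add: lift_sum_diff[OF fibrewise_additive_bd] lift_sum_single[OF fibrewise_additive_bd] bd_def)
  ultimately have "?c \<in> reduced_cycles 0 (cover_sset K)" by (simp add: reduced_cycles_cover_sset)
  then have Cin: "?C \<in> carrier (reduced_homology 0 (cover_sset K))"
    by (auto simp: reduced_homology_def FactGroup_def RCOSETS_def r_coset_def cycle_group_def)
  have "homology_incl 0 (cover_sset K') ?C \<noteq> \<one>\<^bsub>reduced_homology 0 (cover_sset K')\<^esub>"
  proof
    assume "homology_incl 0 (cover_sset K') ?C = \<one>\<^bsub>reduced_homology 0 (cover_sset K')\<^esub>"
    then have "homology_incl 0 (cover_sset K') ?C = boundaries 0 (cover_sset K')"
      by (simp add: reduced_homology_def FactGroup_def)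
    moreover have "?c \<in> ?C" using zero_boundaries[of 0 K] by (intro image_eqI[of _ _ 0]) simp_all
    then have "0 + ?c \<in> homology_incl 0 (cover_sset K') ?C"
      unfolding homology_incl_def set_mult_def cycle_group_def
      by (auto intro!: bexI[of _ 0] simp: zero_boundaries)
    ultimately have "?c \<in> boundaries 0 (cover_sset K')" by simp
    then obtain e where e: "e \<in> chains 1 (cover_sset K')" "?c = lift_sum bd e"
      by (auto simp: boundaries_cover_sset)
    define \<psi> where "\<psi> = (\<lambda>xs (r::'r). if \<phi> (hd xs) then r else 0)"
    have a: "fibrewise_additive \<psi>" by (simp add: fibrewise_additive_def \<psi>_def)
    have "lift_sum \<psi> (lift_sum bd e) = (\<Sum>s\<in>Poly_Mapping.keys e. lift_sum \<psi> (bd s (Poly_Mapping.lookup e s)))"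
      unfolding lift_sum_def[of bd e] by (rule lift_sum_sum[OF a])
    also have "\<dots> = 0"
    proof (rule sum.neutral, rule ballI)
      fix xs assume "xs \<in> Poly_Mapping.keys e"
      then obtain u v B where xs: "xs = [u, v]" "B \<in> K'" "u \<in> B" "v \<in> B"
        using e(1) by (auto simp: chains_cover_sset length_Suc_conv)
      then show "lift_sum \<psi> (bd xs (Poly_Mapping.lookup e xs)) = 0"
        using \<phi>[OF xs(2-4)]
        by (simp add: bd_Cons lift_sum_diff[OF a] lift_sum_single[OF a] push_diff bd_def[of "[]"])
           (simp add: \<psi>_def push_def)
    qed
    finally have "lift_sum \<psi> ?c = 0" using e(2) by simp
    then have "\<psi> [z] 1 = \<psi> [y] 1" by (simp add: lift_sum_diff[OF a] lift_sum_single[OF a])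
    then show False using ne by (auto simp: \<psi>_def split: if_splits)
  qed
  then show ?thesis using Cin by blast
qed

section \<open>Reduced words for the Bass-Serre tree\<close>

locale baumslag_solitar =
  fixes m n :: int
  assumes m0: "m \<noteq> 0" and n0: "n \<noteq> 0"
begin

text \<open>With e = 1 if b holds and e = - 1 otherwise,
  \<open>a^(modulus b) t^e = t^e a^(modulus (\<not> b))\<close> in the group. Hence the neighbours
  \<open>a^r t^e \<langle>a\<rangle>\<close> of the root correspond to the residues r of
  \<open>modulus b\<close>.\<close>

definition modulus :: "bool \<Rightarrow> int" where
  "modulus b = (if b then n else m)"

lemma modulus_nonzero [simp]: "modulus b \<noteq> 0"
  using m0 n0 by (simp add: modulus_def)

text \<open>The list \<open>[(r1, b1), \<dots>, (rk, bk)]\<close> encodes the vertex \<open>a^r1 t^e1 \<dots> a^rk t^ek \<langle>a\<rangle>\<close> of the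
  Bass-Serre tree, where \<open>ei\<close> is \<open>1\<close> if \<open>bi\<close> holds and \<open>- 1\<close> otherwise; \<open>butlast\<close> is the step
  towards the root.  For a negative modulus the residues \<open>ri\<close> are nonpositive.\<close>

fun reduced :: "(int \<times> bool) list \<Rightarrow> bool" where
  "reduced [] \<longleftrightarrow> True"
| "reduced [(r, b)] \<longleftrightarrow> r mod modulus b = r"
| "reduced ((r, b) # (r', b') # l) \<longleftrightarrow>
     r mod modulus b = r \<and> (b' = b \<or> r' \<noteq> 0) \<and> reduced ((r', b') # l)"

lemma reduced_Cons: "reduced ((r, b) # l) \<longleftrightarrow>
    r mod modulus b = r \<and> (l = [] \<or> snd (hd l) = b \<or> fst (hd l) \<noteq> 0) \<and> reduced l"
  by (cases l) auto

lemma reduced_append_Cons: "reduced (l @ (r, b) # l') \<longleftrightarrow>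
    reduced (l @ [(r, b)]) \<and> reduced ((r, b) # l')"
  by (induction l rule: reduced.induct) (auto simp: reduced_Cons)

lemma reduced_butlast: "reduced l \<Longrightarrow> reduced (butlast l)"
  by (induction l rule: reduced.induct) (auto simp: reduced_Cons)

text \<open>Left multiplication by \<open>a^k\<close> and by \<open>t\<close> or its inverse.  The first uses
  \<open>a^(q n) t = t a^(q m)\<close> to push multiples of the modulus to the right.\<close>

fun shift :: "int \<Rightarrow> (int \<times> bool) list \<Rightarrow> (int \<times> bool) list" where
  "shift k [] = []"
| "shift k ((r, b) # l) =
     ((k + r) mod modulus b, b) # shift ((k + r) div modulus b * modulus (\<not> b)) l"

definition tmove :: "bool \<Rightarrow> (int \<times> bool) list \<Rightarrow> (int \<times> bool) list" where
  "tmove b l = (if l \<noteq> [] \<and> hd l = (0, \<not> b) then tl l else (0, b) # l)"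

text \<open>The carry into the next entry is a multiple of \<open>modulus (\<not> b)\<close>. If the
  next letter is the opposite one, this is a multiple of that letter's own modulus, so its nonzero
  residue is unchanged and no backtracking is created.\<close>

lemma reduced_shift: "reduced l \<Longrightarrow> reduced (shift k l)"
proof (induction l arbitrary: k rule: reduced.induct)
  case (3 r b r' b' l)
  define q where "q = (k + r) div modulus b"
  define t where "t = shift (q * modulus (\<not> b)) ((r', b') # l)"
  have l: "reduced ((r', b') # l)" "b' = b \<or> r' \<noteq> 0" using 3(2) by auto
  have "reduced t" unfolding t_def q_def by (rule 3(1)[OF l(1)])
  moreover have "fst (hd t) = r'" if "b' \<noteq> b"
  proof -
    have "b' = (\<not> b)" using that by blast
    moreover have "r' mod modulus b' = r'" using l(1) by (simp add: reduced_Cons)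
    ultimately show ?thesis by (simp add: t_def)
  qed
  moreover have "snd (hd t) = b'" by (simp add: t_def)
  ultimately have "reduced (((k + r) mod modulus b, b) # t)" using l(2) unfolding reduced_Cons by auto
  then show ?case by (simp add: t_def q_def)
qed auto

lemma shift_shift: "shift k (shift j l) = shift (k + j) l"
proof (induction l arbitrary: k j)
  case (Cons p l)
  obtain r b where p: "p = (r, b)" by force
  \<comment> \<open>The carries of the two successive shifts add up to the carry of the combined
    shift.\<close>
  have q: "(k + (j + r) mod modulus b) div modulus b + (j + r) div modulus b = (k + j + r) div modulus b"
    using div_mult_self1[of "modulus b" "k + (j + r) mod modulus b" "(j + r) div modulus b"]
      mult_div_mod_eq[of "modulus b" "j + r"] by (simp add: algebra_simps)
  show ?case
    using q by (simp add: p Cons mod_simps add.assoc flip: distrib_right)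
qed simp

lemma residue_div: "r mod modulus b = r \<Longrightarrow> r div modulus b = 0"
  using mult_div_mod_eq[of "modulus b" r] by simp

lemma shift_0: "reduced l \<Longrightarrow> shift 0 l = l"
  by (induction l rule: reduced.induct) (auto simp: residue_div)

lemma reduced_tmove: "reduced l \<Longrightarrow> reduced (tmove b l)"
  by (cases l) (auto simp: tmove_def reduced_Cons)

lemma tmove_tmove: "reduced l \<Longrightarrow> tmove b (tmove (\<not> b) l) = l"
  by (cases l) (auto simp: tmove_def reduced_Cons)

lemma tmove_Cons: "reduced ((0, b) # l) \<Longrightarrow> tmove b l = (0, b) # l"
  by (auto simp: tmove_def reduced_Cons)

text \<open>The defining relation for the operators: with b true it says that
  \<open>t a^m t^-1\<close> acts as \<open>a^n\<close>. The cases are whether the inner move cancels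
  the first letter or adds a letter, which the outer move then removes.\<close>

lemma shift_modulus:
  assumes "reduced l"
  shows "tmove b (shift (modulus (\<not> b)) (tmove (\<not> b) l)) = shift (modulus b) l"
proof (cases "l \<noteq> [] \<and> hd l = (0, b)")
  case True
  then obtain l' where l: "l = (0, b) # l'" by (cases l) auto
  have s: "shift (modulus b) l = (0, b) # shift (modulus (\<not> b)) l'" by (simp add: l)
  have "reduced (shift (modulus b) l)" by (rule reduced_shift[OF assms])
  then have "tmove b (shift (modulus (\<not> b)) l') = (0, b) # shift (modulus (\<not> b)) l'"
    unfolding s by (rule tmove_Cons)
  then show ?thesis by (simp add: l s tmove_def)
next
  case False
  then have "tmove (\<not> b) l = (0, \<not> b) # l" by (auto simp: tmove_def)
  then show ?thesis by (simp add: tmove_def)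
qed

fun move :: "bs_gen \<times> bool \<Rightarrow> (int \<times> bool) list \<Rightarrow> (int \<times> bool) list" where
  "move (gen_a, b) = shift (if b then 1 else - 1)"
| "move (gen_t, b) = tmove b"

definition moves :: "bs_gen word \<Rightarrow> (int \<times> bool) list \<Rightarrow> (int \<times> bool) list" where
  "moves w l = foldr move w l"

lemma moves_Nil [simp]: "moves [] l = l"
  and moves_Cons [simp]: "moves (x # w) l = move x (moves w l)"
  and moves_append [simp]: "moves (u @ w) l = moves u (moves w l)"
  by (simp_all add: moves_def)

lemma reduced_move: "reduced l \<Longrightarrow> reduced (move x l)"
  by (cases x rule: move.cases) (auto simp: reduced_shift reduced_tmove)

lemma reduced_moves: "reduced l \<Longrightarrow> reduced (moves w l)"
  by (induction w) (auto simp: reduced_move)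

lemma move_cancel: "reduced l \<Longrightarrow> move (x, b) (move (x, \<not> b) l) = l"
  by (cases x) (auto simp: shift_shift shift_0 tmove_tmove)

lemma moves_word_pow_a: "reduced l \<Longrightarrow> moves (word_pow gen_a k) l = shift k l"
proof -
  assume l: "reduced l"
  have "moves (replicate j (gen_a, b)) l = shift (int j * (if b then 1 else - 1)) l" for j b
    using l by (induction j) (auto simp: shift_0 shift_shift algebra_simps)
  then show ?thesis by (simp add: word_pow_def)
qed

text \<open>The operators respect the presentation, so the group itself acts on reduced
  lists.\<close>

lemma moves_pres_eq: "pres_eq (bs_relations m n) u v \<Longrightarrow> reduced l \<Longrightarrow> moves u l = moves v l"
proof (induction arbitrary: l rule: pres_eq.induct)
  case (cancel u x b v)
  then show ?case using move_cancel[OF reduced_moves] by simp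
next
  case (relation r s u v)
  have red: "reduced (moves v l)" using relation(2) by (rule reduced_moves)
  have "moves r (moves v l) = moves s (moves v l)"
    using relation(1) shift_modulus[OF red, of True] red reduced_tmove[OF red, of False]
    by (simp add: bs_relations_def moves_word_pow_a)
       (simp add: word_pow_def moves_word_pow_a[unfolded word_pow_def] modulus_def)
  then show ?case by simp
qed auto

section \<open>Height and distance in the tree\<close>

definition height :: "(int \<times> bool) list \<Rightarrow> real" where
  "height l = (\<Sum>(r, b)\<leftarrow>l. if b then 1 else - 1)"

lemma height_simps [simp]:
  "height [] = 0" "height ((r, b) # l) = (if b then 1 else - 1) + height l"
  "height (l @ l') = height l + height l'"
  "height (replicate k (r, b)) = real k * (if b then 1 else - 1)"
  by (simp_all add: height_def sum_list_replicate)

lemma height_shift: "height (shift k l) = height l"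
  by (induction k l rule: shift.induct) simp_all

lemma height_tmove: "height (tmove b l) = (if b then 1 else - 1) + height l"
  by (cases l) (auto simp: tmove_def)

lemma height_moves: "height (moves w l) = t_exponent w + height l"
proof (induction w)
  case (Cons x w)
  then show ?case
    by (cases x rule: move.cases) (auto simp: height_shift height_tmove t_exponent_def)
qed (simp add: t_exponent_def)

text \<open>Equality is included so that, on reduced lists, \<open>adjacent ^^ r\<close> means
  distance at most r.\<close>

definition adjacent :: "((int \<times> bool) list \<times> (int \<times> bool) list) set" where
  "adjacent = {(u, v). reduced u \<and> reduced v \<and> (u = v \<or> u = butlast v \<or> v = butlast u)}"

lemma shift_butlast: "shift k (butlast l) = butlast (shift k l)"
proof (induction k l rule: shift.induct)
  case (2 k r b l)
  then show ?case by (cases l) auto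
qed simp

text \<open>An edge can be flipped relative to the root: for l = [(0, \<not> b)] the move sends l to
  the root and the root to its child, which is the second alternative. The third one covers the
  root, where \<open>butlast\<close> stays put.\<close>

lemma tmove_butlast: "tmove b (butlast l) = butlast (tmove b l) \<or>
    tmove b l = butlast (tmove b (butlast l)) \<or> tmove b (butlast l) = tmove b l"
  by (cases l rule: reduced.cases) (auto simp: tmove_def)

lemma adjacent_move:
  assumes "(u, v) \<in> adjacent"
  shows "(move x u, move x v) \<in> adjacent"
proof -
  have "move x u = butlast (move x v) \<or> move x v = butlast (move x u) \<or> move x u = move x v"
    if "u = butlast v" for u v
    using that tmove_butlast by (cases x rule: move.cases) (auto simp: shift_butlast)
  from this[of u v] this[of v u] show ?thesis
    using assms reduced_move[of u x] reduced_move[of v x] unfolding adjacent_def by auto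
qed

lemma adjacent_moves: "(u, v) \<in> adjacent \<Longrightarrow> (moves w u, moves w v) \<in> adjacent"
  by (induction w) (auto simp: adjacent_move)

lemma adjacent_butlast: "(u, v) \<in> adjacent \<Longrightarrow> (butlast u, butlast v) \<in> adjacent"
  by (auto simp: adjacent_def reduced_butlast)

lemma relpow_adjacent_map:
  assumes "\<And>u v. (u, v) \<in> adjacent \<Longrightarrow> (f u, f v) \<in> adjacent"
  shows "(u, v) \<in> adjacent ^^ r \<Longrightarrow> (f u, f v) \<in> adjacent ^^ r"
proof (induction r arbitrary: v)
  case (Suc r)
  then obtain w where "(u, w) \<in> adjacent ^^ r" "(w, v) \<in> adjacent" by auto
  then show ?case using Suc.IH assms by auto
qed simp

lemma relpow_adjacent_reduced: "(u, v) \<in> adjacent ^^ r \<Longrightarrow> reduced u \<Longrightarrow> reduced v"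
  by (cases r) (auto simp: adjacent_def)

lemma relpow_adjacent_Suc: "(u, v) \<in> adjacent ^^ r \<Longrightarrow> reduced u \<Longrightarrow> (u, v) \<in> adjacent ^^ Suc r"
  using relpow_adjacent_reduced[of u v r] by (auto simp: adjacent_def intro: relcompI)

lemma relpow_adjacent_length: "(u, v) \<in> adjacent ^^ r \<Longrightarrow> length v \<le> length u + r"
proof (induction r arbitrary: v)
  case (Suc r)
  then obtain w where "(u, w) \<in> adjacent ^^ r" and w: "(w, v) \<in> adjacent" by auto
  then have "length w \<le> length u + r" using Suc.IH by blast
  moreover have "length v \<le> Suc (length w)" using w by (auto simp: adjacent_def)
  ultimately show ?case by simp
qed simp

lemma relpow_adjacent_root: "reduced v \<Longrightarrow> length v \<le> r \<Longrightarrow> ([], v) \<in> adjacent ^^ r"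
proof (induction r arbitrary: v)
  case (Suc r)
  have "([], butlast v) \<in> adjacent ^^ r"
    using Suc.IH[of "butlast v"] Suc.prems reduced_butlast by auto
  moreover have "(butlast v, v) \<in> adjacent" using Suc.prems reduced_butlast by (simp add: adjacent_def)
  ultimately show ?case by auto
qed simp

lemma sym_relpow_adjacent: "(u, v) \<in> adjacent ^^ r \<Longrightarrow> (v, u) \<in> adjacent ^^ r"
proof (induction r arbitrary: v)
  case (Suc r)
  then obtain w where "(u, w) \<in> adjacent ^^ r" and w: "(w, v) \<in> adjacent" by auto
  then have "(w, u) \<in> adjacent ^^ r" using Suc.IH by blast
  moreover have "(v, w) \<in> adjacent" using w by (auto simp: adjacent_def)
  ultimately show ?case by (rule relpow_Suc_I2[rotated])
qed simp

text \<open>The tree is locally finite. The crude bound |m| + |n| on residues is two-sided because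
  residues of a negative modulus are nonpositive.\<close>

lemma finite_reduced: "finite {l. reduced l \<and> length l \<le> r}"
proof (rule finite_subset)
  let ?A = "{- (\<bar>m\<bar> + \<bar>n\<bar>)..\<bar>m\<bar> + \<bar>n\<bar>} \<times> (UNIV :: bool set)"
  show "finite {l. set l \<subseteq> ?A \<and> length l \<le> r}" by (rule finite_lists_length_le) simp
  have "\<bar>q\<bar> \<le> \<bar>m\<bar> + \<bar>n\<bar>" if "q mod modulus b = q" for q b
    using abs_mod_less[of "modulus b" q] that m0 n0 by (cases b) (auto simp: modulus_def)
  then have res: "- (\<bar>m\<bar> + \<bar>n\<bar>) \<le> q \<and> q \<le> \<bar>m\<bar> + \<bar>n\<bar>" if "q mod modulus b = q" for q b
    using that by (fastforce simp: abs_le_iff)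
  have "set l \<subseteq> ?A" if "reduced l" for l
    using that
  proof (induction l)
    case (Cons p l)
    obtain q b where p: "p = (q, b)" by force
    then show ?case using Cons res[of q b] by (auto simp: reduced_Cons)
  qed simp
  then show "{l. reduced l \<and> length l \<le> r} \<subseteq> {l. set l \<subseteq> ?A \<and> length l \<le> r}" by blast
qed

lemma height_butlast: "l \<noteq> [] \<Longrightarrow> height l = height (butlast l) + (if snd (last l) then 1 else - 1)"
  by (cases l rule: rev_cases) auto

lemma height_adjacent: "(u, v) \<in> adjacent \<Longrightarrow> \<bar>height u - height v\<bar> \<le> 1"
  using height_butlast[of u] height_butlast[of v] by (cases "u = []"; cases "v = []") (auto simp: adjacent_def)

text \<open>For c > 0 the half tree opens upward, where a vertex has |n| neighbours; for c < 0 it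
  opens downward, where it has |m|.\<close>

definition good :: "real \<Rightarrow> bool" where
  "good c \<longleftrightarrow> c = 0 \<or> (c > 0 \<and> \<bar>n\<bar> = 1) \<or> (c < 0 \<and> \<bar>m\<bar> = 1)"

text \<open>If \<open>\<bar>n\<bar> = 1\<close> then no upward edge can follow a downward edge in a reduced path, so heights
  along it first increase and then decrease.\<close>

lemma reduced_constant_tail:
  assumes "\<bar>modulus b\<bar> = 1" "reduced ((r, \<not> b) # l)"
  shows "\<forall>p\<in>set l. snd p = (\<not> b)"
  using assms(2)
proof (induction l arbitrary: r)
  case (Cons p l)
  obtain q c where p: "p = (q, c)" by force
  have "modulus b dvd q" using assms(1) by (metis abs_dvd_iff one_dvd)
  then have "q mod modulus b = 0" by simp
  moreover have "q mod modulus c = q" using Cons.prems by (simp add: p reduced_Cons[of q])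
  ultimately have "c = (\<not> b)" using Cons.prems by (cases "c = b") (auto simp: p)
  then show ?case using Cons by (auto simp: p reduced_Cons)
qed simp

text \<open>If the last edge points against b, removing it raises the signed height. Otherwise, by
  \<open>reduced_constant_tail\<close>, no edge of l points against b, and the signed height of
  \<open>butlast l\<close> is its length.\<close>

lemma height_butlast_nonneg:
  assumes "\<bar>modulus b\<bar> = 1" "reduced l" "0 \<le> (if b then 1 else - 1) * height l"
  shows "0 \<le> (if b then 1 else - 1) * height (butlast l)"
proof (cases "l = [] \<or> snd (last l) = (\<not> b)")
  case True
  then show ?thesis using assms(3) height_butlast[of l] by (cases "l = []") (auto split: if_splits)
next
  case False
  have "\<forall>p\<in>set l. snd p = b"
  proof (rule ccontr)
    assume "\<not> ?thesis"
    then obtain p where p: "p \<in> set l" "snd p \<noteq> b" by blast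
    obtain r c where rc: "p = (r, c)" by (rule prod.exhaust)
    then have "c = (\<not> b)" using p by auto
    then have "(r, \<not> b) \<in> set l" using p rc by blast
    from split_list[OF this] obtain u w where l: "l = u @ (r, \<not> b) # w" by blast
    then have "reduced ((r, \<not> b) # w)" using assms(2) reduced_append_Cons[of u r "\<not> b" w] by blast
    then have "\<forall>p\<in>set w. snd p = (\<not> b)" using reduced_constant_tail[OF assms(1)] by blast
    then have "snd (last l) = (\<not> b)" by (cases w rule: rev_cases) (auto simp: l)
    then show False using False by simp
  qed
  then have "\<forall>p\<in>set (butlast l). snd p = b" by (meson in_set_butlastD)
  then have "height (butlast l) = (if b then 1 else - 1) * real (length (butlast l))"
    by (induction "butlast l" arbitrary: l) (auto simp: height_def case_prod_beta sum_list_triv cong: map_cong)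
  then show ?thesis by simp
qed

lemma good_butlast:
  assumes "good c" "reduced l" "0 \<le> c * height l"
  shows "0 \<le> c * height (butlast l)"
proof -
  consider "c = 0" | "c > 0" "\<bar>modulus True\<bar> = 1" | "c < 0" "\<bar>modulus False\<bar> = 1"
    using assms(1) by (auto simp: good_def modulus_def)
  then show ?thesis
  proof cases
    case 2
    then show ?thesis using height_butlast_nonneg[of True l] assms by (simp add: zero_le_mult_iff)
  next
    case 3
    then show ?thesis using height_butlast_nonneg[of False l] assms by (simp add: zero_le_mult_iff)
  qed simp
qed

text \<open>A path that starts in the upper halfspace and leaves it by at most \<open>r\<close> cannot reach the bottom
  of the descending segment \<open>replicate (Suc R) (0, \<not> b)\<close>.\<close>

lemma prefix_locally_constant:
  assumes "(u, v) \<in> adjacent ^^ r" "r \<le> R" "0 \<le> (if b then 1 else - 1) * height u"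
  shows "- real r \<le> (if b then 1 else - 1) * height v \<and>
    (prefix (replicate (Suc R) (0, \<not> b)) v \<longleftrightarrow> prefix (replicate (Suc R) (0, \<not> b)) u)"
  using assms(1,2)
proof (induction r arbitrary: v)
  case 0
  then show ?case using assms(3) by simp
next
  case (Suc r)
  then obtain w where w: "(u, w) \<in> adjacent ^^ r" "(w, v) \<in> adjacent" by auto
  define s where "s = (if b then 1 else - 1 :: real)"
  define P where "P = replicate (Suc R) (0 :: int, \<not> b)"
  have IH: "- real r \<le> s * height w" "prefix P w \<longleftrightarrow> prefix P u"
    using Suc.IH[OF w(1)] Suc.prems unfolding s_def P_def by auto
  have hv: "- real (Suc r) \<le> s * height v"
    using IH(1) height_adjacent[OF w(2)] by (auto simp: s_def abs_le_iff)
  have hP: "s * height P = - real (Suc R)" by (auto simp: s_def P_def simp del: replicate_Suc)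
  \<comment> \<open>P has signed height - (R + 1), whereas w and v have signed height at least - R
    because \<open>Suc r \<le> R\<close>. Whether P is a prefix can change only on the edge joining
    P to its parent, so it does not change from w to v.\<close>
  have "w \<noteq> P" "v \<noteq> P" using IH(1) hv hP Suc.prems(2) by auto
  moreover have pre: "prefix P (butlast x) \<longleftrightarrow> prefix P x" if "x \<noteq> P" for x
    using that by (cases x rule: rev_cases) (auto simp: prefix_snoc)
  ultimately have "prefix P v \<longleftrightarrow> prefix P w" using w(2) unfolding adjacent_def by auto
  then show ?case using hv IH(2) unfolding s_def P_def by blast
qed

lemma bad_vertex:
  assumes "\<bar>modulus b\<bar> \<ge> 2"
  obtains z where "reduced z" "height z = 0" "prefix (replicate (Suc R) (0, \<not> b)) z"
proof -
  \<comment> \<open>A nonzero residue, available because the modulus has absolute value at least 2.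
    It starts an ascent on a branch other than the one of the descent; the heights add up to - (R +
    1) + 1 + R = 0.\<close>
  let ?q = "1 mod modulus b"
  let ?z = "replicate (Suc R) (0, \<not> b) @ (?q, b) # replicate R (0, b)"
  have rep: "reduced (replicate k (0, c))" for k c
    by (induction k) (auto simp: reduced_Cons, (case_tac k; simp)?)
  have q: "?q \<noteq> 0"
  proof
    assume "?q = 0"
    then have "modulus b dvd 1" by presburger
    then show False using assms zdvd_imp_le[of "\<bar>modulus b\<bar>" 1] by simp
  qed
  have 1: "reduced ((?q, b) # replicate R (0, b))"
    unfolding reduced_Cons using rep[of R b] by (cases R) auto
  have "reduced (replicate k (0, \<not> b) @ (?q, b) # replicate R (0, b))" for k
  proof (induction k)
    case (Suc k)
    then show ?case using q by (cases k) (simp_all add: reduced_Cons[of 0 "\<not> b"])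
  qed (use 1 in simp)
  then have "reduced ?z" by blast
  moreover have "height ?z = 0" by (auto simp del: replicate_Suc)
  moreover have "prefix (replicate (Suc R) (0, \<not> b)) ?z" unfolding prefix_def by blast
  ultimately show ?thesis using that by blast
qed

section \<open>The action of the Baumslag-Solitar group\<close>

abbreviation \<Gamma> where "\<Gamma> \<equiv> BS m n"
abbreviation \<Lambda> where "\<Lambda> \<equiv> bs_subgroup m n"
abbreviation wc where "wc \<equiv> word_class (bs_relations m n)"
abbreviation agen where "agen \<equiv> bs_elt m n gen_a"

definition tgen :: "bool \<Rightarrow> bs_gen word set" where
  "tgen b = wc [(gen_t, b)]"

sublocale BS: group \<Gamma>
  by (simp add: BS_def group_presented_group)

lemma carrier_BS: "carrier \<Gamma> = range wc"
  by (simp add: BS_def presented_group_def)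

lemma wc_closed [simp]: "wc w \<in> carrier \<Gamma>"
  by (simp add: carrier_BS)

lemma wc_mult [simp]: "wc u \<otimes>\<^bsub>\<Gamma>\<^esub> wc v = wc (u @ v)"
  by (simp add: BS_def presented_group_mult)

lemma wc_Nil: "wc [] = \<one>\<^bsub>\<Gamma>\<^esub>"
  by (simp add: BS_def presented_group_def)

lemma agen_closed [simp]: "agen \<in> carrier \<Gamma>" and tgen_closed [simp]: "tgen b \<in> carrier \<Gamma>"
  by (simp_all add: bs_elt_def tgen_def)

lemma wc_inverse: "inv\<^bsub>\<Gamma>\<^esub> (wc [(x, b)]) = wc [(x, \<not> b)]"
proof (rule BS.inv_equality)
  have "wc ([(x, \<not> b)] @ [(x, b)]) = wc []"
    using pres_eq.cancel[of "bs_relations m n" "[]" x "\<not> b" "[]"] by (simp add: word_class_eq_iff)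
  then show "wc [(x, \<not> b)] \<otimes>\<^bsub>\<Gamma>\<^esub> wc [(x, b)] = \<one>\<^bsub>\<Gamma>\<^esub>" by (simp add: wc_Nil)
qed simp_all

lemma wc_word_pow: "wc (word_pow x k) = bs_elt m n x [^]\<^bsub>\<Gamma>\<^esub> k"
proof -
  have e: "bs_elt m n x = wc [(x, True)]" by (simp add: bs_elt_def word_pow_def)
  have rep: "wc (replicate j (x, b)) = wc [(x, b)] [^]\<^bsub>\<Gamma>\<^esub> j" for j :: nat and b
  proof (induction j)
    case (Suc j)
    have "wc (replicate (Suc j) (x, b)) = wc (replicate j (x, b)) \<otimes>\<^bsub>\<Gamma>\<^esub> wc [(x, b)]"
      by (simp add: replicate_append_same)
    then show ?case using Suc by simp
  qed (simp add: wc_Nil)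
  show ?thesis
  proof (cases "0 \<le> k")
    case True
    then obtain j where j: "k = int j" by (metis nonneg_int_cases)
    have "word_pow x k = replicate j (x, True)" by (simp add: j word_pow_def)
    then show ?thesis unfolding j int_pow_int e by (simp only: rep)
  next
    case False
    have "wc [(x, False)] = inv\<^bsub>\<Gamma>\<^esub> (wc [(x, True)])" using wc_inverse[of x True] by simp
    moreover from False obtain j where j: "k = - int j" "j \<noteq> 0" by (cases k rule: int_cases2) auto
    moreover have "word_pow x k = replicate j (x, False)" using j by (simp add: word_pow_def)
    ultimately show ?thesis
      unfolding j(1) e by (simp only: rep BS.nat_pow_inv BS.int_pow_neg_int wc_closed)
  qed
qed

lemma tgen_inv: "tgen b \<otimes>\<^bsub>\<Gamma>\<^esub> tgen (\<not> b) = \<one>\<^bsub>\<Gamma>\<^esub>"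
  using BS.r_inv[of "tgen b"] by (simp add: tgen_def wc_inverse del: wc_mult)

lemma agen_pow_add: "agen [^]\<^bsub>\<Gamma>\<^esub> (i + j :: int) = agen [^]\<^bsub>\<Gamma>\<^esub> i \<otimes>\<^bsub>\<Gamma>\<^esub> agen [^]\<^bsub>\<Gamma>\<^esub> j"
  by (rule BS.int_pow_mult) simp

lemma bs_relation: "agen [^]\<^bsub>\<Gamma>\<^esub> n \<otimes>\<^bsub>\<Gamma>\<^esub> tgen True = tgen True \<otimes>\<^bsub>\<Gamma>\<^esub> agen [^]\<^bsub>\<Gamma>\<^esub> m"
proof -
  have "wc (word_pow gen_t 1 @ word_pow gen_a m @ word_pow gen_t (- 1)) = wc (word_pow gen_a n)"
    using pres_eq.relation[of _ _ "bs_relations m n" "[]" "[]"] by (simp add: word_class_eq_iff bs_relations_def)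
  then have "tgen True \<otimes>\<^bsub>\<Gamma>\<^esub> (agen [^]\<^bsub>\<Gamma>\<^esub> m \<otimes>\<^bsub>\<Gamma>\<^esub> tgen False) = agen [^]\<^bsub>\<Gamma>\<^esub> n"
    unfolding wc_word_pow[symmetric] by (simp add: tgen_def word_pow_def)
  then have "agen [^]\<^bsub>\<Gamma>\<^esub> n \<otimes>\<^bsub>\<Gamma>\<^esub> tgen True =
      (tgen True \<otimes>\<^bsub>\<Gamma>\<^esub> (agen [^]\<^bsub>\<Gamma>\<^esub> m \<otimes>\<^bsub>\<Gamma>\<^esub> tgen False)) \<otimes>\<^bsub>\<Gamma>\<^esub> tgen True"
    by (simp only:)
  then have "agen [^]\<^bsub>\<Gamma>\<^esub> n \<otimes>\<^bsub>\<Gamma>\<^esub> tgen True = tgen True \<otimes>\<^bsub>\<Gamma>\<^esub> (agen [^]\<^bsub>\<Gamma>\<^esub> m \<otimes>\<^bsub>\<Gamma>\<^esub> (tgen False \<otimes>\<^bsub>\<Gamma>\<^esub> tgen True))"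
    by (simp add: BS.m_assoc)
  then show ?thesis using tgen_inv[of False] by simp
qed

lemma agen_pow_tgen_True:
  "agen [^]\<^bsub>\<Gamma>\<^esub> (q * n) \<otimes>\<^bsub>\<Gamma>\<^esub> tgen True = tgen True \<otimes>\<^bsub>\<Gamma>\<^esub> agen [^]\<^bsub>\<Gamma>\<^esub> (q * m)"
proof -
  have pos: "agen [^]\<^bsub>\<Gamma>\<^esub> (int j * n) \<otimes>\<^bsub>\<Gamma>\<^esub> tgen True = tgen True \<otimes>\<^bsub>\<Gamma>\<^esub> agen [^]\<^bsub>\<Gamma>\<^esub> (int j * m)" for j
  proof (induction j)
    case (Suc j)
    have "agen [^]\<^bsub>\<Gamma>\<^esub> (int (Suc j) * n) \<otimes>\<^bsub>\<Gamma>\<^esub> tgen True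
        = agen [^]\<^bsub>\<Gamma>\<^esub> (int j * n) \<otimes>\<^bsub>\<Gamma>\<^esub> (agen [^]\<^bsub>\<Gamma>\<^esub> n \<otimes>\<^bsub>\<Gamma>\<^esub> tgen True)"
      by (simp add: distrib_right add.commute[of n] agen_pow_add BS.m_assoc)
    also have "\<dots> = (agen [^]\<^bsub>\<Gamma>\<^esub> (int j * n) \<otimes>\<^bsub>\<Gamma>\<^esub> tgen True) \<otimes>\<^bsub>\<Gamma>\<^esub> agen [^]\<^bsub>\<Gamma>\<^esub> m"
      by (simp add: bs_relation BS.m_assoc)
    also have "\<dots> = tgen True \<otimes>\<^bsub>\<Gamma>\<^esub> agen [^]\<^bsub>\<Gamma>\<^esub> (int (Suc j) * m)"
      unfolding Suc by (simp add: distrib_right add.commute[of m] agen_pow_add BS.m_assoc)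
    finally show ?case .
  qed simp
  show ?thesis
  proof (cases q rule: int_cases2)
    case (nonneg j)
    then show ?thesis using pos by simp
  next
    case (nonpos j)
    let ?x = "agen [^]\<^bsub>\<Gamma>\<^esub> (int j * n)" and ?y = "agen [^]\<^bsub>\<Gamma>\<^esub> (int j * m)"
    have "tgen True = inv\<^bsub>\<Gamma>\<^esub> ?x \<otimes>\<^bsub>\<Gamma>\<^esub> (tgen True \<otimes>\<^bsub>\<Gamma>\<^esub> ?y)"
      by (subst BS.inv_solve_left) (use pos[of j] in simp_all)
    then have "inv\<^bsub>\<Gamma>\<^esub> ?x \<otimes>\<^bsub>\<Gamma>\<^esub> tgen True = tgen True \<otimes>\<^bsub>\<Gamma>\<^esub> inv\<^bsub>\<Gamma>\<^esub> ?y"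
      by (subst BS.inv_solve_right) (simp_all add: BS.m_assoc)
    then show ?thesis by (simp add: nonpos BS.int_pow_neg)
  qed
qed

lemma agen_pow_tgen: "agen [^]\<^bsub>\<Gamma>\<^esub> (q * modulus b) \<otimes>\<^bsub>\<Gamma>\<^esub> tgen b = tgen b \<otimes>\<^bsub>\<Gamma>\<^esub> agen [^]\<^bsub>\<Gamma>\<^esub> (q * modulus (\<not> b))"
proof (cases b)
  case True
  then show ?thesis using agen_pow_tgen_True by (simp add: modulus_def)
next
  case False
  let ?x = "agen [^]\<^bsub>\<Gamma>\<^esub> (q * n)" and ?y = "agen [^]\<^bsub>\<Gamma>\<^esub> (q * m)"
  have inv: "tgen False = inv\<^bsub>\<Gamma>\<^esub> (tgen True)" using wc_inverse[of gen_t True] by (simp add: tgen_def)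
  have "?y = inv\<^bsub>\<Gamma>\<^esub> (tgen True) \<otimes>\<^bsub>\<Gamma>\<^esub> (?x \<otimes>\<^bsub>\<Gamma>\<^esub> tgen True)"
    by (subst BS.inv_solve_left) (use agen_pow_tgen_True in simp_all)
  then have "?y = (inv\<^bsub>\<Gamma>\<^esub> (tgen True) \<otimes>\<^bsub>\<Gamma>\<^esub> ?x) \<otimes>\<^bsub>\<Gamma>\<^esub> tgen True" by (simp add: BS.m_assoc)
  then have "?y \<otimes>\<^bsub>\<Gamma>\<^esub> inv\<^bsub>\<Gamma>\<^esub> (tgen True) = inv\<^bsub>\<Gamma>\<^esub> (tgen True) \<otimes>\<^bsub>\<Gamma>\<^esub> ?x"
    by (subst BS.inv_solve_right') simp_all
  then show ?thesis using False by (simp add: modulus_def inv)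
qed

section \<open>Normal forms of group elements and the action on the tree\<close>

fun normal_form :: "(int \<times> bool) list \<Rightarrow> bs_gen word set" where
  "normal_form [] = \<one>\<^bsub>\<Gamma>\<^esub>"
| "normal_form ((r, b) # l) = agen [^]\<^bsub>\<Gamma>\<^esub> r \<otimes>\<^bsub>\<Gamma>\<^esub> (tgen b \<otimes>\<^bsub>\<Gamma>\<^esub> normal_form l)"

lemma normal_form_closed [simp]: "normal_form l \<in> carrier \<Gamma>"
  by (induction l rule: normal_form.induct) simp_all

text \<open>The carry that \<open>shift\<close> discards at the end of the list survives in the
  group as a power of a on the right, which is invisible in the coset.\<close>

lemma agen_pow_normal_form:
  "\<exists>j. agen [^]\<^bsub>\<Gamma>\<^esub> k \<otimes>\<^bsub>\<Gamma>\<^esub> normal_form l = normal_form (shift k l) \<otimes>\<^bsub>\<Gamma>\<^esub> agen [^]\<^bsub>\<Gamma>\<^esub> (j :: int)"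
proof (induction l arbitrary: k)
  case Nil
  show ?case by (intro exI[of _ k]) simp
next
  case (Cons p l)
  obtain r b where p: "p = (r, b)" by force
  let ?q = "(k + r) div modulus b" and ?r = "(k + r) mod modulus b"
  obtain j :: int where j: "agen [^]\<^bsub>\<Gamma>\<^esub> (?q * modulus (\<not> b)) \<otimes>\<^bsub>\<Gamma>\<^esub> normal_form l
      = normal_form (shift (?q * modulus (\<not> b)) l) \<otimes>\<^bsub>\<Gamma>\<^esub> agen [^]\<^bsub>\<Gamma>\<^esub> j"
    using Cons by blast
  have "agen [^]\<^bsub>\<Gamma>\<^esub> k \<otimes>\<^bsub>\<Gamma>\<^esub> normal_form (p # l) = agen [^]\<^bsub>\<Gamma>\<^esub> (k + r) \<otimes>\<^bsub>\<Gamma>\<^esub> (tgen b \<otimes>\<^bsub>\<Gamma>\<^esub> normal_form l)"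
    by (simp add: p agen_pow_add BS.m_assoc)
  also have "k + r = ?r + ?q * modulus b" by simp
  also have "agen [^]\<^bsub>\<Gamma>\<^esub> (?r + ?q * modulus b) \<otimes>\<^bsub>\<Gamma>\<^esub> (tgen b \<otimes>\<^bsub>\<Gamma>\<^esub> normal_form l)
      = agen [^]\<^bsub>\<Gamma>\<^esub> ?r \<otimes>\<^bsub>\<Gamma>\<^esub> ((agen [^]\<^bsub>\<Gamma>\<^esub> (?q * modulus b) \<otimes>\<^bsub>\<Gamma>\<^esub> tgen b) \<otimes>\<^bsub>\<Gamma>\<^esub> normal_form l)"
    unfolding agen_pow_add[of ?r] by (simp add: BS.m_assoc)
  also have "\<dots> = agen [^]\<^bsub>\<Gamma>\<^esub> ?r \<otimes>\<^bsub>\<Gamma>\<^esub> (tgen b \<otimes>\<^bsub>\<Gamma>\<^esub> (agen [^]\<^bsub>\<Gamma>\<^esub> (?q * modulus (\<not> b)) \<otimes>\<^bsub>\<Gamma>\<^esub> normal_form l))"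
    unfolding agen_pow_tgen by (simp add: BS.m_assoc)
  also have "\<dots> = normal_form (shift k (p # l)) \<otimes>\<^bsub>\<Gamma>\<^esub> agen [^]\<^bsub>\<Gamma>\<^esub> j"
    unfolding j by (simp add: p BS.m_assoc)
  finally show ?case by blast
qed

lemma tgen_normal_form: "tgen b \<otimes>\<^bsub>\<Gamma>\<^esub> normal_form l = normal_form (tmove b l)"
proof (cases "l \<noteq> [] \<and> hd l = (0, \<not> b)")
  case True
  then obtain l' where l: "l = (0, \<not> b) # l'" by (cases l) auto
  have "tgen b \<otimes>\<^bsub>\<Gamma>\<^esub> normal_form l = (tgen b \<otimes>\<^bsub>\<Gamma>\<^esub> tgen (\<not> b)) \<otimes>\<^bsub>\<Gamma>\<^esub> normal_form l'"
    by (simp add: l BS.m_assoc)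
  then show ?thesis using tgen_inv by (simp add: l tmove_def)
next
  case False
  then have "tmove b l = (0, b) # l" by (auto simp: tmove_def)
  then show ?thesis by simp
qed

text \<open>Existence of normal forms: modulo \<Lambda> an element is determined by the list to
  which it moves the root.\<close>

lemma wc_normal_form: "\<exists>j. wc w = normal_form (moves w []) \<otimes>\<^bsub>\<Gamma>\<^esub> agen [^]\<^bsub>\<Gamma>\<^esub> (j :: int)"
proof (induction w)
  case Nil
  show ?case by (intro exI[of _ 0]) (simp add: wc_Nil)
next
  case (Cons x w)
  let ?l = "moves w []"
  obtain j :: int where j: "wc w = normal_form ?l \<otimes>\<^bsub>\<Gamma>\<^esub> agen [^]\<^bsub>\<Gamma>\<^esub> (j :: int)" using Cons by blast
  have "\<exists>i. wc [x] \<otimes>\<^bsub>\<Gamma>\<^esub> normal_form ?l = normal_form (move x ?l) \<otimes>\<^bsub>\<Gamma>\<^esub> agen [^]\<^bsub>\<Gamma>\<^esub> (i :: int)"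
  proof (cases x rule: move.cases)
    case (1 b)
    have "wc [x] = agen [^]\<^bsub>\<Gamma>\<^esub> (if b then 1 else - 1 :: int)"
      unfolding wc_word_pow[symmetric] by (simp add: 1 word_pow_def)
    then show ?thesis using agen_pow_normal_form[of "if b then 1 else - 1" ?l] by (simp add: 1)
  next
    case (2 b)
    then show ?thesis using tgen_normal_form[of b ?l] by (intro exI[of _ 0]) (simp add: tgen_def)
  qed
  then obtain i :: int where i: "wc [x] \<otimes>\<^bsub>\<Gamma>\<^esub> normal_form ?l = normal_form (move x ?l) \<otimes>\<^bsub>\<Gamma>\<^esub> agen [^]\<^bsub>\<Gamma>\<^esub> (i :: int)" by blast
  have "wc (x # w) = wc [x] \<otimes>\<^bsub>\<Gamma>\<^esub> wc w" by simp
  also have "\<dots> = (wc [x] \<otimes>\<^bsub>\<Gamma>\<^esub> normal_form ?l) \<otimes>\<^bsub>\<Gamma>\<^esub> agen [^]\<^bsub>\<Gamma>\<^esub> j"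
    unfolding j by (simp add: BS.m_assoc del: wc_mult)
  also have "\<dots> = normal_form (moves (x # w) []) \<otimes>\<^bsub>\<Gamma>\<^esub> agen [^]\<^bsub>\<Gamma>\<^esub> (i + j)"
    unfolding i by (simp add: BS.m_assoc agen_pow_add)
  finally show ?case by blast
qed

definition act :: "bs_gen word set \<Rightarrow> (int \<times> bool) list \<Rightarrow> (int \<times> bool) list" where
  "act g l = moves (SOME w. w \<in> g) l"

lemma act_wc: "reduced l \<Longrightarrow> act (wc w) l = moves w l"
proof -
  assume l: "reduced l"
  have "w \<in> wc w" by (simp add: word_class_def pres_eq.refl)
  then have "(SOME v. v \<in> wc w) \<in> wc w" by (rule someI)
  then show ?thesis using moves_pres_eq[OF _ l] by (simp add: act_def word_class_def)
qed

lemma act_mult: "g \<in> carrier \<Gamma> \<Longrightarrow> h \<in> carrier \<Gamma> \<Longrightarrow> reduced l \<Longrightarrow> act (g \<otimes>\<^bsub>\<Gamma>\<^esub> h) l = act g (act h l)"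
  unfolding carrier_BS by (auto simp: act_wc reduced_moves)

lemma reduced_act: "reduced l \<Longrightarrow> reduced (act g l)"
  by (simp add: act_def reduced_moves)

lemma act_one: "reduced l \<Longrightarrow> act \<one>\<^bsub>\<Gamma>\<^esub> l = l"
  by (simp add: act_wc flip: wc_Nil)

lemma act_inv: "g \<in> carrier \<Gamma> \<Longrightarrow> reduced l \<Longrightarrow> act (inv\<^bsub>\<Gamma>\<^esub> g) (act g l) = l"
  by (simp add: act_one flip: act_mult)

lemma act_agen_pow: "reduced l \<Longrightarrow> act (agen [^]\<^bsub>\<Gamma>\<^esub> k) l = shift k l"
  by (simp add: act_wc moves_word_pow_a flip: wc_word_pow)

text \<open>Uniqueness of normal forms: a reduced list is recovered from its element by acting on
  the root. A cancellation in \<open>tmove\<close> would contradict reducedness.\<close>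

lemma act_normal_form: "reduced l \<Longrightarrow> act (normal_form l) [] = l"
proof (induction l)
  case Nil
  then show ?case by (simp add: act_one)
next
  case (Cons p l)
  obtain r b where p: "p = (r, b)" by force
  have l: "reduced l" "r mod modulus b = r" using Cons.prems by (auto simp: p reduced_Cons)
  have "act (tgen b \<otimes>\<^bsub>\<Gamma>\<^esub> normal_form l) [] = tmove b l"
    using Cons l by (simp add: act_mult tgen_def act_wc)
  then have "act (normal_form (p # l)) [] = shift r (tmove b l)"
    by (simp add: p act_mult act_agen_pow reduced_tmove l)
  also have "\<dots> = p # l"
  proof (cases "l \<noteq> [] \<and> hd l = (0, \<not> b)")
    case True
    then show ?thesis using Cons.prems by (simp add: p reduced_Cons)
  next
    case False
    then have "tmove b l = (0, b) # l" by (auto simp: tmove_def)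
    then show ?thesis using l by (simp add: p residue_div shift_0)
  qed
  finally show ?case .
qed

lemma relpow_adjacent_act: "(u, v) \<in> adjacent ^^ r \<Longrightarrow> (act g u, act g v) \<in> adjacent ^^ r"
  unfolding act_def by (rule relpow_adjacent_map[OF adjacent_moves])

lemma \<Lambda>_eq: "\<Lambda> = {agen [^]\<^bsub>\<Gamma>\<^esub> k | k. k \<in> (UNIV :: int set)}"
  unfolding bs_subgroup_def by (rule BS.generate_pow) simp

sublocale \<Lambda>: subgroup \<Lambda> \<Gamma>
  unfolding bs_subgroup_def by (rule BS.generate_is_subgroup) simp

lemma tau_char: "tau m n \<in> characters \<Gamma> (discrete_topology (carrier \<Gamma>))"
  and tau_agen: "tau m n agen = 0" and tau_tgen: "tau m n (bs_elt m n gen_t) = 1"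
  using theI'[OF ex1_tau[of m n]] by (simp_all add: tau_def)

lemma tau_eq: "tau m n (wc w) = t_exponent w"
proof -
  have hom: "tau m n \<in> hom \<Gamma> real_group" using tau_char by (simp add: characters_def)
  have add: "tau m n (wc (u @ v)) = tau m n (wc u) + tau m n (wc v)" for u v
    using hom_mult[OF hom, of "wc u" "wc v"] by (simp add: real_group_def)
  have z: "tau m n (wc []) = 0" using add[of "[]" "[]"] by simp
  have neg: "tau m n (wc [(x, False)]) = - tau m n (wc [(x, True)])" for x
  proof -
    have "wc ([(x, False)] @ [(x, True)]) = wc []"
      using pres_eq.cancel[of "bs_relations m n" "[]" x False "[]"] by (simp add: word_class_eq_iff)
    then show ?thesis using add[of "[(x, False)]" "[(x, True)]"] z by simp
  qed
  show ?thesis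
  proof (induction w)
    case Nil
    then show ?case by (simp add: z t_exponent_def)
  next
    case (Cons p w)
    have "tau m n (wc [p]) = t_exponent [p]"
    proof (cases p rule: move.cases)
      case (1 b)
      then show ?thesis using tau_agen neg[of gen_a] by (cases b) (auto simp: bs_elt_def word_pow_def t_exponent_def)
    next
      case (2 b)
      then show ?thesis using tau_tgen neg[of gen_t] by (cases b) (auto simp: bs_elt_def word_pow_def t_exponent_def)
    qed
    then show ?case using add[of "[p]" w] Cons t_exponent_append[of "[p]" w] by simp
  qed
qed

lemma tau_height: "g \<in> carrier \<Gamma> \<Longrightarrow> tau m n g = height (act g [])"
  unfolding carrier_BS by (auto simp: tau_eq act_wc height_moves)

abbreviation \<V> where "\<V> \<equiv> lcosets\<^bsub>\<Gamma>\<^esub> \<Lambda>"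

text \<open>The chosen representative does not matter: two elements of a coset differ by a power of
  a on the right, and this fixes the root \<open>[]\<close>.\<close>

definition vertex :: "bs_gen word set set \<Rightarrow> (int \<times> bool) list" where
  "vertex C = act (SOME g. g \<in> C) []"

lemma coset_in: "g \<in> carrier \<Gamma> \<Longrightarrow> g <#\<^bsub>\<Gamma>\<^esub> \<Lambda> \<in> \<V>"
  by (auto simp: LCOSETS_def)

lemma coset_cases:
  assumes "C \<in> \<V>"
  obtains g where "g \<in> carrier \<Gamma>" "C = g <#\<^bsub>\<Gamma>\<^esub> \<Lambda>"
  using assms by (auto simp: LCOSETS_def)

lemma vertex_coset: "g \<in> carrier \<Gamma> \<Longrightarrow> vertex (g <#\<^bsub>\<Gamma>\<^esub> \<Lambda>) = act g []"
proof -
  assume g: "g \<in> carrier \<Gamma>"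
  have "g \<in> g <#\<^bsub>\<Gamma>\<^esub> \<Lambda>" using BS.lcos_self[OF g \<Lambda>.subgroup_axioms] .
  then have "(SOME h. h \<in> g <#\<^bsub>\<Gamma>\<^esub> \<Lambda>) \<in> g <#\<^bsub>\<Gamma>\<^esub> \<Lambda>" by (rule someI)
  then obtain k :: int where "(SOME h. h \<in> g <#\<^bsub>\<Gamma>\<^esub> \<Lambda>) = g \<otimes>\<^bsub>\<Gamma>\<^esub> agen [^]\<^bsub>\<Gamma>\<^esub> k"
    by (auto simp: l_coset_def \<Lambda>_eq)
  then show ?thesis using g by (simp add: vertex_def act_mult act_agen_pow)
qed

lemma reduced_vertex: "reduced (vertex C)"
  by (simp add: vertex_def reduced_act)

lemma coset_eq_normal_form:
  assumes g: "g \<in> carrier \<Gamma>"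
  shows "g <#\<^bsub>\<Gamma>\<^esub> \<Lambda> = normal_form (act g []) <#\<^bsub>\<Gamma>\<^esub> \<Lambda>"
proof -
  obtain w where w: "g = wc w" using g by (auto simp: carrier_BS)
  obtain j :: int where "g = normal_form (act g []) \<otimes>\<^bsub>\<Gamma>\<^esub> agen [^]\<^bsub>\<Gamma>\<^esub> j"
    using wc_normal_form[of w] by (auto simp: w act_wc)
  then have "g \<in> normal_form (act g []) <#\<^bsub>\<Gamma>\<^esub> \<Lambda>" by (auto simp: l_coset_def \<Lambda>_eq)
  then show ?thesis using BS.l_repr_independence[OF _ normal_form_closed \<Lambda>.subgroup_axioms] by simp
qed

lemma vertex_inj: "C \<in> \<V> \<Longrightarrow> D \<in> \<V> \<Longrightarrow> vertex C = vertex D \<Longrightarrow> C = D"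
  by (elim coset_cases) (metis coset_eq_normal_form vertex_coset)

lemma \<Lambda>_coset: "\<Lambda> = \<one>\<^bsub>\<Gamma>\<^esub> <#\<^bsub>\<Gamma>\<^esub> \<Lambda>"
  by (simp add: BS.lcos_mult_one \<Lambda>.subset)

lemma \<Lambda>_in: "\<Lambda> \<in> \<V>"
  using coset_in[of "\<one>\<^bsub>\<Gamma>\<^esub>"] \<Lambda>_coset by simp

lemma vertex_\<Lambda>: "vertex \<Lambda> = []"
  using vertex_coset[of "\<one>\<^bsub>\<Gamma>\<^esub>"] \<Lambda>_coset by (simp add: act_one)

section \<open>The Schlichting completion\<close>

abbreviation \<G> where "\<G> \<equiv> G_BS m n"
abbreviation \<T> where "\<T> \<equiv> T_BS m n"
abbreviation \<alpha> where "\<alpha> \<equiv> coset_action \<Gamma> \<Lambda>"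
abbreviation prodtop where "prodtop \<equiv> product_topology (\<lambda>_. discrete_topology \<V>) \<V>"

lemma alpha_coset: "g \<in> carrier \<Gamma> \<Longrightarrow> h \<in> carrier \<Gamma> \<Longrightarrow> \<alpha> g (h <#\<^bsub>\<Gamma>\<^esub> \<Lambda>) = (g \<otimes>\<^bsub>\<Gamma>\<^esub> h) <#\<^bsub>\<Gamma>\<^esub> \<Lambda>"
  by (simp add: coset_action_def coset_in BS.lcos_m_assoc \<Lambda>.subset)

lemma alpha_in: "g \<in> carrier \<Gamma> \<Longrightarrow> C \<in> \<V> \<Longrightarrow> \<alpha> g C \<in> \<V>"
  by (elim coset_cases) (simp add: alpha_coset coset_in)

lemma vertex_alpha: "g \<in> carrier \<Gamma> \<Longrightarrow> C \<in> \<V> \<Longrightarrow> vertex (\<alpha> g C) = act g (vertex C)"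
  by (elim coset_cases) (simp add: alpha_coset vertex_coset act_mult)

lemma alpha_mult: "g \<in> carrier \<Gamma> \<Longrightarrow> h \<in> carrier \<Gamma> \<Longrightarrow> C \<in> \<V> \<Longrightarrow> \<alpha> (g \<otimes>\<^bsub>\<Gamma>\<^esub> h) C = \<alpha> g (\<alpha> h C)"
  by (elim coset_cases) (simp add: alpha_coset BS.m_assoc)

lemma alpha_one: "C \<in> \<V> \<Longrightarrow> \<alpha> \<one>\<^bsub>\<Gamma>\<^esub> C = C"
  by (elim coset_cases) (simp add: alpha_coset)

lemma alpha_inv: "g \<in> carrier \<Gamma> \<Longrightarrow> C \<in> \<V> \<Longrightarrow> \<alpha> (inv\<^bsub>\<Gamma>\<^esub> g) (\<alpha> g C) = C"
  "g \<in> carrier \<Gamma> \<Longrightarrow> C \<in> \<V> \<Longrightarrow> \<alpha> g (\<alpha> (inv\<^bsub>\<Gamma>\<^esub> g) C) = C"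
  by (simp_all add: alpha_one flip: alpha_mult)

lemma alpha_Bij: "g \<in> carrier \<Gamma> \<Longrightarrow> \<alpha> g \<in> Bij \<V>"
proof -
  assume g: "g \<in> carrier \<Gamma>"
  have "bij_betw (\<alpha> g) \<V> \<V>"
    by (rule bij_betw_byWitness[where f' = "\<alpha> (inv\<^bsub>\<Gamma>\<^esub> g)"]) (use g alpha_inv alpha_in in auto)
  then show ?thesis by (simp add: Bij_def coset_action_def)
qed

lemma topspace_prodtop: "topspace prodtop = (\<V> \<rightarrow>\<^sub>E \<V>)"
  by simp

text \<open>A basic neighbourhood in the topology of pointwise convergence prescribes finitely many
  values.\<close>

lemma closure_prodtop:
  assumes S: "S \<subseteq> (\<V> \<rightarrow>\<^sub>E \<V>)"
  shows "prodtop closure_of S =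
    {f \<in> \<V> \<rightarrow>\<^sub>E \<V>. \<forall>E. finite E \<and> E \<subseteq> \<V> \<longrightarrow> (\<exists>h\<in>S. \<forall>C\<in>E. h C = f C)}"
proof (intro equalityI subsetI)
  fix f assume f: "f \<in> prodtop closure_of S"
  then have "f \<in> topspace prodtop" unfolding in_closure_of by (rule conjunct1)
  then have fX: "f \<in> \<V> \<rightarrow>\<^sub>E \<V>" by simp
  have "\<exists>h\<in>S. \<forall>C\<in>E. h C = f C" if E: "finite E" "E \<subseteq> \<V>" for E
  proof -
    let ?W = "\<lambda>C. if C \<in> E then {f C} else \<V>"
    have fin: "finite {C \<in> \<V>. ?W C \<noteq> topspace (discrete_topology \<V>)}"
      by (rule finite_subset[OF _ E(1)]) auto
    have "openin prodtop (PiE \<V> ?W)"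
      using fin fX by (subst openin_PiE_gen) (auto simp: PiE_iff)
    moreover have "f \<in> PiE \<V> ?W" using fX by auto
    moreover have "\<forall>T. f \<in> T \<and> openin prodtop T \<longrightarrow> (\<exists>y. y \<in> S \<and> y \<in> T)"
      using f unfolding in_closure_of by (rule conjunct2)
    ultimately obtain h where h: "h \<in> S" "h \<in> PiE \<V> ?W" by meson
    have "h C = f C" if "C \<in> E" for C
    proof -
      have "C \<in> \<V>" using E(2) that by blast
      then have "h C \<in> ?W C" using h(2) by (rule PiE_mem[rotated])
      then show ?thesis using that by simp
    qed
    then show ?thesis using h(1) by blast
  qed
  then show "f \<in> {f \<in> \<V> \<rightarrow>\<^sub>E \<V>. \<forall>E. finite E \<and> E \<subseteq> \<V> \<longrightarrow> (\<exists>h\<in>S. \<forall>C\<in>E. h C = f C)}"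
    using fX by blast
next
  fix f assume f: "f \<in> {f \<in> \<V> \<rightarrow>\<^sub>E \<V>. \<forall>E. finite E \<and> E \<subseteq> \<V> \<longrightarrow> (\<exists>h\<in>S. \<forall>C\<in>E. h C = f C)}"
  show "f \<in> prodtop closure_of S"
    unfolding in_closure_of
  proof (intro conjI allI impI)
    show "f \<in> topspace prodtop" using f topspace_prodtop by simp
    fix U assume "f \<in> U \<and> openin prodtop U"
    then obtain W where W: "finite {C \<in> \<V>. W C \<noteq> topspace (discrete_topology \<V>)}" "f \<in> PiE \<V> W" "PiE \<V> W \<subseteq> U"
      unfolding openin_product_topology_alt by meson
    then obtain h where h: "h \<in> S" "\<forall>C\<in>{C \<in> \<V>. W C \<noteq> \<V>}. h C = f C"
      using f by auto
    have "h \<in> PiE \<V> W"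
    proof (rule PiE_I)
      fix C assume C: "C \<in> \<V>"
      show "h C \<in> W C"
      proof (cases "W C = \<V>")
        case True
        then show ?thesis using S h(1) C by auto
      next
        case False
        then have "h C = f C" using h(2) C by blast
        then show ?thesis using W(2) C by auto
      qed
    qed (use S h(1) in auto)
    then show "\<exists>y. y \<in> S \<and> y \<in> U" using h(1) W(3) by blast
  qed
qed

lemma Bij_subset: "Bij \<V> \<subseteq> (\<V> \<rightarrow>\<^sub>E \<V>)"
  by (auto simp: Bij_def PiE_def bij_betw_def)

lemma carrier_G_closure: "carrier \<G> = Bij \<V> \<inter> prodtop closure_of (\<alpha> ` carrier \<Gamma>)"
proof -
  have "\<alpha> ` carrier \<Gamma> \<subseteq> Bij \<V>" using alpha_Bij by blast
  then show ?thesis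
    by (simp add: schlichting_group_def sym_topology_def closure_of_subtopology Int_absorb1)
qed

lemma carrier_G: "carrier \<G> =
    {f \<in> Bij \<V>. \<forall>E. finite E \<and> E \<subseteq> \<V> \<longrightarrow> (\<exists>g\<in>carrier \<Gamma>. \<forall>C\<in>E. \<alpha> g C = f C)}"
proof -
  have "\<alpha> ` carrier \<Gamma> \<subseteq> (\<V> \<rightarrow>\<^sub>E \<V>)" using alpha_Bij Bij_subset by blast
  have "Bij \<V> \<inter> {f \<in> \<V> \<rightarrow>\<^sub>E \<V>. P f} = {f \<in> Bij \<V>. P f}" for P using Bij_subset by blast
  then show ?thesis unfolding carrier_G_closure closure_prodtop[OF \<open>\<alpha> ` carrier \<Gamma> \<subseteq> _\<close>] by simp
qed

text \<open>The means of transfer from \<Gamma> to its completion: any statement about finitely many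
  cosets may be checked on group elements.\<close>

lemma G_agree:
  assumes "f \<in> carrier \<G>" "finite E" "E \<subseteq> \<V>"
  obtains g where "g \<in> carrier \<Gamma>" "\<And>C. C \<in> E \<Longrightarrow> \<alpha> g C = f C"
proof -
  have "\<forall>E. finite E \<and> E \<subseteq> \<V> \<longrightarrow> (\<exists>g\<in>carrier \<Gamma>. \<forall>C\<in>E. \<alpha> g C = f C)"
    using assms(1) unfolding carrier_G mem_Collect_eq by (rule conjunct2)
  from this[rule_format, OF conjI[OF assms(2,3)]] show ?thesis using that by (elim bexE) simp
qed

lemma G_Bij: "f \<in> carrier \<G> \<Longrightarrow> f \<in> Bij \<V>"
  by (simp add: carrier_G)

lemma G_in: "f \<in> carrier \<G> \<Longrightarrow> C \<in> \<V> \<Longrightarrow> f C \<in> \<V>"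
  using PiE_mem[OF subsetD[OF Bij_subset G_Bij]] .

lemma G_ext: "f \<in> carrier \<G> \<Longrightarrow> f \<in> extensional \<V>"
  using G_Bij[of f] by (simp add: Bij_def)

lemma alpha_G: "g \<in> carrier \<Gamma> \<Longrightarrow> \<alpha> g \<in> carrier \<G>"
  unfolding carrier_G mem_Collect_eq using alpha_Bij by (intro conjI allI impI bexI[of _ g]) simp_all

lemma mult_G: "f \<in> carrier \<G> \<Longrightarrow> h \<in> carrier \<G> \<Longrightarrow> f \<otimes>\<^bsub>\<G>\<^esub> h = compose \<V> f h"
proof -
  assume "f \<in> carrier \<G>" "h \<in> carrier \<G>"
  then have "f \<in> Bij \<V>" "h \<in> Bij \<V>" by (simp_all only: G_Bij)
  then show ?thesis unfolding schlichting_group_def BijGroup_def by simp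
qed

lemma mult_G_closed:
  assumes f: "f \<in> carrier \<G>" and h: "h \<in> carrier \<G>"
  shows "f \<otimes>\<^bsub>\<G>\<^esub> h \<in> carrier \<G>"
  unfolding mult_G[OF assms]
proof -
  have "\<exists>g\<in>carrier \<Gamma>. \<forall>C\<in>E. \<alpha> g C = compose \<V> f h C" if E: "finite E" "E \<subseteq> \<V>" for E
  proof -
    obtain g where g: "g \<in> carrier \<Gamma>" "\<And>C. C \<in> E \<Longrightarrow> \<alpha> g C = h C" using G_agree[OF h E] by blast
    \<comment> \<open>The approximation of f has to be good at the images of E under h, not on E
      itself.\<close>
    have hE: "finite (h ` E)" "h ` E \<subseteq> \<V>" using E G_in[OF h] by auto
    obtain k where k: "k \<in> carrier \<Gamma>" "\<And>C. C \<in> h ` E \<Longrightarrow> \<alpha> k C = f C" using G_agree[OF f hE] by blast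
    have "\<alpha> (k \<otimes>\<^bsub>\<Gamma>\<^esub> g) C = compose \<V> f h C" if "C \<in> E" for C
      using that g k E by (auto simp: alpha_mult compose_def)
    then show ?thesis using g(1) k(1) by (intro bexI[of _ "k \<otimes>\<^bsub>\<Gamma>\<^esub> g"]) simp_all
  qed
  then show "compose \<V> f h \<in> carrier \<G>"
    unfolding carrier_G mem_Collect_eq
    by (intro conjI compose_Bij G_Bij f h allI impI) (elim conjE)
qed

lemma mult_G_apply:
  "f \<in> carrier \<G> \<Longrightarrow> h \<in> carrier \<G> \<Longrightarrow> C \<in> \<V> \<Longrightarrow> (f \<otimes>\<^bsub>\<G>\<^esub> h) C = f (h C)"
  by (simp add: mult_G compose_def)

lemma alpha_mult_G:
  assumes "g \<in> carrier \<Gamma>" "h \<in> carrier \<Gamma>"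
  shows "\<alpha> (g \<otimes>\<^bsub>\<Gamma>\<^esub> h) = \<alpha> g \<otimes>\<^bsub>\<G>\<^esub> \<alpha> h"
proof (rule extensionalityI)
  show "\<alpha> (g \<otimes>\<^bsub>\<Gamma>\<^esub> h) \<in> extensional \<V>" "\<alpha> g \<otimes>\<^bsub>\<G>\<^esub> \<alpha> h \<in> extensional \<V>"
    using assms by (simp_all add: G_ext alpha_G mult_G_closed)
  fix C assume "C \<in> \<V>"
  then show "\<alpha> (g \<otimes>\<^bsub>\<Gamma>\<^esub> h) C = (\<alpha> g \<otimes>\<^bsub>\<G>\<^esub> \<alpha> h) C"
    using assms by (simp add: mult_G_apply alpha_G alpha_mult)
qed

lemma T_eq: "\<T> = subtopology prodtop (carrier \<G>)"
  using G_Bij by (simp add: schlichting_topology_def sym_topology_def subtopology_subtopology Int_absorb1 subset_iff)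

lemma topspace_T: "topspace \<T> = carrier \<G>"
  using G_Bij Bij_subset by (auto simp: T_eq)

definition pos where "pos f = vertex (f \<Lambda>)"

lemma reduced_pos: "reduced (pos f)"
  by (simp add: pos_def reduced_vertex)

text \<open>Two cosets are finitely many, so f may be replaced by an element of \<Gamma>.\<close>

lemma G_isometry:
  assumes f: "f \<in> carrier \<G>" and C: "C \<in> \<V>" "D \<in> \<V>" and r: "(vertex C, vertex D) \<in> adjacent ^^ r"
  shows "(vertex (f C), vertex (f D)) \<in> adjacent ^^ r"
proof -
  obtain g where g: "g \<in> carrier \<Gamma>" "\<And>B. B \<in> {C, D} \<Longrightarrow> \<alpha> g B = f B"
    by (rule G_agree[OF f, of "{C, D}"]) (use C in auto)
  have "(act g (vertex C), act g (vertex D)) \<in> adjacent ^^ r" by (rule relpow_adjacent_act[OF r])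
  then show ?thesis using g(2)[of C] g(2)[of D] vertex_alpha[OF g(1) C(1)] vertex_alpha[OF g(1) C(2)] by simp
qed

lemma pos_mult: "f \<in> carrier \<G> \<Longrightarrow> h \<in> carrier \<G> \<Longrightarrow> pos (f \<otimes>\<^bsub>\<G>\<^esub> h) = vertex (f (h \<Lambda>))"
  by (simp add: mult_G pos_def compose_def \<Lambda>_in)

lemma pos_alpha: "g \<in> carrier \<Gamma> \<Longrightarrow> pos (\<alpha> g) = act g []"
  by (simp add: pos_def vertex_alpha \<Lambda>_in vertex_\<Lambda>)

lemma pos_alpha_mult: "g \<in> carrier \<Gamma> \<Longrightarrow> f \<in> carrier \<G> \<Longrightarrow> pos (\<alpha> g \<otimes>\<^bsub>\<G>\<^esub> f) = act g (pos f)"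
  by (simp add: pos_mult alpha_G vertex_alpha G_in \<Lambda>_in) (simp add: pos_def)

text \<open>Left division by elements of the dense image of \<Gamma>, with the inverse formed in
  \<Gamma>.\<close>

lemma alpha_inv_mult:
  assumes "g \<in> carrier \<Gamma>" "f \<in> carrier \<G>"
  shows "\<alpha> g \<otimes>\<^bsub>\<G>\<^esub> (\<alpha> (inv\<^bsub>\<Gamma>\<^esub> g) \<otimes>\<^bsub>\<G>\<^esub> f) = f"
proof (rule extensionalityI[of _ \<V>])
  show "\<alpha> g \<otimes>\<^bsub>\<G>\<^esub> (\<alpha> (inv\<^bsub>\<Gamma>\<^esub> g) \<otimes>\<^bsub>\<G>\<^esub> f) \<in> extensional \<V>" "f \<in> extensional \<V>"
    using assms by (simp_all add: G_ext alpha_G mult_G_closed)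
  fix C assume "C \<in> \<V>"
  then show "(\<alpha> g \<otimes>\<^bsub>\<G>\<^esub> (\<alpha> (inv\<^bsub>\<Gamma>\<^esub> g) \<otimes>\<^bsub>\<G>\<^esub> f)) C = f C"
    using assms by (simp add: mult_G_apply alpha_G mult_G_closed alpha_inv G_in)
qed

section \<open>Compact subsets of the completion\<close>

definition coset_ball :: "nat \<Rightarrow> (bs_gen word set set \<Rightarrow> bs_gen word set set) set" where
  "coset_ball r = {f \<in> carrier \<G>. length (pos f) \<le> r}"

lemma finite_vertex_ball: "finite {D \<in> \<V>. length (vertex D) \<le> r}"
proof (rule inj_on_finite)
  show "inj_on vertex {D \<in> \<V>. length (vertex D) \<le> r}" 
    by (rule inj_onI, rule vertex_inj) simp_all
  show "vertex ` {D \<in> \<V>. length (vertex D) \<le> r} \<subseteq> {l. reduced l \<and> length l \<le> r}"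
    using reduced_vertex by auto
qed (rule finite_reduced)

text \<open>Exhibits a closed subset of a product of finite sets. The closure is taken among all
  self-maps of the coset space, where limits of bijections can fail to be surjective; bounding the
  displacement of the root rules this out.\<close>

lemma coset_ball_eq:
  "coset_ball r = PiE \<V> (\<lambda>C. {D \<in> \<V>. length (vertex D) \<le> r + length (vertex C)}) \<inter>
    prodtop closure_of (\<alpha> ` carrier \<Gamma>)" (is "_ = PiE \<V> ?K \<inter> _")
proof (intro equalityI subsetI)
  fix f assume f: "f \<in> coset_ball r"
  then have fG: "f \<in> carrier \<G>" and fr: "length (pos f) \<le> r" by (auto simp: coset_ball_def)
  have "length (vertex (f C)) \<le> r + length (vertex C)" if C: "C \<in> \<V>" for C
  proof -
    have "([], vertex C) \<in> adjacent ^^ length (vertex C)" by (rule relpow_adjacent_root[OF reduced_vertex order_refl])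
    then have "(pos f, vertex (f C)) \<in> adjacent ^^ length (vertex C)"
      unfolding pos_def using G_isometry[OF fG \<Lambda>_in C] vertex_\<Lambda> by simp
    from relpow_adjacent_length[OF this] show ?thesis using fr by simp
  qed
  then have "f \<in> PiE \<V> ?K" using G_in[OF fG] G_Bij[OF fG] by (auto simp: PiE_def Bij_def)
  then show "f \<in> PiE \<V> ?K \<inter> prodtop closure_of (\<alpha> ` carrier \<Gamma>)" using fG by (simp add: carrier_G_closure)
next
  fix f assume f: "f \<in> PiE \<V> ?K \<inter> prodtop closure_of (\<alpha> ` carrier \<Gamma>)"
  have "\<alpha> ` carrier \<Gamma> \<subseteq> (\<V> \<rightarrow>\<^sub>E \<V>)" using alpha_Bij Bij_subset by blast
  from closure_prodtop[OF this] f
  have ag: "\<exists>g\<in>carrier \<Gamma>. \<forall>C\<in>E. \<alpha> g C = f C" if "finite E" "E \<subseteq> \<V>" for E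
    using that by auto
  have fX: "f C \<in> \<V>" if "C \<in> \<V>" for C using f that by auto
  have fr: "length (pos f) \<le> r" using f \<Lambda>_in by (auto simp: pos_def vertex_\<Lambda> PiE_iff dest!: bspec[of _ _ \<Lambda>])
  have "inj_on f \<V>"
  proof (rule inj_onI)
    fix C D assume C: "C \<in> \<V>" "D \<in> \<V>" and e: "f C = f D"
    obtain g where g: "g \<in> carrier \<Gamma>" "\<forall>B\<in>{C, D}. \<alpha> g B = f B" using ag[of "{C, D}"] C by auto
    then have "\<alpha> g C = \<alpha> g D" using e by simp
    then show "C = D" using alpha_inv(1)[OF g(1)] C by metis
  qed
  moreover have "f ` \<V> = \<V>"
  proof (intro equalityI subsetI)
    fix D assume D: "D \<in> \<V>"
    \<comment> \<open>Let g agree with f on the finite ball of radius ?R and at the root. As g moves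
      the root by at most r, the coset \<open>g^-1 D\<close> lies in this ball, so f maps it to D as
      well.\<close>
    let ?R = "r + length (vertex D)"
    let ?E = "insert \<Lambda> {C \<in> \<V>. length (vertex C) \<le> ?R}"
    have "finite ?E" "?E \<subseteq> \<V>" using finite_vertex_ball \<Lambda>_in by auto
    then obtain g where g: "g \<in> carrier \<Gamma>" "\<forall>B\<in>?E. \<alpha> g B = f B" using ag by blast
    let ?C = "\<alpha> (inv\<^bsub>\<Gamma>\<^esub> g) D"
    have C: "?C \<in> \<V>" using g D by (simp add: alpha_in)
    have gp: "act g [] = pos f" using g vertex_alpha[OF g(1) \<Lambda>_in] by (simp add: pos_def vertex_\<Lambda>)
    have "(pos f, []) \<in> adjacent ^^ r" by (rule sym_relpow_adjacent[OF relpow_adjacent_root[OF reduced_pos fr]])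
    moreover have "([], vertex D) \<in> adjacent ^^ length (vertex D)"
      by (rule relpow_adjacent_root[OF reduced_vertex order_refl])
    ultimately have "(act g [], vertex D) \<in> adjacent ^^ ?R" unfolding gp relpow_add by blast
    then have "(act (inv\<^bsub>\<Gamma>\<^esub> g) (act g []), vertex ?C) \<in> adjacent ^^ ?R"
      using relpow_adjacent_act g D by (simp add: vertex_alpha)
    then have "([], vertex ?C) \<in> adjacent ^^ ?R" using g by (simp add: act_inv)
    from relpow_adjacent_length[OF this] have "?C \<in> ?E" using C by simp
    with g(2) have "\<alpha> g ?C = f ?C" by (rule bspec)
    then have "D = f ?C" using alpha_inv(2)[OF g(1) D] by simp
    then show "D \<in> f ` \<V>" using C by (rule image_eqI)
  qed (use fX in blast)
  moreover have "f \<in> extensional \<V>" using f by (simp add: PiE_def)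
  ultimately have "f \<in> Bij \<V>" by (simp add: Bij_def bij_betw_def)
  then show "f \<in> coset_ball r" using fr f by (simp add: coset_ball_def carrier_G_closure)
qed

lemma compactin_coset_ball: "compactin \<T> (coset_ball r)"
proof -
  have "compactin prodtop (PiE \<V> (\<lambda>C. {D \<in> \<V>. length (vertex D) \<le> r + length (vertex C)}))"
    by (subst compactin_PiE) (auto simp: compactin_discrete_topology finite_vertex_ball)
  then have "compactin prodtop (coset_ball r)"
    unfolding coset_ball_eq by (rule compact_Int_closedin[OF _ closedin_closure_of])
  moreover have "coset_ball r \<subseteq> carrier \<G>" unfolding coset_ball_def by blast
  ultimately show ?thesis by (simp add: T_eq compactin_subtopology)
qed

text \<open>Evaluation at \<Lambda> is continuous into a discrete space, so a compact set moves the
  root to finitely many vertices only. Thus the sets \<open>coset_ball r\<close> are cofinal among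
  the compact sets.\<close>

lemma compactin_subset_coset_ball:
  assumes "compactin \<T> C"
  obtains r where "C \<subseteq> coset_ball r"
proof -
  have "continuous_map \<T> (discrete_topology \<V>) (\<lambda>f. f \<Lambda>)"
    unfolding T_eq by (intro continuous_map_from_subtopology continuous_map_product_projection \<Lambda>_in)
  from image_compactin[OF assms this] have fin: "finite ((\<lambda>f. f \<Lambda>) ` C)"
    by (simp add: compactin_discrete_topology)
  define r where "r = Max (insert 0 ((length \<circ> vertex) ` (\<lambda>f. f \<Lambda>) ` C))"
  have "length (pos f) \<le> r" if "f \<in> C" for f
    unfolding r_def pos_def by (rule Max_ge) (use fin that in auto)
  moreover have "C \<subseteq> carrier \<G>" using compactin_subset_topspace[OF assms] topspace_T by simp
  ultimately show ?thesis using that[of r] by (auto simp: coset_ball_def)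
qed

lemma char_mult:
  "\<psi> \<in> characters \<G> \<T> \<Longrightarrow> f \<in> carrier \<G> \<Longrightarrow> h \<in> carrier \<G> \<Longrightarrow> \<psi> (f \<otimes>\<^bsub>\<G>\<^esub> h) = \<psi> f + \<psi> h"
  by (auto simp: characters_def hom_def real_group_def)

text \<open>The stabilizer \<open>coset_ball 0\<close> of the root is a compact subgroup, so every character kills it.\<close>

lemma char_coset_ball_0:
  assumes \<psi>: "\<psi> \<in> characters \<G> \<T>" and u: "u \<in> coset_ball 0"
  shows "\<psi> u = 0"
proof -
  have mult: "v \<otimes>\<^bsub>\<G>\<^esub> w \<in> coset_ball 0" if "v \<in> coset_ball 0" "w \<in> coset_ball 0" for v w
  proof -
    have vw: "v \<in> carrier \<G>" "w \<in> carrier \<G>" "pos v = []" "pos w = []" using that by (auto simp: coset_ball_def)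
    have "w \<Lambda> = \<Lambda>" by (rule vertex_inj) (use vw G_in \<Lambda>_in in \<open>auto simp: pos_def vertex_\<Lambda>\<close>)
    then have "pos (v \<otimes>\<^bsub>\<G>\<^esub> w) = []" using vw pos_mult[OF vw(1,2)] by (simp add: pos_def)
    then show ?thesis using vw mult_G_closed by (simp add: coset_ball_def)
  qed
  \<comment> \<open>The witness is the power \<open>u^(k + 1)\<close>, so all multiples of \<psi> u
    lie in the bounded image of the stabilizer.\<close>
  have pow: "\<exists>w\<in>coset_ball 0. \<psi> w = real (Suc k) * \<psi> u" for k
  proof (induction k)
    case (Suc k)
    then obtain w where "w \<in> coset_ball 0" "\<psi> w = real (Suc k) * \<psi> u" by blast
    then show ?case using mult[OF u] char_mult[OF \<psi>, of u w] u
      by (intro bexI[of _ "u \<otimes>\<^bsub>\<G>\<^esub> w"]) (auto simp: coset_ball_def algebra_simps)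
  qed (use u in auto)
  have "continuous_map \<T> euclideanreal \<psi>" using \<psi> by (simp add: characters_def)
  from image_compactin[OF compactin_coset_ball this] have "bounded (\<psi> ` coset_ball 0)" by (simp add: compact_imp_bounded)
  then obtain b where b: "\<And>w. w \<in> coset_ball 0 \<Longrightarrow> \<bar>\<psi> w\<bar> \<le> b" by (auto simp: bounded_iff)
  have le: "real (Suc k) * \<bar>\<psi> u\<bar> \<le> b" for k
  proof -
    obtain w where "w \<in> coset_ball 0" "\<psi> w = real (Suc k) * \<psi> u" using pow by blast
    then show ?thesis using b[of w] by (simp add: abs_mult)
  qed
  show ?thesis
  proof (rule ccontr)
    assume "\<psi> u \<noteq> 0"
    then obtain k where "b < real k * \<bar>\<psi> u\<bar>" using ex_less_of_nat_mult[of "\<bar>\<psi> u\<bar>" b] by auto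
    then show False using le[of k] by (simp add: algebra_simps) 
  qed
qed

text \<open>Some g in \<Gamma> moves the root to the same place as f; then f is \<alpha> g times an
  element of the stabilizer, which \<psi> kills.\<close>

lemma char_alpha:
  assumes \<psi>: "\<psi> \<in> characters \<G> \<T>" and f: "f \<in> carrier \<G>"
  obtains g where "g \<in> carrier \<Gamma>" "\<psi> f = \<psi> (\<alpha> g)" "pos f = act g []"
proof -
  obtain g where g: "g \<in> carrier \<Gamma>" "\<alpha> g \<Lambda> = f \<Lambda>" using G_agree[OF f, of "{\<Lambda>}"] \<Lambda>_in by auto
  have p: "pos f = act g []" using vertex_alpha[OF g(1) \<Lambda>_in] g(2) by (simp add: pos_def vertex_\<Lambda>)
  let ?u = "\<alpha> (inv\<^bsub>\<Gamma>\<^esub> g) \<otimes>\<^bsub>\<G>\<^esub> f"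
  have uG: "?u \<in> carrier \<G>" using f g by (simp add: alpha_G mult_G_closed)
  have "pos ?u = []" using f g by (simp add: pos_alpha_mult p act_inv)
  then have "\<psi> ?u = 0" using char_coset_ball_0[OF \<psi>] uG by (simp add: coset_ball_def)
  then have "\<psi> f = \<psi> (\<alpha> g)" using char_mult[OF \<psi> alpha_G[OF g(1)] uG] alpha_inv_mult[OF g(1) f] by simp
  then show ?thesis using that g p by blast
qed

text \<open>The image of a stabilizes the root, so \<psi> vanishes there and its restriction to
  \<Gamma> is determined by the value at t. \<open>char_alpha\<close> carries the formula over to
  the completion.\<close>

lemma char_height:
  assumes \<psi>: "\<psi> \<in> characters \<G> \<T>"
  obtains c where "\<forall>f\<in>carrier \<G>. \<psi> f = c * height (pos f)" "c = \<psi> (\<alpha> (bs_elt m n gen_t))"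
proof -
  let ?c = "\<psi> (\<alpha> (bs_elt m n gen_t))"
  have hom: "(\<lambda>g. \<psi> (\<alpha> g)) \<in> hom (presented_group (bs_relations m n)) real_group"
  proof (rule homI)
    fix g h assume "g \<in> carrier (presented_group (bs_relations m n))" "h \<in> carrier (presented_group (bs_relations m n))"
    then have g: "g \<in> carrier \<Gamma>" "h \<in> carrier \<Gamma>" by (simp_all add: BS_def)
    have "\<psi> (\<alpha> (g \<otimes>\<^bsub>\<Gamma>\<^esub> h)) = \<psi> (\<alpha> g) + \<psi> (\<alpha> h)"
      unfolding alpha_mult_G[OF g] using g by (simp add: char_mult[OF \<psi>] alpha_G)
    then show "\<psi> (\<alpha> (g \<otimes>\<^bsub>presented_group (bs_relations m n)\<^esub> h)) = \<psi> (\<alpha> g) \<otimes>\<^bsub>real_group\<^esub> \<psi> (\<alpha> h)"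
      by (simp add: real_group_def BS_def)
  qed (simp add: real_group_def)
  have tau_hom: "(\<lambda>g. ?c * tau m n g) \<in> hom (presented_group (bs_relations m n)) real_group"
    using tau_char by (auto simp: characters_def hom_def real_group_def BS_def distrib_left)
  have "\<alpha> agen \<in> coset_ball 0"
    using act_agen_pow[of "[]" 1] by (simp add: coset_ball_def alpha_G pos_alpha)
  then have a0: "\<psi> (\<alpha> agen) = 0" using char_coset_ball_0[OF \<psi>] by simp
  have "\<psi> (\<alpha> (wc w)) = ?c * tau m n (wc w)" for w
  proof (rule char_real_unique[OF hom tau_hom])
    fix x show "\<psi> (\<alpha> (wc [(x, True)])) = ?c * tau m n (wc [(x, True)])"
      using a0 tau_agen tau_tgen by (cases x) (simp_all add: bs_elt_def word_pow_def)
  qed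
  then have e: "\<psi> (\<alpha> g) = ?c * height (act g [])" if "g \<in> carrier \<Gamma>" for g
    using that tau_height by (auto simp: carrier_BS)
  have "\<psi> f = ?c * height (pos f)" if f: "f \<in> carrier \<G>" for f
  proof -
    obtain g where "g \<in> carrier \<Gamma>" "\<psi> f = \<psi> (\<alpha> g)" "pos f = act g []" by (rule char_alpha[OF \<psi> f])
    then show ?thesis using e by simp
  qed
  then show ?thesis using that by blast
qed

lemma tau_bar_char: "tau_bar m n \<in> characters \<G> \<T>"
  and tau_bar_alpha: "g \<in> carrier \<Gamma> \<Longrightarrow> tau_bar m n (\<alpha> g) = tau m n g"
  using theI'[OF ex1_tau_bar[of m n]] by (simp_all add: tau_bar_def bs_structure_map_def)

lemma tau_bar_height: "f \<in> carrier \<G> \<Longrightarrow> tau_bar m n f = height (pos f)"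
proof -
  assume f: "f \<in> carrier \<G>"
  obtain c where c: "\<forall>f\<in>carrier \<G>. tau_bar m n f = c * height (pos f)"
    "c = tau_bar m n (\<alpha> (bs_elt m n gen_t))" by (rule char_height[OF tau_bar_char])
  have "c = 1" using c(2) tau_bar_alpha[of "bs_elt m n gen_t"] tau_tgen by (simp add: bs_elt_def)
  then show ?thesis using c f by simp
qed

lemma characters_eq: "characters \<G> \<T> = {scale_character \<G> c (tau_bar m n) | c. True}"
proof (intro equalityI subsetI)
  fix \<psi> assume \<psi>: "\<psi> \<in> characters \<G> \<T>"
  obtain c where c: "\<forall>f\<in>carrier \<G>. \<psi> f = c * height (pos f)" by (rule char_height[OF \<psi>])
  have "\<psi> = scale_character \<G> c (tau_bar m n)"
    by (rule extensionalityI[of _ "carrier \<G>"])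
       (use \<psi> c in \<open>auto simp: characters_def scale_character_def tau_bar_height\<close>)
  then show "\<psi> \<in> {scale_character \<G> c (tau_bar m n) | c. True}" by blast
next
  fix \<psi> assume "\<psi> \<in> {scale_character \<G> c (tau_bar m n) | c. True}"
  then obtain c where c: "\<psi> = scale_character \<G> c (tau_bar m n)" by blast
  have "\<psi> \<in> hom \<G> real_group"
  proof (rule homI)
    fix f h assume "f \<in> carrier \<G>" "h \<in> carrier \<G>"
    then show "\<psi> (f \<otimes>\<^bsub>\<G>\<^esub> h) = \<psi> f \<otimes>\<^bsub>real_group\<^esub> \<psi> h"
      using char_mult[OF tau_bar_char] by (simp add: c scale_character_def mult_G_closed real_group_def distrib_left)
  qed (simp add: real_group_def)
  moreover have "continuous_map \<T> euclideanreal \<psi>"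
  proof (rule continuous_map_eq)
    show "continuous_map \<T> euclideanreal (\<lambda>f. c * tau_bar m n f)"
      using tau_bar_char by (intro continuous_map_real_mult_left) (simp add: characters_def)
  qed (simp add: c scale_character_def topspace_T)
  ultimately show "\<psi> \<in> characters \<G> \<T>" by (simp add: characters_def c scale_character_def)
qed

end

section \<open>The sigma-sets\<close>

text \<open>A list with entries in g C is the translate of a list with entries in C. The face and
  degeneracy maps of \<open>EE\<close> do not depend on the vertex set, so \<open>UNIV\<close> may
  replace the carrier.\<close>

lemma translates_eq_cover_sset:
  "translates G S C = cover_sset ((\<lambda>g. (\<lambda>x. g \<otimes>\<^bsub>G\<^esub> x) ` C) ` S)"
proof -
  have "(\<Union>g\<in>S. map (\<lambda>x. g \<otimes>\<^bsub>G\<^esub> x) ` {xs. length xs = Suc k \<and> set xs \<subseteq> C}) =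
      {xs. length xs = Suc k \<and> (\<exists>B\<in>(\<lambda>g. (\<lambda>x. g \<otimes>\<^bsub>G\<^esub> x) ` C) ` S. set xs \<subseteq> B)}" (is "?L = ?R") for k
  proof (intro equalityI subsetI)
    fix xs assume "xs \<in> ?R"
    then obtain g where g: "g \<in> S" "length xs = Suc k" "set xs \<subseteq> (\<lambda>x. g \<otimes>\<^bsub>G\<^esub> x) ` C" by blast
    then have "\<forall>x\<in>set xs. \<exists>y\<in>C. x = g \<otimes>\<^bsub>G\<^esub> y" by blast
    then obtain h where h: "\<forall>x\<in>set xs. h x \<in> C \<and> x = g \<otimes>\<^bsub>G\<^esub> h x" by metis
    then have "xs = map (\<lambda>x. g \<otimes>\<^bsub>G\<^esub> x) (map h xs)" by (simp add: map_idI)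
    moreover have "map h xs \<in> {xs. length xs = Suc k \<and> set xs \<subseteq> C}" using h g by auto
    ultimately show "xs \<in> ?L" using g(1) by blast
  next
    fix xs assume "xs \<in> ?L"
    then obtain g ys where "g \<in> S" "xs = map (\<lambda>x. g \<otimes>\<^bsub>G\<^esub> x) ys" "length ys = Suc k" "set ys \<subseteq> C" by blast
    then show "xs \<in> ?R" by (auto intro!: bexI[of _ g])
  qed
  then show ?thesis by (simp add: translates_def cover_sset_def EE_def)
qed

context baumslag_solitar begin

abbreviation halfspace where "halfspace c \<equiv> char_halfspace \<G> (scale_character \<G> c (tau_bar m n))"

definition family :: "real \<Rightarrow> (bs_gen word set set \<Rightarrow> bs_gen word set set) set \<Rightarrow> (bs_gen word set set \<Rightarrow> bs_gen word set set) set set" where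
  "family c C = (\<lambda>g. (\<lambda>x. g \<otimes>\<^bsub>\<G>\<^esub> x) ` C) ` halfspace c"

lemma translates_family: "translates \<G> (halfspace c) C = cover_sset (family c C)"
  by (simp add: translates_eq_cover_sset family_def)

lemma halfspace_eq: "halfspace c = {g \<in> carrier \<G>. 0 \<le> c * height (pos g)}"
  by (auto simp: char_halfspace_def scale_character_def tau_bar_height)

lemma family_mono: "C \<subseteq> D \<Longrightarrow> B \<in> family c C \<Longrightarrow> \<exists>B'\<in>family c D. B \<subseteq> B'"
  unfolding family_def by (elim imageE) (blast intro: image_mono)

text \<open>The translating element g is the centre: C lies within r of the root, and g acts on the
  tree by isometries.\<close>

lemma family_near:
  assumes "B \<in> family c C" "C \<subseteq> coset_ball r"
  obtains g where "g \<in> carrier \<G>" "0 \<le> c * height (pos g)"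
    "\<forall>x\<in>B. x \<in> carrier \<G> \<and> (pos g, pos x) \<in> adjacent ^^ r"
proof -
  obtain g where g: "g \<in> halfspace c" "B = (\<lambda>x. g \<otimes>\<^bsub>\<G>\<^esub> x) ` C" using assms(1) by (auto simp: family_def)
  have gG: "g \<in> carrier \<G>" "0 \<le> c * height (pos g)" using g(1) by (simp_all add: halfspace_eq)
  have "x \<in> carrier \<G> \<and> (pos g, pos x) \<in> adjacent ^^ r" if "x \<in> B" for x
  proof -
    obtain z where z: "z \<in> C" "x = g \<otimes>\<^bsub>\<G>\<^esub> z" using \<open>x \<in> B\<close> g(2) by blast
    have zG: "z \<in> carrier \<G>" "length (pos z) \<le> r" using z(1) assms(2) by (auto simp: coset_ball_def)
    have "([], pos z) \<in> adjacent ^^ r" by (rule relpow_adjacent_root[OF reduced_pos zG(2)])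
    then have "(vertex \<Lambda>, vertex (z \<Lambda>)) \<in> adjacent ^^ r" by (simp add: vertex_\<Lambda> pos_def)
    from G_isometry[OF gG(1) \<Lambda>_in G_in[OF zG(1) \<Lambda>_in] this]
    have "(pos g, pos x) \<in> adjacent ^^ r" unfolding z(2) pos_mult[OF gG(1) zG(1)] by (simp add: pos_def)
    then show ?thesis using z(2) gG(1) zG(1) by (simp add: mult_G_closed)
  qed
  then show ?thesis using that gG by blast
qed

text \<open>A section of \<open>pos\<close> over the reduced lists; \<open>lift []\<close> is the
  identity of the completion.\<close>

definition lift :: "(int \<times> bool) list \<Rightarrow> bs_gen word set set \<Rightarrow> bs_gen word set set" where
  "lift u = \<alpha> (normal_form u)"

lemma lift_closed [simp]: "lift u \<in> carrier \<G>"
  by (simp add: lift_def alpha_G)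

lemma pos_lift: "reduced u \<Longrightarrow> pos (lift u) = u"
  by (simp add: lift_def pos_alpha act_normal_form)

lemma lift_one:
  assumes "g \<in> carrier \<G>"
  shows "lift [] \<otimes>\<^bsub>\<G>\<^esub> g = g" "g \<otimes>\<^bsub>\<G>\<^esub> lift [] = g"
  by (rule extensionalityI[of _ \<V>]; use assms in
      \<open>simp add: G_ext mult_G_closed mult_G_apply lift_def alpha_G alpha_one G_in\<close>)+

text \<open>Converse of \<open>family_near\<close>: everything lying over a ball around u fits into
  one member, because division by \<open>normal_form u\<close> moves the ball to the root.\<close>

lemma family_ball:
  assumes u: "reduced u" "0 \<le> c * height u"
  obtains B where "B \<in> family c (coset_ball r)"
    "\<forall>x. x \<in> carrier \<G> \<and> (u, pos x) \<in> adjacent ^^ r \<longrightarrow> x \<in> B"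
proof -
  let ?g = "normal_form u"
  let ?B = "(\<lambda>x. lift u \<otimes>\<^bsub>\<G>\<^esub> x) ` coset_ball r"
  have "?B \<in> family c (coset_ball r)"
    unfolding family_def by (rule imageI) (use u in \<open>simp add: halfspace_eq pos_lift\<close>)
  moreover have "x \<in> ?B" if x: "x \<in> carrier \<G>" "(u, pos x) \<in> adjacent ^^ r" for x
  proof -
    let ?z = "\<alpha> (inv\<^bsub>\<Gamma>\<^esub> ?g) \<otimes>\<^bsub>\<G>\<^esub> x"
    have xz: "x = lift u \<otimes>\<^bsub>\<G>\<^esub> ?z" using alpha_inv_mult[of ?g x] x(1) by (simp add: lift_def)
    have "(act (inv\<^bsub>\<Gamma>\<^esub> ?g) (act ?g []), act (inv\<^bsub>\<Gamma>\<^esub> ?g) (pos x)) \<in> adjacent ^^ r"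
      by (rule relpow_adjacent_act) (use x(2) u(1) in \<open>simp add: act_normal_form\<close>)
    then have "([], pos ?z) \<in> adjacent ^^ r" using x(1) by (simp add: act_inv pos_alpha_mult)
    from relpow_adjacent_length[OF this] have "?z \<in> coset_ball r"
      using x(1) by (simp add: coset_ball_def mult_G_closed alpha_G)
    from imageI[OF this, of "\<lambda>x. lift u \<otimes>\<^bsub>\<G>\<^esub> x"] show ?thesis by (simp only: xz[symmetric])
  qed
  ultimately show ?thesis using that by blast
qed

text \<open>Many group elements lie over one tree vertex. Step 1 therefore moves x to the chosen
  element over the same vertex, and the vertex itself moves towards the root only from step 2 on;
  hence the exponent j - 1 in \<open>pos_contraction\<close>.\<close>

fun contraction :: "nat \<Rightarrow> (bs_gen word set set \<Rightarrow> bs_gen word set set) \<Rightarrow> bs_gen word set set \<Rightarrow> bs_gen word set set" where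
  "contraction 0 = id"
| "contraction (Suc j) = (\<lambda>x. lift ((butlast ^^ j) (pos x)))"

lemma funpow_butlast_Nil [simp]: "(butlast ^^ j) [] = []"
  by (induction j) simp_all

lemma funpow_butlast_length: "length ((butlast ^^ j) l) = length l - j"
  by (induction j) simp_all

lemma reduced_funpow_butlast: "reduced l \<Longrightarrow> reduced ((butlast ^^ j) l)"
  by (induction j) (simp_all add: reduced_butlast)

lemma contraction_base: "contraction j (lift []) = lift []"
  by (cases j) (simp_all add: pos_lift)

lemma contraction_eventually: "\<exists>N. \<forall>j\<ge>N. contraction j x = lift []"
proof (intro exI allI impI)
  fix j assume "Suc (length (pos x)) \<le> j"
  then obtain i where i: "j = Suc i" "length (pos x) \<le> i" by (cases j) auto
  have "(butlast ^^ i) (pos x) = []" using funpow_butlast_length[of i "pos x"] i by simp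
  then show "contraction j x = lift []" by (simp add: i)
qed

lemma pos_contraction: "pos (contraction j x) = (butlast ^^ (j - 1)) (pos x)"
  by (cases j) (simp_all add: pos_lift reduced_funpow_butlast reduced_pos)

lemma contraction_closed: "x \<in> carrier \<G> \<Longrightarrow> contraction j x \<in> carrier \<G>"
  by (cases j) simp_all

lemma good_funpow_butlast:
  "good c \<Longrightarrow> reduced l \<Longrightarrow> 0 \<le> c * height l \<Longrightarrow> 0 \<le> c * height ((butlast ^^ j) l)"
  by (induction j) (simp_all add: good_butlast reduced_funpow_butlast)

text \<open>Moving towards the root does not increase distances, and goodness keeps the moved centre
  in the half tree. So step j stays within r of that centre, and step j + 1 differs from it by at
  most one edge, whence the radius \<open>Suc r\<close>.\<close>

lemma contraction_contiguous:
  assumes "good c" "C \<subseteq> coset_ball r" "B \<in> family c C"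
  shows "\<exists>B'\<in>family c (coset_ball (Suc r)). contraction j ` B \<union> contraction (Suc j) ` B \<subseteq> B'"
proof -
  obtain g where g: "g \<in> carrier \<G>" "0 \<le> c * height (pos g)"
    and near: "\<forall>x\<in>B. x \<in> carrier \<G> \<and> (pos g, pos x) \<in> adjacent ^^ r"
    by (rule family_near[OF assms(3,2)])
  let ?u = "(butlast ^^ (j - 1)) (pos g)"
  have u: "reduced ?u" "0 \<le> c * height ?u"
    using reduced_funpow_butlast[OF reduced_pos] good_funpow_butlast[OF assms(1) reduced_pos g(2)] by blast+
  obtain B' where B': "B' \<in> family c (coset_ball (Suc r))"
    "\<forall>x. x \<in> carrier \<G> \<and> (?u, pos x) \<in> adjacent ^^ Suc r \<longrightarrow> x \<in> B'"
    by (rule family_ball[OF u])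
  have "contraction j x \<in> B' \<and> contraction (Suc j) x \<in> B'" if x: "x \<in> B" for x
  proof -
    let ?v = "(butlast ^^ (j - 1)) (pos x)"
    have xG: "x \<in> carrier \<G>" and d: "(pos g, pos x) \<in> adjacent ^^ r" using near x by auto
    have fp: "(v, w) \<in> adjacent \<Longrightarrow> ((butlast ^^ i) v, (butlast ^^ i) w) \<in> adjacent" for v w i
      by (induction i) (simp_all add: adjacent_butlast)
    have uv: "(?u, ?v) \<in> adjacent ^^ r" by (rule relpow_adjacent_map[OF fp d])
    have "(?v, (butlast ^^ j) (pos x)) \<in> adjacent"
      using reduced_funpow_butlast[OF reduced_pos, of _ x] reduced_pos[of x]
      by (cases j) (auto simp: adjacent_def reduced_butlast)
    with uv have "(?u, pos (contraction (Suc j) x)) \<in> adjacent ^^ Suc r"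
      unfolding pos_contraction diff_Suc_1 by (rule relpow_Suc_I)
    moreover have "(?u, pos (contraction j x)) \<in> adjacent ^^ Suc r"
      unfolding pos_contraction by (rule relpow_adjacent_Suc[OF uv u(1)])
    ultimately show ?thesis using B'(2) contraction_closed[OF xG] by blast
  qed
  then show ?thesis using B'(1) by blast
qed

text \<open>The stage of radius \<open>Suc r\<close> works in every degree k, so q is arbitrary. The
  base vertex is the identity, which all steps of the contraction fix.\<close>

lemma good_connected:
  assumes "good c"
  shows "essentially_connected q {C. compactin \<T> C} (\<subseteq>) (EE (carrier \<G>)) (translates \<G> (halfspace c))"
  unfolding essentially_connected_def
proof (intro bexI[of _ "[lift []]"] allI impI ballI)
  fix k C assume C: "C \<in> {C. compactin \<T> C}" and y: "[lift []] \<in> simplices (translates \<G> (halfspace c) C) 0"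
  have Cc: "compactin \<T> C" using C by simp
  obtain r where r: "C \<subseteq> coset_ball r" by (rule compactin_subset_coset_ball[OF Cc])
  have yK: "lift [] \<in> \<Union> (family c C)" using y by (auto simp: translates_family simplices_cover_sset)
  have sub: "C \<subseteq> coset_ball (Suc r)" using r by (auto simp: coset_ball_def)
  show "\<exists>D\<in>{C. compactin \<T> C}. C \<subseteq> D \<and>
      (\<forall>cl\<in>homotopy_group k (realization (translates \<G> (halfspace c) C)) (vertex_point (translates \<G> (halfspace c) C) [lift []]).
         homotopy_induced k (realization (translates \<G> (halfspace c) D)) (vertex_point (translates \<G> (halfspace c) D) [lift []])
           (realization_incl (translates \<G> (halfspace c) D)) cl
         = homotopy_one k (realization (translates \<G> (halfspace c) D)) (vertex_point (translates \<G> (halfspace c) D) [lift []]))"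
    unfolding translates_family
    by (intro bexI[of _ "coset_ball (Suc r)"] conjI sub ballI
        homotopy_trivial[where f = contraction, OF _ contraction_base contraction_eventually
          contraction_contiguous[OF assms r] yK])
       (simp_all add: compactin_coset_ball)
qed (simp add: EE_def)

lemma good_acyclic:
  assumes "good c"
  shows "essentially_acyclic TYPE('r::comm_ring_1) q {C. compactin \<T> C} (\<subseteq>) (translates \<G> (halfspace c))"
  unfolding essentially_acyclic_def
proof (intro allI impI ballI)
  fix k C assume C: "C \<in> {C. compactin \<T> C}"
  have Cc: "compactin \<T> C" using C by simp
  obtain r where r: "C \<subseteq> coset_ball r" by (rule compactin_subset_coset_ball[OF Cc])
  have sub: "C \<subseteq> coset_ball (Suc r)" using r by (auto simp: coset_ball_def)
  show "\<exists>D\<in>{C. compactin \<T> C}. C \<subseteq> D \<and>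
      (\<forall>cl\<in>carrier (reduced_homology k (translates \<G> (halfspace c) C) :: (_ \<Rightarrow>\<^sub>0 'r) set monoid).
        homology_incl k (translates \<G> (halfspace c) D) cl = \<one>\<^bsub>reduced_homology k (translates \<G> (halfspace c) D)\<^esub>)"
    unfolding translates_family
    by (intro bexI[of _ "coset_ball (Suc r)"] conjI sub ballI
        homology_trivial[where f = contraction, OF _ contraction_eventually contraction_contiguous[OF assms r]])
       (simp_all add: compactin_coset_ball)
qed

text \<open>Here \<phi> is the indicator of the branch beyond a path of R + 1 edges leading out of
  the half tree. Members of the stage have radius R around a vertex of the half tree, so \<phi> is
  constant on them; \<open>bad_vertex\<close> supplies a half space element inside the branch, and
  the identity lies outside.\<close>

lemma bad_separation:
  assumes c: "\<not> good c" and D: "D \<subseteq> coset_ball R"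
  obtains \<phi> z where "z \<in> halfspace c" "\<phi> (lift []) \<noteq> \<phi> z"
    "\<forall>B\<in>family c D. \<forall>u\<in>B. \<forall>v\<in>B. \<phi> u = (\<phi> v :: bool)"
proof -
  \<comment> \<open>The direction in which the half tree opens; c = 0 is good and hence
    excluded.\<close>
  define b where "b = (c > 0)"
  have m2: "\<bar>modulus b\<bar> \<ge> 2" using c m0 n0 by (auto simp: good_def b_def modulus_def)
  have sg: "0 \<le> (if b then 1 else - 1) * h" if "0 \<le> c * h" for h :: real
    using that c by (auto simp: b_def good_def zero_le_mult_iff)
  define \<phi> where "\<phi> x = prefix (replicate (Suc R) (0, \<not> b)) (pos x)" for x
  obtain z where z: "reduced z" "height z = 0" "prefix (replicate (Suc R) (0, \<not> b)) z"
    by (rule bad_vertex[OF m2])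
  have "\<phi> (lift z)" "\<not> \<phi> (lift [])" using z by (simp_all add: \<phi>_def pos_lift)
  moreover have "lift z \<in> halfspace c" using z by (simp add: halfspace_eq pos_lift)
  moreover have "\<phi> u = \<phi> v" if B: "B \<in> family c D" and uv: "u \<in> B" "v \<in> B" for B u v
  proof -
    obtain g where g: "0 \<le> c * height (pos g)"
      and near: "\<forall>x\<in>B. x \<in> carrier \<G> \<and> (pos g, pos x) \<in> adjacent ^^ R"
      by (rule family_near[OF B D])
    have "\<phi> x \<longleftrightarrow> \<phi> g" if "x \<in> B" for x
      using prefix_locally_constant[of "pos g" "pos x" R R b] near that sg[OF g] by (simp add: \<phi>_def)
    then show ?thesis using uv by blast
  qed
  ultimately show ?thesis using that[of "lift z" \<phi>] by blast
qed

lemma halfspace_family: "g \<in> halfspace c \<Longrightarrow> lift [] \<in> C \<Longrightarrow> g \<in> \<Union> (family c C)"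
proof -
  assume g: "g \<in> halfspace c" "lift [] \<in> C"
  then have "g = g \<otimes>\<^bsub>\<G>\<^esub> lift []" using lift_one by (simp add: halfspace_eq)
  then show ?thesis using g unfolding family_def by blast
qed

lemma lift_halfspace: "lift [] \<in> halfspace c"
  by (simp add: halfspace_eq pos_lift)

lemma bad_not_connected:
  assumes c: "\<not> good c" and q: "0 \<le> q"
  shows "\<not> essentially_connected q {C. compactin \<T> C} (\<subseteq>) (EE (carrier \<G>)) (translates \<G> (halfspace c))"
proof
  assume "essentially_connected q {C. compactin \<T> C} (\<subseteq>) (EE (carrier \<G>)) (translates \<G> (halfspace c))"
  then obtain yl where yl: "yl \<in> simplices (EE (carrier \<G>)) 0" and
    tr: "\<And>C. compactin \<T> C \<Longrightarrow> yl \<in> simplices (cover_sset (family c C)) 0 \<Longrightarrow>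
      \<exists>D. compactin \<T> D \<and> C \<subseteq> D \<and>
      (\<forall>cl\<in>homotopy_group 0 (realization (cover_sset (family c C))) (vertex_point (cover_sset (family c C)) yl).
         homotopy_induced 0 (realization (cover_sset (family c D))) (vertex_point (cover_sset (family c D)) yl)
           (realization_incl (cover_sset (family c D))) cl
         = homotopy_one 0 (realization (cover_sset (family c D))) (vertex_point (cover_sset (family c D)) yl))"
    using q unfolding essentially_connected_def translates_family
    by (elim bexE) (drule spec[of _ 0], auto)
  obtain y where y: "yl = [y]" "y \<in> carrier \<G>" using yl by (auto simp: EE_def length_Suc_conv)
  \<comment> \<open>The base vertex y is prescribed by the assumption and may be any element.
    Including y puts it into the stage as the translate by the identity; including the identity puts
    the whole half space there.\<close>
  let ?C = "{y, lift []}"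
  have cpt: "compactin \<T> ?C" by (rule finite_imp_compactin) (use y in \<open>auto simp: topspace_T\<close>)
  have yK: "y \<in> \<Union> (family c ?C)"
    using lift_halfspace[of c] lift_one(1)[OF y(2)] unfolding family_def by (auto intro!: bexI[of _ "lift []"])
  then have "yl \<in> simplices (cover_sset (family c ?C)) 0" by (simp add: y simplices_cover_sset)
  from tr[OF cpt this] obtain D where D: "compactin \<T> D" "?C \<subseteq> D"
    and triv: "\<forall>cl\<in>homotopy_group 0 (realization (cover_sset (family c ?C))) (vertex_point (cover_sset (family c ?C)) [y]).
         homotopy_induced 0 (realization (cover_sset (family c D))) (vertex_point (cover_sset (family c D)) [y])
           (realization_incl (cover_sset (family c D))) cl
         = homotopy_one 0 (realization (cover_sset (family c D))) (vertex_point (cover_sset (family c D)) [y])"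
    unfolding y(1) by blast
  obtain R where R: "D \<subseteq> coset_ball R" by (rule compactin_subset_coset_ball[OF D(1)])
  obtain \<phi> z where z: "z \<in> halfspace c" "\<phi> (lift []) \<noteq> \<phi> z"
    and loc: "\<forall>B\<in>family c D. \<forall>u\<in>B. \<forall>v\<in>B. \<phi> u = (\<phi> v :: bool)"
    by (rule bad_separation[OF c R])
  \<comment> \<open>As \<phi> takes both values on the half space, one of z and
    \<open>lift []\<close> is separated from y.\<close>
  obtain w where w: "w \<in> halfspace c" "\<phi> y \<noteq> \<phi> w" using z lift_halfspace by (cases "\<phi> y = \<phi> z") auto
  have "\<exists>cl\<in>homotopy_group 0 (realization (cover_sset (family c ?C))) (vertex_point (cover_sset (family c ?C)) [y]).
         homotopy_induced 0 (realization (cover_sset (family c D))) (vertex_point (cover_sset (family c D)) [y])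
           (realization_incl (cover_sset (family c D))) cl
         \<noteq> homotopy_one 0 (realization (cover_sset (family c D))) (vertex_point (cover_sset (family c D)) [y])"
  proof (rule pi0_nontrivial[of _ _ \<phi> y w])
    show "\<exists>B'\<in>family c D. B \<subseteq> B'" if "B \<in> family c ?C" for B by (rule family_mono[OF D(2) that])
    show "\<phi> u = \<phi> v" if "B \<in> family c D" "u \<in> B" "v \<in> B" for B u v using loc that by blast
    show "w \<in> \<Union> (family c ?C)" by (rule halfspace_family) (use w in auto)
  qed (rule yK, rule w)
  then show False using triv by blast
qed

lemma bad_not_acyclic:
  assumes c: "\<not> good c" and q: "0 \<le> q"
  shows "\<not> essentially_acyclic TYPE('r::comm_ring_1) q {C. compactin \<T> C} (\<subseteq>) (translates \<G> (halfspace c))"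
proof
  assume a: "essentially_acyclic TYPE('r) q {C. compactin \<T> C} (\<subseteq>) (translates \<G> (halfspace c))"
  let ?C = "{lift []}"
  have "int 0 \<le> q" "?C \<in> {C. compactin \<T> C}"
    using q by (auto simp: topspace_T intro!: finite_imp_compactin)
  from a[unfolded essentially_acyclic_def translates_family, rule_format, OF this]
  obtain D where D: "compactin \<T> D" "?C \<subseteq> D" and
    triv: "\<forall>cl\<in>carrier (reduced_homology 0 (cover_sset (family c ?C)) :: (_ \<Rightarrow>\<^sub>0 'r) set monoid).
        homology_incl 0 (cover_sset (family c D)) cl = \<one>\<^bsub>reduced_homology 0 (cover_sset (family c D))\<^esub>"
    by (elim bexE conjE) (simp only: mem_Collect_eq)
  obtain R where R: "D \<subseteq> coset_ball R" by (rule compactin_subset_coset_ball[OF D(1)])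
  obtain \<phi> z where z: "z \<in> halfspace c" "\<phi> (lift []) \<noteq> \<phi> z"
    and loc: "\<forall>B\<in>family c D. \<forall>u\<in>B. \<forall>v\<in>B. \<phi> u = (\<phi> v :: bool)"
    by (rule bad_separation[OF c R])
  have "\<exists>cl\<in>carrier (reduced_homology 0 (cover_sset (family c ?C)) :: (_ \<Rightarrow>\<^sub>0 'r) set monoid).
        homology_incl 0 (cover_sset (family c D)) cl \<noteq> \<one>\<^bsub>reduced_homology 0 (cover_sset (family c D))\<^esub>"
  proof (rule homology_0_nontrivial[of _ \<phi> "lift []" _ z])
    show "\<phi> u = \<phi> v" if "B \<in> family c D" "u \<in> B" "v \<in> B" for B u v using loc that by blast
    show "lift [] \<in> \<Union> (family c ?C)" "z \<in> \<Union> (family c ?C)"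
      by (rule halfspace_family; use z lift_halfspace in simp)+
  qed (rule z)
  then show False using triv by blast
qed

lemma Sigma_top_eq: "k \<ge> 1 \<Longrightarrow> Sigma_top k \<G> \<T> = {scale_character \<G> c (tau_bar m n) | c. good c}"
  using good_connected[of _ "int k - 1"] bad_not_connected[of _ "int k - 1"]
  unfolding Sigma_top_def characters_eq by auto

lemma Sigma_top_hom_eq:
  "k \<ge> 1 \<Longrightarrow> Sigma_top_hom TYPE('r::comm_ring_1) k \<G> \<T> = {scale_character \<G> c (tau_bar m n) | c. good c}"
  using good_acyclic[of _ "int k - 1", where 'r = 'r] bad_not_acyclic[of _ "int k - 1", where 'r = 'r]
  unfolding Sigma_top_hom_def characters_eq by auto

text \<open>Here q = - 1 and both conditions are vacuous, apart from the existence of a vertex in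
  the homotopical one, for which the identity serves.\<close>

lemma Sigma_top_0: "Sigma_top 0 \<G> \<T> = characters \<G> \<T>"
  and Sigma_top_hom_0: "Sigma_top_hom TYPE('r::comm_ring_1) 0 \<G> \<T> = characters \<G> \<T>"
proof -
  have "[lift []] \<in> simplices (EE (carrier \<G>)) 0" by (simp add: EE_def)
  then show "Sigma_top 0 \<G> \<T> = characters \<G> \<T>"
    unfolding Sigma_top_def essentially_connected_def by auto
  show "Sigma_top_hom TYPE('r) 0 \<G> \<T> = characters \<G> \<T>"
    unfolding Sigma_top_hom_def essentially_acyclic_def by auto
qed

end

theorem proposition6p2:
  fixes m n :: int
  assumes "m \<noteq> 0" and "n \<noteq> 0"
  shows
    "(\<bar>m * n\<bar> = 1 \<longrightarrow> (\<forall>k\<ge>1. Sigma_top k (G_BS m n) (T_BS m n) =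
        {scale_character (G_BS m n) c (tau_bar m n) | c. True})) \<and>
     (\<bar>m\<bar> = 1 \<and> \<bar>n\<bar> \<ge> 2 \<longrightarrow> (\<forall>k\<ge>1. Sigma_top k (G_BS m n) (T_BS m n) =
        {scale_character (G_BS m n) c (tau_bar m n) | c. c \<le> 0})) \<and>
     (\<bar>m\<bar> \<ge> 2 \<and> \<bar>n\<bar> = 1 \<longrightarrow> (\<forall>k\<ge>1. Sigma_top k (G_BS m n) (T_BS m n) =
        {scale_character (G_BS m n) c (tau_bar m n) | c. c \<ge> 0})) \<and>
     (\<bar>m\<bar> \<ge> 2 \<and> \<bar>n\<bar> \<ge> 2 \<longrightarrow> (\<forall>k\<ge>1. Sigma_top k (G_BS m n) (T_BS m n) =
        {zero_character (G_BS m n)})) \<and>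
     (\<forall>k. Sigma_top_hom TYPE('r::comm_ring_1) k (G_BS m n) (T_BS m n) =
        Sigma_top k (G_BS m n) (T_BS m n))"
proof -
  interpret baumslag_solitar m n by unfold_locales (use assms in auto)
  have g1: "good c" if "\<bar>m * n\<bar> = 1" for c
    using that by (auto simp: good_def abs_mult zmult_eq_1_iff)
  have g2: "good c \<longleftrightarrow> c \<le> 0" if "\<bar>m\<bar> = 1 \<and> \<bar>n\<bar> \<ge> 2" for c
    using that by (auto simp: good_def)
  have g3: "good c \<longleftrightarrow> c \<ge> 0" if "\<bar>m\<bar> \<ge> 2 \<and> \<bar>n\<bar> = 1" for c
    using that by (auto simp: good_def)
  have g4: "good c \<longleftrightarrow> c = 0" if "\<bar>m\<bar> \<ge> 2 \<and> \<bar>n\<bar> \<ge> 2" for c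
    using that by (auto simp: good_def)
  have z: "scale_character (G_BS m n) 0 (tau_bar m n) = zero_character (G_BS m n)"
    by (simp add: scale_character_def zero_character_def)
  have "Sigma_top_hom TYPE('r) k (G_BS m n) (T_BS m n) = Sigma_top k (G_BS m n) (T_BS m n)" for k
    using Sigma_top_eq[of k] Sigma_top_hom_eq[of k, where 'r = 'r] Sigma_top_0 Sigma_top_hom_0[where 'r = 'r]
    by (cases "k = 0") auto
  then show ?thesis
    using g1 g2 g3 g4 z by (intro conjI allI impI) (simp_all add: Sigma_top_eq)
qed

end
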